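(* Let the Pick matrix $P$ of an interpolation data set $\Omega$ be invertible. A function $w$ meromorphic on $\mathbb{C}^+$ of the form $w=\mathbf{T}_\Theta[\varphi]$ with $\varphi\in\widetilde{\mathbf{N}}_0$ is a solution of the Boundary Interpolation Problem with equality for $\Omega$ if and only if the corresponding parameter $\varphi$ meets, at each interpolation node $x_i$, condition $\mathbf C_1$ or $\mathbf C_2$ (if $\tilde e_i\ne0$), respectively $\widetilde{\mathbf C}_1$ or $\widetilde{\mathbf C}_2$ (if $\tilde e_i=0$).
   Context: Classes. $\mathbb{C}^+$ is the open upper half plane. For $w$ meromorphic on $\mathbb{C}^+$, $\rho(w)\subset\mathbb{C}^+$ is its domain of analyticity and $K_w(z,\zeta)=\frac{w(z)-\overline{w(\zeta)}}{z-\bar\zeta}$. For an integer $\kappa\ge 0$, $\mathbf{N}_\kappa$ is the set of $w$ meromorphic on $\mathbb{C}^+$ such that all matrices $[K_w(z_j,z_i)]_{i,j=1}^m$ ($m\ge1$, $z_i\in\rho(w)$) have at most $\kappa$ negative eigenvalues, and at least one has exactly $\kappa$; $\mathbf{N}_0$ is the Nevanlinna class. $\widetilde{\mathbf{N}}_0=\mathbf{N}_0\cup\{\infty\}$, where $\infty$ is the function identically $\infty$. $\mathrm{sq}_-A$ is the number of negative eigenvalues of a Hermitian matrix $A$. Boundary limits. For $x\in\mathbb{R}$, $f(x)$, $f'(x)$, $f_{-1}(x)$ and $K_f(x,x)$ denote the nontangential limits as $z\to x$ of $f(z)$, $f'(z)$, $(z-x)f(z)$ and $K_f(z,z)$, when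 they exist. If $f\equiv\infty$, then $f_{-1}(x)=\infty$. Data. $\Omega$ consists of distinct real numbers $x_1,\dots,x_n$ (nodes), an integer $0\le\ell\le n$, $w_j,\gamma_j\in\mathbb{R}$ $(1\le j\le\ell)$, $\xi_k\in\mathbb{R}\setminus\{0\}$ $(\ell<k\le n)$. The Pick matrix $P=[p_{ij}]_{i,j=1}^n$ is the real symmetric matrix with: $p_{ij}=\frac{w_j-w_i}{x_j-x_i}$ for $i\ne j$ and $p_{ii}=\gamma_i$, for $i,j\le\ell$; $p_{ij}=p_{ji}=\frac{\xi_j}{x_j-x_i}$ for $i\le\ell<j$; $p_{ii}=-\xi_i$ and $p_{ij}=0$ $(i\neq j)$ for $i,j>\ell$. Also $X=\mathrm{diag}(x_1,\dots,x_n)$, $C=[w_1\ \cdots\ w_\ell\ \xi_{\ell+1}\ \cdots\ \xi_n]$, $E=[1\ \cdots\ 1\ 0\ \cdots\ 0]$ ($\ell$ ones), $J=\begin{bmatrix}0&-i\\ i&0\end{bmatrix}$. For $P$ invertible, $\Theta(z)=[\Theta_{ij}(z)]_{i,j=1}^2=I_2-i\begin{bmatrix}C\\ E\end{bmatrix}(zI-X)^{-1}P^{-1}\begin{bmatrix}C^*&E^*\end{bmatrix}J$ and $\mathbf{T}_\Theta[\varphi]=\frac{\Theta_{11}\varphi+\Theta_{12}}{\Theta_{21}\varphi+\Theta_{22}}$, with $\mathbf{T}_\Theta[\infty]=\Theta_{11}/\Theta_{21}$. Boundary Interpolation Problem with equality: find all $w\in\mathbf{N}_\kappa$, $\kappa=\mathrm{sq}_-P$,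 such that $w(x_i)=w_i$ and $w'(x_i)=\gamma_i$ for $i=1,\dots,\ell$ and $w_{-1}(x_j)=\xi_j$ for $j=\ell+1,\dots,n$. Let $\tilde c_i$, $\tilde e_i$ be the $i$-th entries of the row vectors $CP^{-1}$, $EP^{-1}$ (real, not both zero) and $\eta_i=\tilde c_i/\tilde e_i$. Conditions on $\varphi\in\widetilde{\mathbf{N}}_0$ at $x_i$: when $\tilde e_i\ne0$: $\mathbf C_1$: the limit $\varphi(x_i)$ does not exist, or exists and is not equal to $\eta_i$; $\mathbf C_2$: $\varphi(x_i)=\eta_i$ and $K_\varphi(x_i,x_i)=\infty$; when $\tilde e_i=0$: $\widetilde{\mathbf C}_1$: it is not the case that the limit $\varphi(x_i)$ exists and equals $\infty$; $\widetilde{\mathbf C}_2$: $\varphi(x_i)=\infty$ and $\varphi_{-1}(x_i)=0$. *)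

theory Defs
  imports
    "HOL-Complex_Analysis.Meromorphic"
    "Jordan_Normal_Form.Char_Poly"
    "Jordan_Normal_Form.Gauss_Jordan_Elimination"
    "Jordan_Normal_Form.Schur_Decomposition"
begin

(* Adjoins a point at infinity. It serves both for limit values in the Riemann sphere and
   for function classes enlarged by the function identically equal to infinity. *)
datatype 'a with_infty = Value 'a | Infty


section \<open>Generalized Nevanlinna classes\<close>

definition upper_half_plane :: "complex set" where
  "upper_half_plane = {z. Im z > 0}"

(* Meromorphic functions on the upper half plane are represented by total functions that are
   nicely_meromorphic_on it: removable singularities are removed, and the value at a pole is
   the dummy 0. Hence the points of analyticity are exactly those that are not poles. *)
definition analyticity_domain :: "(complex \<Rightarrow> complex) \<Rightarrow> complex set" where
  "analyticity_domain w = {z \<in> upper_half_plane. w analytic_on {z}}"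

definition pick_kernel :: "(complex \<Rightarrow> complex) \<Rightarrow> complex \<Rightarrow> complex \<Rightarrow> complex" where
  "pick_kernel w z \<zeta> = (w z - cnj (w \<zeta>)) / (z - cnj \<zeta>)"

definition kernel_matrix :: "(complex \<Rightarrow> complex) \<Rightarrow> complex list \<Rightarrow> complex mat" where
  "kernel_matrix w zs =
     Matrix.mat (length zs) (length zs) (\<lambda>(i, j). pick_kernel w (zs ! j) (zs ! i))"

(* Negative eigenvalues counted with multiplicity. For Hermitian matrices, the only ones
   to which this is applied, algebraic and geometric multiplicity agree. *)
definition sq_neg :: "complex mat \<Rightarrow> nat" where
  "sq_neg A = size {#\<mu> \<in># proots (char_poly A). \<mu> \<in> \<real> \<and> Re \<mu> < 0#}"

definition nevanlinna :: "nat \<Rightarrow> (complex \<Rightarrow> complex) set" where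
  "nevanlinna \<kappa> = {w. w nicely_meromorphic_on upper_half_plane \<and>
     (\<forall>zs. zs \<noteq> [] \<and> set zs \<subseteq> analyticity_domain w \<longrightarrow> sq_neg (kernel_matrix w zs) \<le> \<kappa>) \<and>
     (\<exists>zs. zs \<noteq> [] \<and> set zs \<subseteq> analyticity_domain w \<and> sq_neg (kernel_matrix w zs) = \<kappa>)}"

definition extended_nevanlinna :: "(complex \<Rightarrow> complex) with_infty set" where
  "extended_nevanlinna = insert Infty (Value ` nevanlinna 0)"


section \<open>Nontangential boundary limits\<close>

definition stolz_sector :: "real \<Rightarrow> real \<Rightarrow> complex set" where
  "stolz_sector x M = {z. Im z > 0 \<and> \<bar>Re z - x\<bar> \<le> M * Im z}"

definition nt_limit :: "(complex \<Rightarrow> complex) \<Rightarrow> real \<Rightarrow> complex with_infty \<Rightarrow> bool" where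
  "nt_limit f x L \<longleftrightarrow> (\<forall>M>0. filterlim f
     (case L of Value l \<Rightarrow> nhds l | Infty \<Rightarrow> at_infinity)
     (at (complex_of_real x) within stolz_sector x M))"

(* The next two say that phi(x) = L and phi_{-1}(x) = L. For phi identically infinite,
   both boundary values are infinite. *)
definition boundary_value ::
    "(complex \<Rightarrow> complex) with_infty \<Rightarrow> real \<Rightarrow> complex with_infty \<Rightarrow> bool" where
  "boundary_value \<phi> x L \<longleftrightarrow> (case \<phi> of Value f \<Rightarrow> nt_limit f x L | Infty \<Rightarrow> L = Infty)"

definition boundary_residue ::
    "(complex \<Rightarrow> complex) with_infty \<Rightarrow> real \<Rightarrow> complex with_infty \<Rightarrow> bool" where
  "boundary_residue \<phi> x L \<longleftrightarrow>
     (case \<phi> of Value f \<Rightarrow> nt_limit (\<lambda>z. (z - of_real x) * f z) x L | Infty \<Rightarrow> L = Infty)"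

(* K_phi(x,x) = L; the kernel of the infinite function is undefined, so it has no limit. *)
definition boundary_kernel ::
    "(complex \<Rightarrow> complex) with_infty \<Rightarrow> real \<Rightarrow> complex with_infty \<Rightarrow> bool" where
  "boundary_kernel \<phi> x L \<longleftrightarrow>
     (case \<phi> of Value f \<Rightarrow> nt_limit (\<lambda>z. pick_kernel f z z) x L | Infty \<Rightarrow> False)"


section \<open>Interpolation data\<close>

(* Indices start at 0: the nodes with index i < ell are regular (prescribed value and
   derivative), those with ell <= i < num are singular (prescribed residue). The entries
   of the fields at other indices are irrelevant. *)
record interp_data =
  num :: nat
  ell :: nat
  node :: "nat \<Rightarrow> real"
  val :: "nat \<Rightarrow> real"
  dval :: "nat \<Rightarrow> real"
  res :: "nat \<Rightarrow> real"

definition interpolation_data :: "interp_data \<Rightarrow> bool" where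
  "interpolation_data \<Omega> \<longleftrightarrow> 1 \<le> num \<Omega> \<and> ell \<Omega> \<le> num \<Omega> \<and> inj_on (node \<Omega>) {..<num \<Omega>} \<and>
     (\<forall>k. ell \<Omega> \<le> k \<and> k < num \<Omega> \<longrightarrow> res \<Omega> k \<noteq> 0)"

definition pick_entry :: "interp_data \<Rightarrow> nat \<Rightarrow> nat \<Rightarrow> real" where
  "pick_entry \<Omega> i j =
     (if i < ell \<Omega> \<and> j < ell \<Omega> then
        (if i = j then dval \<Omega> i else (val \<Omega> j - val \<Omega> i) / (node \<Omega> j - node \<Omega> i))
      else if i < ell \<Omega> then res \<Omega> j / (node \<Omega> j - node \<Omega> i)
      else if j < ell \<Omega> then res \<Omega> i / (node \<Omega> i - node \<Omega> j)
      else if i = j then - res \<Omega> i else 0)"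

definition pick_matrix :: "interp_data \<Rightarrow> complex mat" where
  "pick_matrix \<Omega> = Matrix.mat (num \<Omega>) (num \<Omega>) (\<lambda>(i, j). complex_of_real (pick_entry \<Omega> i j))"

definition node_matrix :: "interp_data \<Rightarrow> complex mat" where
  "node_matrix \<Omega> = mat_diag (num \<Omega>) (\<lambda>i. complex_of_real (node \<Omega> i))"

definition C_row :: "interp_data \<Rightarrow> complex mat" where
  "C_row \<Omega> = Matrix.mat 1 (num \<Omega>)
     (\<lambda>(_, j). complex_of_real (if j < ell \<Omega> then val \<Omega> j else res \<Omega> j))"

definition E_row :: "interp_data \<Rightarrow> complex mat" where
  "E_row \<Omega> = Matrix.mat 1 (num \<Omega>) (\<lambda>(_, j). if j < ell \<Omega> then 1 else 0)"

definition J_matrix :: "complex mat" where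
  "J_matrix = mat_of_rows_list 2 [[0, - \<i>], [\<i>, 0]]"

(* Only meaningful for invertible matrices. *)
definition inv_mat :: "complex mat \<Rightarrow> complex mat" where
  "inv_mat A = the (mat_inverse A)"

definition Theta :: "interp_data \<Rightarrow> complex \<Rightarrow> complex mat" where
  "Theta \<Omega> z =
     1\<^sub>m 2 - \<i> \<cdot>\<^sub>m ((C_row \<Omega> @\<^sub>r E_row \<Omega>) * inv_mat (z \<cdot>\<^sub>m 1\<^sub>m (num \<Omega>) - node_matrix \<Omega>)
        * inv_mat (pick_matrix \<Omega>) * mat_adjoint (C_row \<Omega> @\<^sub>r E_row \<Omega>) * J_matrix)"


section \<open>The linear fractional transformation\<close>

definition lft_num ::
    "(complex \<Rightarrow> complex mat) \<Rightarrow> (complex \<Rightarrow> complex) with_infty \<Rightarrow> complex \<Rightarrow> complex" where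
  "lft_num \<Theta> \<phi> z =
     (case \<phi> of Value f \<Rightarrow> \<Theta> z $$ (0, 0) * f z + \<Theta> z $$ (0, 1) | Infty \<Rightarrow> \<Theta> z $$ (0, 0))"

definition lft_den ::
    "(complex \<Rightarrow> complex mat) \<Rightarrow> (complex \<Rightarrow> complex) with_infty \<Rightarrow> complex \<Rightarrow> complex" where
  "lft_den \<Theta> \<phi> z =
     (case \<phi> of Value f \<Rightarrow> \<Theta> z $$ (1, 0) * f z + \<Theta> z $$ (1, 1) | Infty \<Rightarrow> \<Theta> z $$ (1, 0))"

(* Equality of w with the transform as meromorphic functions on the upper half plane, that is,
   away from isolated points. The denominator must not vanish identically, since otherwise
   the transform would be the constant infinity and not a meromorphic function. *)
definition is_lft ::
    "(complex \<Rightarrow> complex mat) \<Rightarrow> (complex \<Rightarrow> complex) with_infty \<Rightarrow> (complex \<Rightarrow> complex) \<Rightarrow> bool" where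
  "is_lft \<Theta> \<phi> w \<longleftrightarrow>
     (\<forall>\<^sub>\<approx>z\<in>upper_half_plane. lft_den \<Theta> \<phi> z \<noteq> 0 \<and> w z = lft_num \<Theta> \<phi> z / lft_den \<Theta> \<phi> z)"


section \<open>The interpolation problem and the conditions on the parameter\<close>

definition solves_BIP :: "interp_data \<Rightarrow> (complex \<Rightarrow> complex) \<Rightarrow> bool" where
  "solves_BIP \<Omega> w \<longleftrightarrow> w \<in> nevanlinna (sq_neg (pick_matrix \<Omega>)) \<and>
     (\<forall>i<ell \<Omega>. nt_limit w (node \<Omega> i) (Value (of_real (val \<Omega> i))) \<and>
        nt_limit (deriv w) (node \<Omega> i) (Value (of_real (dval \<Omega> i)))) \<and>
     (\<forall>j. ell \<Omega> \<le> j \<and> j < num \<Omega> \<longrightarrow>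
        nt_limit (\<lambda>z. (z - of_real (node \<Omega> j)) * w z) (node \<Omega> j) (Value (of_real (res \<Omega> j))))"

(* The entries of C P^{-1} and E P^{-1}; they are real, although typed as complex numbers. *)
definition c_tilde :: "interp_data \<Rightarrow> nat \<Rightarrow> complex" where
  "c_tilde \<Omega> i = (C_row \<Omega> * inv_mat (pick_matrix \<Omega>)) $$ (0, i)"

definition e_tilde :: "interp_data \<Rightarrow> nat \<Rightarrow> complex" where
  "e_tilde \<Omega> i = (E_row \<Omega> * inv_mat (pick_matrix \<Omega>)) $$ (0, i)"

definition eta :: "interp_data \<Rightarrow> nat \<Rightarrow> complex" where
  "eta \<Omega> i = c_tilde \<Omega> i / e_tilde \<Omega> i"

definition cond_C1 :: "interp_data \<Rightarrow> (complex \<Rightarrow> complex) with_infty \<Rightarrow> nat \<Rightarrow> bool" where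
  "cond_C1 \<Omega> \<phi> i \<longleftrightarrow> (\<nexists>L. boundary_value \<phi> (node \<Omega> i) L) \<or>
     (\<exists>L. boundary_value \<phi> (node \<Omega> i) L \<and> L \<noteq> Value (eta \<Omega> i))"

definition cond_C2 :: "interp_data \<Rightarrow> (complex \<Rightarrow> complex) with_infty \<Rightarrow> nat \<Rightarrow> bool" where
  "cond_C2 \<Omega> \<phi> i \<longleftrightarrow> boundary_value \<phi> (node \<Omega> i) (Value (eta \<Omega> i)) \<and>
     boundary_kernel \<phi> (node \<Omega> i) Infty"

definition cond_C1_tilde :: "interp_data \<Rightarrow> (complex \<Rightarrow> complex) with_infty \<Rightarrow> nat \<Rightarrow> bool" where
  "cond_C1_tilde \<Omega> \<phi> i \<longleftrightarrow> \<not> boundary_value \<phi> (node \<Omega> i) Infty"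

definition cond_C2_tilde :: "interp_data \<Rightarrow> (complex \<Rightarrow> complex) with_infty \<Rightarrow> nat \<Rightarrow> bool" where
  "cond_C2_tilde \<Omega> \<phi> i \<longleftrightarrow> boundary_value \<phi> (node \<Omega> i) Infty \<and>
     boundary_residue \<phi> (node \<Omega> i) (Value 0)"

end

(* Write phi = p/q with (p, q) = (phi, 1), or (1, 0) if phi is infinite, and put
   h_j = (e_j p - c_j q) / (z - x_j), where c = C P^{-1} and e = E P^{-1}. The Lyapunov identity
   P X - X P = E^* C - C^* E turns w = T_Theta[phi] into w = num/den with
   num = p + sum C_j h_j and den = q + sum E_j h_j, subject to two identities:
   (z - x_i) (P h)_i = E_i num - C_i den, and K_w den den^* = h^* P h + K_phi.
   If phi satisfies the condition at x_i, then h_i dominates p, q and all other h_j near x_i, so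
   num/h_i -> C_i, den/h_i -> E_i, and the first identity yields the boundary values of w at x_i.
   By the second identity the kernel matrix of w at points close to the nodes is then congruent
   to a small perturbation of P, and every kernel matrix is P compressed plus a nonnegative
   matrix; hence w has exactly as many negative squares as P.
   If phi violates the condition at x_i, then after scaling p, q and h converge along a sequence
   in a sector. The boundary values prescribed at x_i and the first identity force the limit of h
   to be a multiple of the i-th unit vector, and then the limits of p and q to vanish, which is
   impossible. *)
theory Submission
  imports Defs
begin

section \<open>Hermitian forms and negative eigenvalues\<close>

text \<open>The conditions at a node are translated into the size of the linear form L = e_i p - c_i
  q. \<open>good_node\<close> says that |z - x_i| (|p| + |q|) = o(|L|) in every sector;
  \<open>bad_node\<close> says that along some sequence in one sector, under a scaling for which (p,
  q) has a nonzero limit, L / (z - x_i) converges. That nothing lies between the two is a rigidity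
  property of Nevanlinna functions: by a Julia-Caratheodory estimate, |f - \<eta>| = O(|z - x_i|)
  along a single sequence in a single sector already forces f(x_i) = \<eta> and prevents the
  diagonal kernel from tending to infinity. A parameter without boundary value therefore falls on
  the good side without separate treatment, and e_i = 0 is reduced to the finite case by passing to
  -1/f. The identities control the difference quotient of w at a regular node, not w'. The two
  nontangential limits are exchanged separately: by Cauchy estimates in a wider sector, and by the
  mean value inequality in the convex sector.\<close>

lemma mat_adjoint_carrier:
  "(A :: complex mat) \<in> carrier_mat n m \<Longrightarrow> mat_adjoint A \<in> carrier_mat m n"
  by (auto simp: mat_adjoint_def)

lemma mat_adjoint_index:
  assumes "(A :: complex mat) \<in> carrier_mat n m" "i < m" "j < n"
  shows "mat_adjoint A $$ (i, j) = cnj (A $$ (j, i))"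
  using assms unfolding mat_adjoint_def by (auto simp: mat_of_rows_def)

lemma mat_adjoint_mult:
  assumes "(A :: complex mat) \<in> carrier_mat n m" "B \<in> carrier_mat m l"
  shows "mat_adjoint (A * B) = mat_adjoint B * mat_adjoint A"
proof (rule eq_matI)
  have AB: "A * B \<in> carrier_mat n l" using assms by simp
  note c = mat_adjoint_carrier[OF assms(1)] mat_adjoint_carrier[OF assms(2)] mat_adjoint_carrier[OF AB]
  show "dim_row (mat_adjoint (A * B)) = dim_row (mat_adjoint B * mat_adjoint A)"
       "dim_col (mat_adjoint (A * B)) = dim_col (mat_adjoint B * mat_adjoint A)"
    using c by auto
  fix i j assume "i < dim_row (mat_adjoint B * mat_adjoint A)" "j < dim_col (mat_adjoint B * mat_adjoint A)"
  hence ij: "i < l" "j < n" using c by auto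
  show "mat_adjoint (A * B) $$ (i, j) = (mat_adjoint B * mat_adjoint A) $$ (i, j)"
    using ij c assms mat_adjoint_index[OF AB ij(1) ij(2)] 
    by (auto simp: scalar_prod_def mat_adjoint_index[OF assms(1)] mat_adjoint_index[OF assms(2)] mult.commute
        intro!: sum.cong)
qed

lemma mat_adjoint_one [simp]: "mat_adjoint (1\<^sub>m n :: complex mat) = 1\<^sub>m n"
  by (rule eq_matI)
     (use mat_adjoint_carrier[OF one_carrier_mat, of n] in \<open>auto simp: mat_adjoint_index[OF one_carrier_mat]\<close>)

lemma mat_adjoint_adjoint [simp]: "mat_adjoint (mat_adjoint (A :: complex mat)) = A"
proof -
  have A: "A \<in> carrier_mat (dim_row A) (dim_col A)" by simp
  note A' = mat_adjoint_carrier[OF A]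
  show ?thesis
    by (rule eq_matI) (use mat_adjoint_carrier[OF A'] in \<open>auto simp: mat_adjoint_index[OF A'] mat_adjoint_index[OF A]\<close>)
qed

text \<open>Gram-Schmidt yields an orthogonal list that starts with \<open>v\<close> itself; the
  columns are normalized only afterwards, hence the factor \<open>c\<close>.\<close>

lemma unitary_completion:
  assumes v: "(v :: complex vec) \<in> carrier_vec n" "v \<noteq> 0\<^sub>v n"
  obtains U c where "U \<in> carrier_mat n n" "mat_adjoint U * U = 1\<^sub>m n" "U * mat_adjoint U = 1\<^sub>m n"
    "col U 0 = c \<cdot>\<^sub>v v"
proof -
  interpret cof_vec_space n "TYPE(complex)" .
  define b where "b = basis_completion v"
  define ws where "ws = gram_schmidt n b"
  have n0: "0 < n" using v by (cases n) auto
  from basis_completion[OF v, folded b_def]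
  have dist_b: "distinct b" and indep: "\<not> lin_dep (set b)" and b: "set b \<subseteq> carrier_vec n"
    and hdb: "hd b = v" and len_b: "length b = n" by auto
  from hdb len_b n0 obtain vs where bv: "b = v # vs" by (cases b, auto)
  from gram_schmidt_result[OF b dist_b indep refl, folded ws_def]
  have ws: "set ws \<subseteq> carrier_vec n" "corthogonal ws" "length ws = n" by (auto simp: len_b)
  from gram_schmidt_hd[OF v(1), of vs, folded bv] have hdws: "hd ws = v" unfolding ws_def .
  define s where "s i = complex_of_real (1 / sqrt (Re (ws ! i \<bullet>c ws ! i)))" for i
  define U where "U = Matrix.mat n n (\<lambda>(i, j). s j * (ws ! j) $ i)"
  have U: "U \<in> carrier_mat n n" by (simp add: U_def)
  have wsi: "ws ! i \<in> carrier_vec n" if "i < n" for i using ws that by auto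
  have scal: "(mat_adjoint U * U) $$ (i, j) = cnj (s i) * s j * (ws ! j \<bullet>c ws ! i)"
    if "i < n" "j < n" for i j
  proof -
    have "(mat_adjoint U * U) $$ (i, j) = (\<Sum>k<n. cnj (U $$ (k, i)) * U $$ (k, j))"
      using that mat_adjoint_carrier[OF U] U
      by (auto simp: scalar_prod_def mat_adjoint_index[OF U] atLeast0LessThan intro!: sum.cong)
    also have "\<dots> = cnj (s i) * s j * (ws ! j \<bullet>c ws ! i)"
      using that wsi[OF that(1)] wsi[OF that(2)]
      by (auto simp: scalar_prod_def U_def sum_distrib_left mult_ac atLeast0LessThan intro!: sum.cong)
    finally show ?thesis .
  qed
  have pos: "Re (ws ! i \<bullet>c ws ! i) > 0 \<and> Im (ws ! i \<bullet>c ws ! i) = 0" if "i < n" for i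
  proof -
    have "ws ! i \<bullet>c ws ! i \<noteq> 0" using corthogonalD[OF ws(2), of i i] that ws(3) by auto
    moreover have "ws ! i \<bullet>c ws ! i \<ge> 0" by (rule conjugate_square_ge_0_vec)
    ultimately show ?thesis by (auto simp: less_eq_complex_def complex_eq_iff)
  qed
  have 1: "mat_adjoint U * U = 1\<^sub>m n"
  proof (rule eq_matI)
    fix i j assume "i < dim_row (1\<^sub>m n :: complex mat)" "j < dim_col (1\<^sub>m n :: complex mat)"
    hence ij: "i < n" "j < n" by auto
    show "(mat_adjoint U * U) $$ (i, j) = 1\<^sub>m n $$ (i, j)"
    proof (cases "i = j")
      case True
      have "ws ! i \<bullet>c ws ! i = complex_of_real (Re (ws ! i \<bullet>c ws ! i))"
        using pos[OF ij(1)] by (auto simp: complex_eq_iff)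
      then obtain r where r: "ws ! i \<bullet>c ws ! i = complex_of_real r" "r > 0" using pos[OF ij(1)] by metis
      have "(mat_adjoint U * U) $$ (i, i) = complex_of_real (1 / sqrt r * (1 / sqrt r) * r)"
        unfolding scal[OF ij(1) ij(1)] s_def r
        by (simp only: of_real_mult complex_cnj_complex_of_real Re_complex_of_real)
      also have "1 / sqrt r * (1 / sqrt r) * r = 1" using r(2) by (simp add: field_simps)
      finally show ?thesis using True ij by simp
    next
      case False
      thus ?thesis unfolding scal[OF ij] using corthogonalD[OF ws(2), of j i] ij ws(3) by auto
    qed
  qed (use mat_adjoint_carrier[OF U] U in auto)
  have 2: "U * mat_adjoint U = 1\<^sub>m n"
    by (rule mat_mult_left_right_inverse[OF mat_adjoint_carrier[OF U] U 1])
  have "col U 0 = s 0 \<cdot>\<^sub>v v"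
  proof -
    have "ws ! 0 = v" using n0 hdws ws(3) by (cases ws) auto
    thus ?thesis using n0 v by (intro eq_vecI) (auto simp: U_def)
  qed
  from that[OF U 1 2 this] show ?thesis .
qed

definition hermitian :: "complex mat \<Rightarrow> bool" where
  "hermitian A \<longleftrightarrow> mat_adjoint A = A"

lemma hermitianI:
  assumes "A \<in> carrier_mat n n" "\<And>i j. i < n \<Longrightarrow> j < n \<Longrightarrow> A $$ (j, i) = cnj (A $$ (i, j))"
  shows "hermitian A"
  unfolding hermitian_def
  by (rule eq_matI)
     (use assms mat_adjoint_carrier[OF assms(1)] in \<open>auto simp: mat_adjoint_index[OF assms(1)] assms(2)[symmetric]\<close>)

lemma hermitianD:
  assumes "hermitian A" "A \<in> carrier_mat n n" "i < n" "j < n"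
  shows "A $$ (j, i) = cnj (A $$ (i, j))"
  using mat_adjoint_index[OF assms(2) assms(4) assms(3)] assms(1) by (simp add: hermitian_def)

text \<open>Deflation: conjugation by a unitary matrix whose first column is an eigenvector clears
  the first column below the diagonal, and hermiticity then clears the first row. The remaining
  block is Hermitian with eigenvalues \<open>es\<close>. The list is prescribed through the
  characteristic polynomial so that diagonal entries can later be counted with the multiplicities
  that \<open>sq_neg\<close> uses.\<close>

lemma hermitian_unitary_diagonalization:
  assumes "A \<in> carrier_mat n n" "hermitian A" "char_poly A = (\<Prod>e \<leftarrow> es. [:- e, 1:])"
  shows "\<exists>U \<in> carrier_mat n n. mat_adjoint U * U = 1\<^sub>m n \<and> U * mat_adjoint U = 1\<^sub>m n \<and>
           A = U * mat_diag n ((!) es) * mat_adjoint U"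
  using assms
proof (induction es arbitrary: n A)
  case Nil
  have "n = 0" using degree_monic_char_poly[OF Nil(1)] Nil(3) by simp
  with Nil(1) show ?case
    by (intro bexI[of _ "1\<^sub>m n"]) auto
next
  case (Cons e es n A)
  note A = Cons.prems(1)
  let ?n1 = "n - 1"
  have deg: "degree (char_poly A) = Suc (degree (\<Prod>e\<leftarrow>es. [:- e, 1:]))"
  proof -
    have "monic (\<Prod>e\<leftarrow>es. [:- e, 1:])" by (rule monic_prod_list) auto
    thus ?thesis unfolding Cons.prems(3) list.map prod_list.Cons
      by (subst degree_mult_eq) auto
  qed
  with degree_monic_char_poly[OF A] have n: "n = Suc ?n1" by auto
  have "eigenvalue A e" unfolding eigenvalue_root_char_poly[OF A] Cons.prems(3) by simp
  from find_eigenvector[OF A this] obtain v where "eigenvector A v e" by blast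
  hence v: "v \<in> carrier_vec n" "v \<noteq> 0\<^sub>v n" "A *\<^sub>v v = e \<cdot>\<^sub>v v"
    using A by (auto simp: eigenvector_def)
  obtain W c where W: "W \<in> carrier_mat n n" "mat_adjoint W * W = 1\<^sub>m n" "W * mat_adjoint W = 1\<^sub>m n"
    and col0: "col W 0 = c \<cdot>\<^sub>v v" by (rule unitary_completion[OF v(1,2)])
  note W' = mat_adjoint_carrier[OF W(1)]
  define A' where "A' = mat_adjoint W * A * W"
  have A': "A' \<in> carrier_mat n n" using W W' A by (auto simp: A'_def)
  have herm': "mat_adjoint A' = A'"
  proof -
    have "mat_adjoint A' = mat_adjoint W * mat_adjoint (mat_adjoint W * A)"
      unfolding A'_def using W W' A by (intro mat_adjoint_mult) auto
    also have "mat_adjoint (mat_adjoint W * A) = mat_adjoint A * mat_adjoint (mat_adjoint W)"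
      using W W' A by (intro mat_adjoint_mult) auto
    finally show ?thesis unfolding A'_def using Cons.prems(2) W W' A
      by (auto simp: hermitian_def assoc_mult_mat[of _ n n _ n _ n])
  qed
  have Aeq: "A = W * A' * mat_adjoint W"
  proof -
    have "W * A' * mat_adjoint W = (W * mat_adjoint W) * A * (W * mat_adjoint W)"
      unfolding A'_def using W(1) W' A by (simp add: assoc_mult_mat[of _ n n _ n _ n])
    thus ?thesis using W A by simp
  qed
  have c0: "A' $$ (i, 0) = (if i = 0 then e else 0)" if i: "i < n" for i
  proof -
    have "A' = mat_adjoint W * (A * W)" unfolding A'_def using W(1) W' A by simp
    hence "col A' 0 = mat_adjoint W *\<^sub>v col (A * W) 0"
      using W(1) W' A n by (auto intro!: col_mult2)
    also have "col (A * W) 0 = A *\<^sub>v col W 0" using W(1) A n by (auto intro!: col_mult2)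
    also have "\<dots> = e \<cdot>\<^sub>v col W 0" unfolding col0 using A v by (simp add: mult_mat_vec smult_smult_assoc mult.commute)
    also have "mat_adjoint W *\<^sub>v \<dots> = e \<cdot>\<^sub>v (mat_adjoint W *\<^sub>v col W 0)"
      using W W' n by (auto intro!: mult_mat_vec)
    also have "mat_adjoint W *\<^sub>v col W 0 = col (mat_adjoint W * W) 0" using W(1) W' n by (auto intro!: col_mult2[symmetric])
    finally have "col A' 0 = e \<cdot>\<^sub>v col (1\<^sub>m n) 0" unfolding W .
    from arg_cong[OF this, of "\<lambda>v. vec_index v i"] show ?thesis using i A' n by auto
  qed
  have r0: "A' $$ (0, i) = (if i = 0 then cnj e else 0)" if i: "i < n" for i
    using c0[OF i] mat_adjoint_index[OF A', of 0 i] herm' i n by auto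
  have ee: "cnj e = e" using c0[of 0] r0[of 0] n by simp
  define A3 where "A3 = Matrix.mat ?n1 ?n1 (\<lambda>(i, j). A' $$ (Suc i, Suc j))"
  define Z where "Z = (0\<^sub>m 1 ?n1 :: complex mat)"
  define Z' where "Z' = (0\<^sub>m ?n1 1 :: complex mat)"
  define E where "E = Matrix.mat 1 1 (\<lambda>_. e)"
  have cs: "A3 \<in> carrier_mat ?n1 ?n1" "Z \<in> carrier_mat 1 ?n1" "Z' \<in> carrier_mat ?n1 1" "E \<in> carrier_mat 1 1"
    by (auto simp: A3_def Z_def Z'_def E_def)
  have blk: "A' = four_block_mat E Z Z' A3"
    by (rule eq_matI) (use A' n c0 r0 ee in \<open>auto simp: E_def Z_def Z'_def A3_def less_Suc_eq_0_disj\<close>)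
  have "char_poly A' = char_poly A"
  proof (rule char_poly_similar)
    have "similar_mat_wit A' A (mat_adjoint W) W"
      using W W' A A' by (intro similar_mat_witI[of _ _ n]) (auto simp: A'_def)
    thus "similar_mat A' A" unfolding similar_mat_def by blast
  qed
  hence "char_poly E * char_poly A3 = [:- e, 1:] * (\<Prod>e\<leftarrow>es. [:- e, 1:])"
    unfolding Cons.prems(3) blk Z'_def using char_poly_four_block_zeros_col[OF cs(4) cs(2) cs(1)] by simp
  moreover have "char_poly E = [: -e,1 :]"
    by (simp add: E_def char_poly_defs Determinant.det_def sign_def)
  ultimately have cp3: "char_poly A3 = (\<Prod>e\<leftarrow>es. [:- e, 1:])"
    by (metis mult_cancel_left pCons_eq_0_iff zero_neq_one)
  have "mat_adjoint A3 = A3"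
  proof (rule eq_matI)
    fix i j assume "i < dim_row A3" "j < dim_col A3"
    hence ij: "i < ?n1" "j < ?n1" using cs by auto
    have "A' $$ (Suc i, Suc j) = cnj (A' $$ (Suc j, Suc i))"
      using mat_adjoint_index[OF A', of "Suc i" "Suc j"] herm' ij by auto
    thus "mat_adjoint A3 $$ (i, j) = A3 $$ (i, j)"
      unfolding mat_adjoint_index[OF cs(1) ij] using ij by (simp add: A3_def)
  qed (use cs mat_adjoint_carrier[OF cs(1)] in auto)
  hence "hermitian A3" by (simp add: hermitian_def)
  from Cons.IH[OF cs(1) this cp3] obtain U3 where U3: "U3 \<in> carrier_mat ?n1 ?n1"
    "mat_adjoint U3 * U3 = 1\<^sub>m ?n1" "U3 * mat_adjoint U3 = 1\<^sub>m ?n1"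
    and A3: "A3 = U3 * mat_diag ?n1 ((!) es) * mat_adjoint U3" by blast
  note U3' = mat_adjoint_carrier[OF U3(1)]
  define V where "V = four_block_mat (1\<^sub>m 1) Z Z' U3"
  have V: "V \<in> carrier_mat n n" using cs U3 n unfolding V_def by auto
  have V': "mat_adjoint V = four_block_mat (1\<^sub>m 1) Z Z' (mat_adjoint U3)" (is "_ = ?V'")
  proof (rule eq_matI)
    fix i j assume "i < dim_row ?V'" "j < dim_col ?V'"
    hence ij: "i < n" "j < n" using U3' n by auto
    show "mat_adjoint V $$ (i, j) = ?V' $$ (i, j)"
      unfolding mat_adjoint_index[OF V ij] using ij n U3(1) U3'
      by (auto simp: V_def mat_adjoint_index[OF U3(1)] Z_def Z'_def)
  qed (use mat_adjoint_carrier[OF V] n U3' in auto)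
  have one: "four_block_mat (1\<^sub>m 1) Z Z' (1\<^sub>m ?n1) = 1\<^sub>m n"
    by (rule eq_matI) (use n in \<open>auto simp: Z_def Z'_def less_Suc_eq_0_disj\<close>)
  have mult_blk: "four_block_mat X1 Z Z' Y1 * four_block_mat X2 Z Z' Y2 = four_block_mat (X1 * X2) Z Z' (Y1 * Y2)"
    if "X1 \<in> carrier_mat 1 1" "X2 \<in> carrier_mat 1 1" "Y1 \<in> carrier_mat ?n1 ?n1" "Y2 \<in> carrier_mat ?n1 ?n1"
    for X1 X2 Y1 Y2 :: "complex mat"
    using that cs by (subst mult_four_block_mat[of _ 1 1 _ ?n1 _ ?n1 _ _ 1 _ ?n1]) (auto simp: Z_def Z'_def)
  have V1: "mat_adjoint V * V = 1\<^sub>m n" "V * mat_adjoint V = 1\<^sub>m n"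
    unfolding V' unfolding V_def using U3 U3' by (auto simp: mult_blk one[simplified])
  have D: "mat_diag n ((!) (e # es)) = four_block_mat E Z Z' (mat_diag ?n1 ((!) es))"
    by (rule eq_matI) (use n in \<open>auto simp: Z_def Z'_def E_def mat_diag_def less_Suc_eq_0_disj\<close>)
  have Dc: "mat_diag ?n1 ((!) es) \<in> carrier_mat ?n1 ?n1" "mat_diag n ((!) (e # es)) \<in> carrier_mat n n" by (auto simp: mat_diag_def)
  have A'eq: "A' = V * mat_diag n ((!) (e # es)) * mat_adjoint V"
    unfolding V' D unfolding V_def
    using cs U3(1) U3' Dc by (auto simp: mult_blk blk A3)
  define U where "U = W * V"
  have U: "U \<in> carrier_mat n n" using W V by (auto simp: U_def)
  have aU: "mat_adjoint U = mat_adjoint V * mat_adjoint W" unfolding U_def by (rule mat_adjoint_mult[OF W(1) V])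
  note Va = mat_adjoint_carrier[OF V]
  have "mat_adjoint U * U = mat_adjoint V * (mat_adjoint W * W) * V"
    unfolding aU unfolding U_def using W(1) W' V Va by (simp add: assoc_mult_mat[of _ n n _ n _ n])
  hence U1: "mat_adjoint U * U = 1\<^sub>m n" using W V Va V1 by simp
  have "U * mat_adjoint U = 1\<^sub>m n"
    by (rule mat_mult_left_right_inverse[OF mat_adjoint_carrier[OF U] U U1])
  moreover have "A = U * mat_diag n ((!) (e # es)) * mat_adjoint U"
  proof -
    let ?D = "mat_diag n ((!) (e # es))"
    have "W * V * ?D * (mat_adjoint V * mat_adjoint W) = W * (V * ?D * mat_adjoint V) * mat_adjoint W"
      using W(1) W' V Va mult_carrier_mat[OF Dc(2) Va] mult_carrier_mat[OF V mult_carrier_mat[OF Dc(2) Va]]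
      by (simp add: assoc_mult_mat[of _ n n _ n _ n])
    thus ?thesis unfolding aU unfolding U_def using Aeq A'eq by simp
  qed
  ultimately show ?case using U U1 by blast
qed


section \<open>Eigenvalue counts as dimensions of definite subspaces\<close>

definition qform :: "nat \<Rightarrow> (nat \<Rightarrow> nat \<Rightarrow> complex) \<Rightarrow> (nat \<Rightarrow> complex) \<Rightarrow> complex" where
  "qform n A c = (\<Sum>i<n. \<Sum>j<n. cnj (c i) * A i j * c j)"

lemma sq_neg_roots:
  assumes "char_poly A = (\<Prod>e \<leftarrow> es. [:- e, 1:])" "length es = n" "\<And>k. k < n \<Longrightarrow> es ! k \<in> \<real>"
  shows "sq_neg A = card {k. k < n \<and> Re (es ! k) < 0}"
proof -
  have "proots (char_poly A) = mset es"
    unfolding assms(1)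
  proof (induction es)
    case (Cons e es)
    have ne: "(\<Prod>e\<leftarrow>es. [:- e, 1:]) \<noteq> 0" by (auto simp: prod_list_zero_iff)
    thus ?case unfolding list.map prod_list.Cons by (subst proots_mult) (use Cons in auto)
  qed auto
  hence "sq_neg A = length (filter (\<lambda>\<mu>. \<mu> \<in> \<real> \<and> Re \<mu> < 0) es)"
    unfolding sq_neg_def by (metis mset_filter size_mset)
  also have "\<dots> = card {k. k < n \<and> es ! k \<in> \<real> \<and> Re (es ! k) < 0}"
    by (simp add: length_filter_conv_card assms(2))
  also have "{k. k < n \<and> es ! k \<in> \<real> \<and> Re (es ! k) < 0} = {k. k < n \<and> Re (es ! k) < 0}"
    using assms(3) by auto
  finally show ?thesis .
qed

text \<open>In the orthonormal basis \<open>u\<close> of eigenvectors the form is a sum of squares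
  with weights \<mu>, so that counting negative eigenvalues becomes counting negative weights. Later
  arguments refer to the form alone.\<close>

lemma hermitian_spectral:
  assumes A: "A \<in> carrier_mat n n" and herm: "hermitian A"
  obtains u :: "nat \<Rightarrow> nat \<Rightarrow> complex" and \<mu> :: "nat \<Rightarrow> real" where
    "\<forall>k<n. \<forall>l<n. (\<Sum>i<n. cnj (u k i) * u l i) = (if k = l then 1 else 0)"
    "\<forall>c. qform n (\<lambda>i j. A $$ (i, j)) c = (\<Sum>k<n. complex_of_real (\<mu> k * (cmod (\<Sum>i<n. cnj (u k i) * c i))\<^sup>2))"
    "sq_neg A = card {k. k < n \<and> \<mu> k < 0}"
proof -
  obtain es where es: "char_poly A = (\<Prod>e \<leftarrow> es. [:- e, 1:])" "length es = n"
    using char_poly_factorized[OF A] by blast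
  obtain U where U: "U \<in> carrier_mat n n" "mat_adjoint U * U = 1\<^sub>m n" "U * mat_adjoint U = 1\<^sub>m n"
    "A = U * mat_diag n ((!) es) * mat_adjoint U"
    using hermitian_unitary_diagonalization[OF A herm es(1)] by blast
  note U' = mat_adjoint_carrier[OF U(1)]
  define u where "u k i = U $$ (i, k)" for k i
  have D: "mat_diag n ((!) es) \<in> carrier_mat n n" by simp
  have orth: "(\<Sum>i<n. cnj (u k i) * u l i) = (if k = l then 1 else 0)" if "k < n" "l < n" for k l
  proof -
    have "(mat_adjoint U * U) $$ (k, l) = (\<Sum>i<n. cnj (u k i) * u l i)"
      using that U' U(1)
      by (auto simp: scalar_prod_def mat_adjoint_index[OF U(1)] atLeast0LessThan u_def intro!: sum.cong)
    thus ?thesis using that unfolding U(2) by auto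
  qed
  have Aij: "A $$ (i, j) = (\<Sum>k<n. u k i * es ! k * cnj (u k j))" if "i < n" "j < n" for i j
  proof -
    have "(U * mat_diag n ((!) es)) = Matrix.mat n n (\<lambda>(i, j). U $$ (i, j) * es ! j)"
      using U(1) by (simp add: mat_diag_mult_right)
    thus ?thesis unfolding U(4) using that U' U(1)
      by (auto simp: scalar_prod_def mat_adjoint_index[OF U(1)] atLeast0LessThan u_def intro!: sum.cong)
  qed
  have q: "qform n (\<lambda>i j. A $$ (i, j)) c = (\<Sum>k<n. es ! k * (complex_of_real ((cmod (\<Sum>i<n. cnj (u k i) * c i))\<^sup>2)))" for c
  proof -
    have "qform n (\<lambda>i j. A $$ (i, j)) c = (\<Sum>i<n. \<Sum>j<n. \<Sum>k<n. es ! k * (cnj (cnj (u k i) * c i) * (cnj (u k j) * c j)))"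
      unfolding qform_def by (intro sum.cong refl) (auto simp: Aij sum_distrib_left sum_distrib_right mult_ac)
    also have "\<dots> = (\<Sum>k<n. \<Sum>i<n. \<Sum>j<n. es ! k * (cnj (cnj (u k i) * c i) * (cnj (u k j) * c j)))"
      by (subst (2) sum.swap, subst sum.swap) (rule refl)
    also have "\<dots> = (\<Sum>k<n. es ! k * (cnj (\<Sum>i<n. cnj (u k i) * c i) * (\<Sum>i<n. cnj (u k i) * c i)))"
      unfolding cnj_sum sum_product unfolding sum_distrib_left ..
    finally show ?thesis by (simp only: complex_norm_square mult.commute)
  qed
  \<comment> \<open>At the eigenvector \<open>u l\<close> the form takes the value
    \<open>es ! l\<close>, and hermiticity makes every value of the form equal to its
    conjugate.\<close>
  have real: "es ! l \<in> \<real>" if l: "l < n" for l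
  proof -
    have "(\<Sum>i<n. cnj (u k i) * u l i) = (if k = l then 1 else 0)" if "k < n" for k
      using orth that l by auto
    hence 1: "qform n (\<lambda>i j. A $$ (i, j)) (u l) = es ! l"
      unfolding q by (subst sum.cong[OF refl, of _ _ "\<lambda>k. if k = l then es ! l else 0"]) (use l in auto)
    have "cnj (qform n (\<lambda>i j. A $$ (i, j)) (u l)) = (\<Sum>j<n. \<Sum>i<n. u l i * cnj (A $$ (i, j)) * cnj (u l j))"
      unfolding qform_def cnj_sum by (subst sum.swap) simp
    also have "\<dots> = qform n (\<lambda>i j. A $$ (i, j)) (u l)"
      unfolding qform_def by (intro sum.cong refl) (auto simp: hermitianD[OF herm A, symmetric] mult_ac)
    finally show ?thesis unfolding 1 by (simp add: Reals_cnj_iff)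
  qed
  have "qform n (\<lambda>i j. A $$ (i, j)) c = (\<Sum>k<n. complex_of_real (Re (es ! k) * (cmod (\<Sum>i<n. cnj (u k i) * c i))\<^sup>2))" for c
    unfolding q using real by (intro sum.cong refl) (auto simp: of_real_mult)
  moreover have "sq_neg A = card {k. k < n \<and> Re (es ! k) < 0}"
    by (rule sq_neg_roots[OF es real])
  ultimately show ?thesis using orth by (intro that[of u "\<lambda>k. Re (es ! k)"]) auto
qed

text \<open>Gaussian elimination: a nonzero coefficient \<open>M i0 j0\<close> solves equation
  \<open>i0\<close> for the unknown \<open>j0\<close>, and substitution leaves the Schur complement
  \<open>M'\<close>, with one equation and one unknown fewer. This replaces the intersection of
  subspaces in the inertia arguments.\<close>

lemma homogeneous_system_nontrivial:
  fixes M :: "'a \<Rightarrow> 'b \<Rightarrow> 'c :: field"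
  assumes "finite K" "finite I" "card K < card I"
  shows "\<exists>b. (\<exists>j\<in>I. b j \<noteq> 0) \<and> (\<forall>i\<in>K. (\<Sum>j\<in>I. M i j * b j) = 0)"
  using assms
proof (induction K arbitrary: I M rule: finite_induct)
  case empty
  hence "I \<noteq> {}" by auto
  thus ?case by (intro exI[of _ "\<lambda>_. 1"]) auto
next
  case (insert i0 K I M)
  show ?case
  proof (cases "\<forall>j\<in>I. M i0 j = 0")
    case True
    from insert have "card K < card I" by auto
    from insert.IH[OF insert.prems(1) this, of M] True show ?thesis by auto
  next
    case False
    then obtain j0 where j0: "j0 \<in> I" "M i0 j0 \<noteq> 0" by auto
    define I' where "I' = I - {j0}"
    define M' where "M' i j = M i j - M i j0 * M i0 j / M i0 j0" for i j
    have "card K < card I'" using insert j0 by (auto simp: I'_def card_Diff_singleton)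
    from insert.IH[OF _ this, of M'] obtain b where b: "\<exists>j\<in>I'. b j \<noteq> 0" "\<forall>i\<in>K. (\<Sum>j\<in>I'. M' i j * b j) = 0"
      using insert.prems(1) by (auto simp: I'_def)
    define b' where "b' j = (if j = j0 then - (\<Sum>j\<in>I'. M i0 j * b j) / M i0 j0 else b j)" for j
    have s: "(\<Sum>j\<in>I. M i j * b' j) = (\<Sum>j\<in>I'. M i j * b j) - M i j0 * (\<Sum>j\<in>I'. M i0 j * b j) / M i0 j0" for i
    proof -
      have "(\<Sum>j\<in>I. M i j * b' j) = M i j0 * b' j0 + (\<Sum>j\<in>I'. M i j * b' j)"
        unfolding I'_def by (rule sum.remove[OF insert.prems(1) j0(1)])
      also have "(\<Sum>j\<in>I'. M i j * b' j) = (\<Sum>j\<in>I'. M i j * b j)"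
        by (intro sum.cong refl) (auto simp: b'_def I'_def)
      finally show ?thesis by (simp add: b'_def)
    qed
    have "(\<Sum>j\<in>I. M i j * b' j) = (\<Sum>j\<in>I'. M' i j * b j)" for i
      unfolding s M'_def by (simp add: sum_subtractf algebra_simps sum_distrib_left sum_divide_distrib)
    moreover have "(\<Sum>j\<in>I. M i0 j * b' j) = 0" unfolding s using j0 by simp
    moreover have "\<exists>j\<in>I. b' j \<noteq> 0" using b(1) by (auto simp: b'_def I'_def)
    ultimately show ?thesis using b(2) by (intro exI[of _ b']) auto
  qed
qed

text \<open>If the coordinates with negative weight vanish, only nonnegative terms survive. Together
  with the next lemma this gives both halves of the law of inertia: \<open>sq_neg A\<close> linear
  conditions ensure nonnegativity, and a space of that dimension carries a negative form.\<close>

lemma sq_neg_nonneg_subspace: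
  assumes A: "A \<in> carrier_mat n n" and herm: "hermitian A"
  obtains K :: "nat set" and B :: "nat \<Rightarrow> nat \<Rightarrow> complex" where "finite K" "card K = sq_neg A"
    "\<forall>c. (\<forall>k\<in>K. (\<Sum>i<n. B k i * c i) = 0) \<longrightarrow> 0 \<le> Re (qform n (\<lambda>i j. A $$ (i, j)) c)"
proof -
  obtain u \<mu> where *: "\<forall>k<n. \<forall>l<n. (\<Sum>i<n. cnj (u k i) * u l i) = (if k = l then 1 else 0)"
    "\<forall>c. qform n (\<lambda>i j. A $$ (i, j)) c = (\<Sum>k<n. complex_of_real (\<mu> k * (cmod (\<Sum>i<n. cnj (u k i) * c i))\<^sup>2))"
    "sq_neg A = card {k. k < n \<and> \<mu> k < 0}"
    by (rule hermitian_spectral[OF A herm])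
  show ?thesis
  proof (rule that[of "{k. k < n \<and> \<mu> k < 0}" "\<lambda>k i. cnj (u k i)"])
    have "0 \<le> Re (qform n (\<lambda>i j. A $$ (i, j)) c)" if c: "\<forall>k\<in>{k. k < n \<and> \<mu> k < 0}. (\<Sum>i<n. cnj (u k i) * c i) = 0" for c
    proof -
      have "0 \<le> \<mu> k * (cmod (\<Sum>i<n. cnj (u k i) * c i))\<^sup>2" if "k < n" for k
        using c that by (cases "\<mu> k < 0") auto
      thus "0 \<le> Re (qform n (\<lambda>i j. A $$ (i, j)) c)"
        unfolding *(2)[rule_format] by (auto intro!: sum_nonneg)
    qed
    thus "\<forall>c. (\<forall>k\<in>{k. k < n \<and> \<mu> k < 0}. (\<Sum>i<n. cnj (u k i) * c i) = 0) \<longrightarrow>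
        0 \<le> Re (qform n (\<lambda>i j. A $$ (i, j)) c)" by blast
  qed (use *(3) in auto)
qed

text \<open>\<delta> is the smallest modulus of a negative eigenvalue (1 if there is none). The
  uniform gap and the isometry of the parametrization let negativity survive a small perturbation of
  the form.\<close>

lemma sq_neg_negative_subspace:
  assumes A: "A \<in> carrier_mat n n" and herm: "hermitian A"
  obtains K :: "nat set" and V :: "nat \<Rightarrow> nat \<Rightarrow> complex" and \<delta> where "finite K" "card K = sq_neg A" "\<delta> > 0"
    "\<forall>b. (\<Sum>i<n. (cmod (\<Sum>k\<in>K. V k i * b k))\<^sup>2) = (\<Sum>k\<in>K. (cmod (b k))\<^sup>2)"
    "\<forall>b. Re (qform n (\<lambda>i j. A $$ (i, j)) (\<lambda>i. \<Sum>k\<in>K. V k i * b k)) \<le> - \<delta> * (\<Sum>k\<in>K. (cmod (b k))\<^sup>2)"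
proof -
  obtain u \<mu> where *: 
    "\<forall>k<n. \<forall>l<n. (\<Sum>i<n. cnj (u k i) * u l i) = (if k = l then 1 else 0)"
    "\<forall>c. qform n (\<lambda>i j. A $$ (i, j)) c = (\<Sum>k<n. complex_of_real (\<mu> k * (cmod (\<Sum>i<n. cnj (u k i) * c i))\<^sup>2))"
    "sq_neg A = card {k. k < n \<and> \<mu> k < 0}"
    by (rule hermitian_spectral[OF A herm])
  define K where "K = {k. k < n \<and> \<mu> k < 0}"
  have K: "finite K" "K \<subseteq> {..<n}" by (auto simp: K_def)
  define \<delta> where "\<delta> = (if K = {} then 1 else - Max (\<mu> ` K))"
  have \<delta>: "\<delta> > 0" using K by (auto simp: \<delta>_def) (auto simp: K_def)
  have \<delta>\<mu>: "\<mu> k \<le> - \<delta>" if "k \<in> K" for k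
  proof -
    have "\<delta> = - Max (\<mu> ` K)" using that by (simp add: \<delta>_def split: if_splits) auto
    moreover have "\<mu> k \<le> Max (\<mu> ` K)" using that K by (intro Max_ge) auto
    ultimately show ?thesis by linarith
  qed
  have coef: "(\<Sum>i<n. cnj (u l i) * (\<Sum>k\<in>K. u k i * b k)) = (if l \<in> K then b l else 0)" if l: "l < n" for b l
  proof -
    have "(\<Sum>i<n. cnj (u l i) * (\<Sum>k\<in>K. u k i * b k)) = (\<Sum>k\<in>K. \<Sum>i<n. cnj (u l i) * u k i * b k)"
      unfolding sum_distrib_left by (subst sum.swap) (simp add: mult_ac)
    also have "\<dots> = (\<Sum>k\<in>K. (if l = k then 1 else 0) * b k)"
      unfolding sum_distrib_right[symmetric] using *(1) l K by (intro sum.cong refl) auto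
    also have "\<dots> = (if l \<in> K then b l else 0)" using K by (auto simp: if_distrib[of "\<lambda>x. x * _"] cong: if_cong)
    finally show ?thesis .
  qed
  have 1: "(\<Sum>i<n. (cmod (\<Sum>k\<in>K. u k i * b k))\<^sup>2) = (\<Sum>k\<in>K. (cmod (b k))\<^sup>2)"
    and 2: "Re (qform n (\<lambda>i j. A $$ (i, j)) (\<lambda>i. \<Sum>k\<in>K. u k i * b k)) \<le> - \<delta> * (\<Sum>k\<in>K. (cmod (b k))\<^sup>2)"
    for b
  proof -
    let ?c = "\<lambda>i. \<Sum>k\<in>K. u k i * b k"
    have "complex_of_real (\<Sum>i<n. (cmod (?c i))\<^sup>2) = (\<Sum>i<n. cnj (?c i) * ?c i)"
      by (simp only: of_real_sum complex_norm_square mult.commute)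
    also have "\<dots> = (\<Sum>i<n. \<Sum>l\<in>K. cnj (b l) * (cnj (u l i) * ?c i))"
      by (intro sum.cong refl) (simp only: cnj_sum sum_distrib_right, simp add: mult_ac)
    also have "\<dots> = (\<Sum>l\<in>K. cnj (b l) * (\<Sum>i<n. cnj (u l i) * ?c i))"
      by (subst sum.swap) (simp add: sum_distrib_left)
    also have "\<dots> = (\<Sum>l\<in>K. cnj (b l) * b l)" using K by (intro sum.cong refl, subst coef) auto
    also have "\<dots> = complex_of_real (\<Sum>k\<in>K. (cmod (b k))\<^sup>2)"
      by (simp only: of_real_sum complex_norm_square mult.commute)
    finally show "(\<Sum>i<n. (cmod (?c i))\<^sup>2) = (\<Sum>k\<in>K. (cmod (b k))\<^sup>2)" by (simp only: of_real_eq_iff)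
    have "Re (qform n (\<lambda>i j. A $$ (i, j)) ?c) = (\<Sum>k<n. \<mu> k * (cmod (if k \<in> K then b k else 0))\<^sup>2)"
      unfolding *(2)[rule_format] Re_sum Re_complex_of_real by (intro sum.cong refl, subst coef) auto
    also have "\<dots> = (\<Sum>k\<in>K. \<mu> k * (cmod (b k))\<^sup>2)"
      using K by (intro sum.mono_neutral_cong_right) auto
    also have "\<dots> \<le> (\<Sum>k\<in>K. - \<delta> * (cmod (b k))\<^sup>2)"
      using \<delta>\<mu> by (intro sum_mono mult_right_mono) auto
    finally show "Re (qform n (\<lambda>i j. A $$ (i, j)) ?c) \<le> - \<delta> * (\<Sum>k\<in>K. (cmod (b k))\<^sup>2)"
      by (simp add: sum_distrib_left)
  qed
  show ?thesis
    by (rule that[of K \<delta> u]) (use K \<delta> *(3) 1 2 in \<open>auto simp: K_def\<close>)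
qed

text \<open>With fewer conditions than negative eigenvalues, some nonzero vector of the negative
  eigenspace would satisfy all conditions, and the form would be both negative and nonnegative
  there.\<close>

lemma sq_neg_le:
  assumes A: "A \<in> carrier_mat n n" and herm: "hermitian A"
    and K: "finite K"
    and nonneg: "\<And>c. \<forall>k\<in>K. (\<Sum>i<n. B k i * c i) = 0 \<Longrightarrow> 0 \<le> Re (qform n (\<lambda>i j. A $$ (i, j)) c)"
  shows "sq_neg A \<le> card K"
proof (rule ccontr)
  assume less: "\<not> ?thesis"
  obtain L :: "nat set" and V \<delta> where L: "finite L" "card L = sq_neg A" "\<delta> > 0"
    "\<forall>b. (\<Sum>i<n. (cmod (\<Sum>k\<in>L. V k i * b k))\<^sup>2) = (\<Sum>k\<in>L. (cmod (b k))\<^sup>2)"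
    "\<forall>b. Re (qform n (\<lambda>i j. A $$ (i, j)) (\<lambda>i. \<Sum>k\<in>L. V k i * b k)) \<le> - \<delta> * (\<Sum>k\<in>L. (cmod (b k))\<^sup>2)"
    by (rule sq_neg_negative_subspace[OF A herm])
  from homogeneous_system_nontrivial[OF K L(1), of "\<lambda>k l. \<Sum>i<n. B k i * V l i"] less L(2)
  obtain b where b: "\<exists>j\<in>L. b j \<noteq> 0" "\<forall>k\<in>K. (\<Sum>l\<in>L. (\<Sum>i<n. B k i * V l i) * b l) = 0" by auto
  have "(\<Sum>i<n. B k i * (\<Sum>l\<in>L. V l i * b l)) = (\<Sum>l\<in>L. (\<Sum>i<n. B k i * V l i) * b l)" for k
    unfolding sum_distrib_left sum_distrib_right by (subst sum.swap) (simp add: mult_ac)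
  with b(2) nonneg have "0 \<le> Re (qform n (\<lambda>i j. A $$ (i, j)) (\<lambda>i. \<Sum>k\<in>L. V k i * b k))" by simp
  with L(5)[rule_format, of b] have "\<delta> * (\<Sum>k\<in>L. (cmod (b k))\<^sup>2) \<le> 0" by simp
  moreover have "(\<Sum>k\<in>L. (cmod (b k))\<^sup>2) > 0" using b(1) L(1) by (auto intro: sum_pos2)
  ultimately show False using L(3) by (simp add: mult_le_0_iff)
qed

text \<open>The dual count: otherwise a nonzero combination of the vectors \<open>V l\<close> would
  meet the conditions for nonnegativity. Strict negativity for every nonzero \<open>b\<close>
  already implies that these vectors are linearly independent.\<close>

lemma sq_neg_ge:
  assumes A: "A \<in> carrier_mat n n" and herm: "hermitian A"
    and L: "finite L"
    and neg: "\<And>b. \<exists>j\<in>L. b j \<noteq> 0 \<Longrightarrow> Re (qform n (\<lambda>i j. A $$ (i, j)) (\<lambda>i. \<Sum>l\<in>L. V l i * b l)) < 0"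
  shows "card L \<le> sq_neg A"
proof (rule ccontr)
  assume less: "\<not> ?thesis"
  obtain K :: "nat set" and B where K: "finite K" "card K = sq_neg A"
    "\<forall>c. (\<forall>k\<in>K. (\<Sum>i<n. B k i * c i) = 0) \<longrightarrow> 0 \<le> Re (qform n (\<lambda>i j. A $$ (i, j)) c)"
    by (rule sq_neg_nonneg_subspace[OF A herm])
  from homogeneous_system_nontrivial[OF K(1) L, of "\<lambda>k l. \<Sum>i<n. B k i * V l i"] less K(2)
  obtain b where b: "\<exists>j\<in>L. b j \<noteq> 0" "\<forall>k\<in>K. (\<Sum>l\<in>L. (\<Sum>i<n. B k i * V l i) * b l) = 0" by auto
  have "(\<Sum>i<n. B k i * (\<Sum>l\<in>L. V l i * b l)) = (\<Sum>l\<in>L. (\<Sum>i<n. B k i * V l i) * b l)" for k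
    unfolding sum_distrib_left sum_distrib_right by (subst sum.swap) (simp add: mult_ac)
  with b(2) K(3) have "0 \<le> Re (qform n (\<lambda>i j. A $$ (i, j)) (\<lambda>i. \<Sum>k\<in>L. V k i * b k))" by simp
  with neg[OF b(1)] show False by simp
qed

lemma qform_nonneg_if_sq_neg_0:
  assumes A: "A \<in> carrier_mat n n" and herm: "hermitian A"
    and "sq_neg A = 0"
  shows "0 \<le> Re (qform n (\<lambda>i j. A $$ (i, j)) c)"
proof -
  obtain K :: "nat set" and B where K: "finite K" "card K = sq_neg A"
    "\<forall>c. (\<forall>k\<in>K. (\<Sum>i<n. B k i * c i) = 0) \<longrightarrow> 0 \<le> Re (qform n (\<lambda>i j. A $$ (i, j)) c)"
    by (rule sq_neg_nonneg_subspace[OF A herm])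
  with assms(3) show ?thesis by auto
qed

section \<open>Stolz sectors\<close>

lemma frequently_within_sequence:
  fixes a :: "'a :: metric_space"
  assumes "\<exists>\<^sub>F z in at a within S. P z"
  obtains X where "\<forall>n. X n \<in> S - {a} \<and> P (X n)" "X \<longlonglongrightarrow> a"
proof -
  have "\<forall>n. \<exists>z. z \<in> S - {a} \<and> P z \<and> dist z a < 1 / real (Suc n)"
  proof
    fix n
    have "0 < 1 / real (Suc n)" by simp
    with assms show "\<exists>z. z \<in> S - {a} \<and> P z \<and> dist z a < 1 / real (Suc n)"
      unfolding frequently_def eventually_at by blast
  qed
  then obtain X where X: "\<And>n. X n \<in> S - {a} \<and> P (X n) \<and> dist (X n) a < 1 / real (Suc n)" by metis
  have "(\<lambda>n. dist (X n) a) \<longlonglongrightarrow> 0"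
    using X by (intro tendsto_sandwich[OF _ _ tendsto_const lim_inverse_n'[THEN LIMSEQ_Suc]])
      (auto intro!: always_eventually less_imp_le)
  with X that show ?thesis by (auto simp: tendsto_dist_iff[of _ a])
qed

lemma stolz_sectorD:
  assumes "z \<in> stolz_sector x M"
  shows "Im z > 0" "z \<noteq> of_real x" "cmod (z - of_real x) \<le> (1 + M) * Im z"
proof -
  show "Im z > 0" using assms by (simp add: stolz_sector_def)
  thus "z \<noteq> of_real x" by auto
  have "cmod (z - of_real x) \<le> \<bar>Re (z - of_real x)\<bar> + \<bar>Im (z - of_real x)\<bar>" by (rule cmod_le)
  also have "\<dots> \<le> M * Im z + Im z" using assms by (simp add: stolz_sector_def)
  finally show "cmod (z - of_real x) \<le> (1 + M) * Im z" by (simp add: algebra_simps)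
qed

lemma stolz_sector_filter_nontrivial:
  assumes "M > 0"
  shows "at (complex_of_real x) within stolz_sector x M \<noteq> bot"
proof -
  have "(complex_of_real x) islimpt stolz_sector x M"
    unfolding islimpt_approachable
  proof safe
    fix e :: real assume "e > 0"
    with assms show "\<exists>x'\<in>stolz_sector x M. x' \<noteq> complex_of_real x \<and> dist x' (complex_of_real x) < e"
      by (intro bexI[of _ "Complex x (e / 2)"])
         (auto simp: stolz_sector_def dist_norm complex_eq_iff cmod_def)
  qed
  thus ?thesis by (simp add: trivial_limit_within)
qed

lemma nt_limit_Value:
  "nt_limit f x (Value l) \<longleftrightarrow> (\<forall>M>0. (f \<longlongrightarrow> l) (at (complex_of_real x) within stolz_sector x M))"
  by (simp add: nt_limit_def)

lemma nt_limit_Infty: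
  "nt_limit f x Infty \<longleftrightarrow> (\<forall>M>0. filterlim f at_infinity (at (complex_of_real x) within stolz_sector x M))"
  by (simp add: nt_limit_def)

lemma nt_limit_unique:
  assumes "nt_limit f x L" "nt_limit f x L'"
  shows "L = L'"
proof -
  have nb: "at (complex_of_real x) within stolz_sector x 1 \<noteq> bot"
    by (rule stolz_sector_filter_nontrivial) simp
  have "False" if "nt_limit f x (Value l)" "nt_limit f x Infty" for l
    by (rule not_tendsto_and_filterlim_at_infinity[OF nb, of f l])
       (use that in \<open>simp_all add: nt_limit_Value nt_limit_Infty\<close>)
  moreover have "l = l'" if "nt_limit f x (Value l)" "nt_limit f x (Value l')" for l l'
    by (rule tendsto_unique[OF nb, of f]) (use that in \<open>simp_all add: nt_limit_Value\<close>)
  ultimately show ?thesis using assms by (cases L; cases L') auto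
qed

lemma filterlim_stolz_sequence:
  assumes "\<And>n. X n \<in> stolz_sector x M" "X \<longlonglongrightarrow> complex_of_real x"
  shows "filterlim X (at (complex_of_real x) within stolz_sector x M) sequentially"
  unfolding filterlim_at using assms stolz_sectorD(2) by (intro conjI always_eventually) blast+

lemma convex_stolz_sector: "convex (stolz_sector x M)"
proof (rule convexI)
  fix a b :: complex and u v :: real
  assume ab: "a \<in> stolz_sector x M" "b \<in> stolz_sector x M" and uv: "0 \<le> u" "0 \<le> v" "u + v = 1"
  have "Re (u *\<^sub>R a + v *\<^sub>R b) - x = u * (Re a - x) + v * (Re b - x)"
    using uv(3) by (simp add: algebra_simps) (metis distrib_right mult_1 mult.commute)
  hence "\<bar>Re (u *\<^sub>R a + v *\<^sub>R b) - x\<bar> \<le> u * \<bar>Re a - x\<bar> + v * \<bar>Re b - x\<bar>"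
    using uv abs_triangle_ineq[of "u * (Re a - x)" "v * (Re b - x)"] by (simp add: abs_mult)
  also have "\<dots> \<le> u * (M * Im a) + v * (M * Im b)"
    using ab uv by (intro add_mono mult_left_mono) (auto simp: stolz_sector_def)
  finally have 1: "\<bar>Re (u *\<^sub>R a + v *\<^sub>R b) - x\<bar> \<le> M * Im (u *\<^sub>R a + v *\<^sub>R b)" by (simp add: algebra_simps)
  have "0 < Im (u *\<^sub>R a + v *\<^sub>R b)"
  proof (cases "u = 0")
    case False
    with ab uv show ?thesis by (auto simp: stolz_sector_def intro!: add_pos_nonneg)
  qed (use ab uv in \<open>auto simp: stolz_sector_def\<close>)
  with 1 show "u *\<^sub>R a + v *\<^sub>R b \<in> stolz_sector x M" by (auto simp: stolz_sector_def)
qed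

text \<open>The vertex is outside the sector, so the puncture in the neighbourhood filter
  disappears.\<close>

lemma eventually_stolz_sector_eq:
  "eventually P (at (complex_of_real x) within stolz_sector x M) \<longleftrightarrow>
     (\<exists>d>0. \<forall>z\<in>stolz_sector x M. cmod (z - of_real x) < d \<longrightarrow> P z)"
  unfolding eventually_at using stolz_sectorD(2) by (fastforce simp: dist_norm)

section \<open>The Nevanlinna class\<close>

(* Nonnegativity of the 1x1 and 2x2 kernel matrices; this is all that is used about the boundary
   behaviour of Nevanlinna functions, in place of an integral representation. *)
definition pick_ineq :: "(complex \<Rightarrow> complex) \<Rightarrow> complex set \<Rightarrow> bool" where
  "pick_ineq f S \<longleftrightarrow> (\<forall>z\<in>S. 0 \<le> Im (f z)) \<and>
     (\<forall>z\<in>S. \<forall>\<zeta>\<in>S. (cmod (f z - cnj (f \<zeta>)))\<^sup>2 * (Im z * Im \<zeta>) \<le> (cmod (z - cnj \<zeta>))\<^sup>2 * (Im (f z) * Im (f \<zeta>)))"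

section \<open>Kernel matrices and the Pick inequality\<close>

lemma pick_kernel_diagonal: "pick_kernel f z z = complex_of_real (Im (f z) / Im z)"
  by (cases "Im z = 0") (auto simp: pick_kernel_def complex_diff_cnj complex_eq_iff)

lemma cnj_pick_kernel: "cnj (pick_kernel f z \<zeta>) = pick_kernel f \<zeta> z"
proof -
  have "cnj (pick_kernel f z \<zeta>) = - (f \<zeta> - cnj (f z)) / - (\<zeta> - cnj z)" by (simp add: pick_kernel_def)
  thus ?thesis by (simp only: minus_divide_divide pick_kernel_def)
qed

lemma kernel_matrix_carrier: "kernel_matrix f zs \<in> carrier_mat (length zs) (length zs)"
  by (simp add: kernel_matrix_def)

lemma kernel_matrix_index:
  "i < length zs \<Longrightarrow> j < length zs \<Longrightarrow> kernel_matrix f zs $$ (i, j) = pick_kernel f (zs ! j) (zs ! i)"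
  by (simp add: kernel_matrix_def)

lemma hermitian_kernel_matrix: "hermitian (kernel_matrix f zs)"
  by (rule hermitianI[OF kernel_matrix_carrier]) (simp add: kernel_matrix_index cnj_pick_kernel)

lemma qform_kernel_matrix:
  "qform (length zs) (\<lambda>i j. kernel_matrix f zs $$ (i, j)) c =
   qform (length zs) (\<lambda>i j. pick_kernel f (zs ! j) (zs ! i)) c"
  unfolding qform_def by (intro sum.cong refl) (simp add: kernel_matrix_index)

text \<open>The discriminant argument: s = - cnj b and real t give the polynomial a t^2 - 2 t |b|^2
  + d |b|^2. It is tested at its minimum t = |b|^2 / a, or, if a = 0 and it is linear, at t = d +
  1.\<close>

lemma nonneg_form_imp_cauchy_schwarz:
  fixes a d :: real and b :: complex
  assumes "\<And>t s. 0 \<le> Re (cnj t * a * t + cnj t * b * s + cnj s * cnj b * t + cnj s * d * s)"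
  shows "0 \<le> a" "(cmod b)\<^sup>2 \<le> a * d"
proof -
  from assms[of 1 0] show a: "0 \<le> a" by simp
  from assms[of 0 1] have d: "0 \<le> d" by simp
  define \<beta> where "\<beta> = (cmod b)\<^sup>2"
  have key: "0 \<le> a * t\<^sup>2 - 2 * t * \<beta> + d * \<beta>" for t :: real
  proof -
    have bb: "Re b * Re b + Im b * Im b = \<beta>" unfolding \<beta>_def cmod_def by (simp add: power2_eq_square)
    have "Re (cnj (of_real t) * a * of_real t + cnj (of_real t) * b * (- cnj b) + cnj (- cnj b) * cnj b * of_real t
         + cnj (- cnj b) * d * (- cnj b)) =
       a * t\<^sup>2 - 2 * t * (Re b * Re b + Im b * Im b) + d * (Re b * Re b + Im b * Im b)"
      by (simp add: algebra_simps power2_eq_square)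
    with assms[of "of_real t" "- cnj b"] show ?thesis unfolding bb by simp
  qed
  have \<beta>: "0 \<le> \<beta>" by (simp add: \<beta>_def)
  show "(cmod b)\<^sup>2 \<le> a * d"
  proof (rule ccontr)
    assume "\<not> ?thesis"
    hence less: "a * d < \<beta>" by (simp add: \<beta>_def)
    have \<beta>pos: "0 < \<beta>" using less a d by (meson le_less_trans mult_nonneg_nonneg)
    show False
    proof (cases "a = 0")
      case True
      have "0 \<le> \<beta> * (- d - 2)" using key[of "d + 1"] True by (simp add: algebra_simps)
      with \<beta>pos d show False by (simp add: zero_le_mult_iff)
    next
      case False
      with a have "0 < a" by simp
      have "0 \<le> a * (a * (\<beta> / a)\<^sup>2 - 2 * (\<beta> / a) * \<beta> + d * \<beta>)" using key[of "\<beta> / a"] a by simp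
      also have "\<dots> = \<beta> * (a * d - \<beta>)" using \<open>0 < a\<close> by (simp add: field_simps power2_eq_square)
      finally show False using \<beta>pos less by (simp add: zero_le_mult_iff)
    qed
  qed
qed

lemma nevanlinna_0_qform_nonneg:
  assumes "f \<in> nevanlinna 0" "set zs \<subseteq> analyticity_domain f"
  shows "0 \<le> Re (qform (length zs) (\<lambda>i j. pick_kernel f (zs ! j) (zs ! i)) c)"
proof (cases "zs = []")
  case False
  hence "sq_neg (kernel_matrix f zs) = 0" using assms by (simp add: nevanlinna_def)
  thus ?thesis using qform_nonneg_if_sq_neg_0[OF kernel_matrix_carrier hermitian_kernel_matrix]
    unfolding qform_kernel_matrix by blast
qed (simp add: qform_def)

lemma nevanlinna_0_pick_ineq_domain:
  assumes f: "f \<in> nevanlinna 0"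
  shows "pick_ineq f (analyticity_domain f)"
proof -
  have Im: "Im z > 0" if "z \<in> analyticity_domain f" for z
    using that by (simp add: analyticity_domain_def upper_half_plane_def)
  have 1: "0 \<le> Im (f z) / Im z \<and> (cmod (pick_kernel f \<zeta> z))\<^sup>2 \<le> (Im (f z) / Im z) * (Im (f \<zeta>) / Im \<zeta>)"
    if z: "z \<in> analyticity_domain f" "\<zeta> \<in> analyticity_domain f" for z \<zeta>
  proof -
    have *: "0 \<le> Re (cnj t * of_real (Im (f z) / Im z) * t + cnj t * pick_kernel f \<zeta> z * s + cnj s * cnj (pick_kernel f \<zeta> z) * t
              + cnj s * of_real (Im (f \<zeta>) / Im \<zeta>) * s)" for t s
      using nevanlinna_0_qform_nonneg[OF f, of "[z, \<zeta>]" "\<lambda>i. if i = 0 then t else s"] z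
      by (simp add: qform_def lessThan_Suc pick_kernel_diagonal cnj_pick_kernel add_ac numeral_2_eq_2)
    show ?thesis using nonneg_form_imp_cauchy_schwarz[OF *] by blast
  qed
  show ?thesis unfolding pick_ineq_def
  proof safe
    fix z assume z: "z \<in> analyticity_domain f"
    show "0 \<le> Im (f z)" using 1[OF z z] Im[OF z] by (simp add: zero_le_divide_iff)
  next
    fix z \<zeta> assume z: "z \<in> analyticity_domain f" "\<zeta> \<in> analyticity_domain f"
    have nz: "z - cnj \<zeta> \<noteq> 0" using Im[OF z(1)] Im[OF z(2)] by (auto simp: complex_eq_iff)
    have "(cmod (f z - cnj (f \<zeta>)))\<^sup>2 / (cmod (z - cnj \<zeta>))\<^sup>2 \<le> (Im (f \<zeta>) / Im \<zeta>) * (Im (f z) / Im z)"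
      using 1[OF z(2) z(1)] by (simp add: pick_kernel_def norm_divide power_divide)
    thus "(cmod (f z - cnj (f \<zeta>)))\<^sup>2 * (Im z * Im \<zeta>) \<le> (cmod (z - cnj \<zeta>))\<^sup>2 * (Im (f z) * Im (f \<zeta>))"
      using nz Im[OF z(1)] Im[OF z(2)] by (simp add: field_simps)
  qed
qed

text \<open>For fixed \<zeta> the Pick inequality is quadratic in |f z| on the left but only linear
  on the right. It therefore bounds f near any point of the half plane and excludes poles.\<close>

lemma nevanlinna_0_analytic:
  assumes f: "f \<in> nevanlinna 0"
  shows "f analytic_on upper_half_plane"
proof -
  have nm: "f nicely_meromorphic_on upper_half_plane" using f by (simp add: nevanlinna_def)
  hence mero: "f meromorphic_on upper_half_plane" by (simp add: nicely_meromorphic_on_def)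
  have op: "open upper_half_plane" unfolding upper_half_plane_def by (rule open_halfspace_Im_gt)
  note pi = nevanlinna_0_pick_ineq_domain[OF f]
  have "\<not> is_pole f z0" if z0: "z0 \<in> upper_half_plane" for z0
  proof
    assume pole: "is_pole f z0"
    have "eventually (\<lambda>z. f analytic_on {z}) (at z0)"
      using meromorphic_on_isolated_singularity[OF meromorphic_on_subset[OF mero]] z0
      by (simp add: isolated_singularity_at_altdef)
    moreover have "eventually (\<lambda>z. z \<in> upper_half_plane) (at z0)"
      using op z0 by (rule eventually_at_in_open')
    ultimately have dom: "eventually (\<lambda>z. z \<in> analyticity_domain f) (at z0)"
      by eventually_elim (simp add: analyticity_domain_def)
    then obtain \<zeta> where \<zeta>: "\<zeta> \<in> analyticity_domain f"
      using eventually_happens[of _ "at z0"] by (metis trivial_limit_at)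
    \<comment> \<open>Once |f z| is at least 2 |f \<zeta>| + 1, |f z| / 2 is at most |f z - cnj (f
      \<zeta>)|; squaring this produces the factor 4.\<close>
    define B where "B z = 4 * (cmod (z - cnj \<zeta>))\<^sup>2 * Im (f \<zeta>) / (Im z * Im \<zeta>)" for z
    have Im\<zeta>: "0 < Im \<zeta>" and Imz0: "0 < Im z0" using \<zeta> z0 by (auto simp: analyticity_domain_def upper_half_plane_def)
    have inf: "filterlim f at_infinity (at z0)" using pole by (simp add: is_pole_def)
    have "eventually (\<lambda>z. 2 * cmod (f \<zeta>) + 1 \<le> cmod (f z)) (at z0)"
      using inf[unfolded filterlim_at_infinity[OF order_refl], rule_format, of "2 * cmod (f \<zeta>) + 1"]
      by (simp add: add_nonneg_pos)
    hence le: "eventually (\<lambda>z. cmod (f z) \<le> B z) (at z0)"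
      using dom
    proof eventually_elim
      case (elim z)
      have z: "0 < Im z" using elim(2) by (auto simp: analyticity_domain_def upper_half_plane_def)
      have "cmod (f z) - cmod (f \<zeta>) \<le> cmod (f z - cnj (f \<zeta>))" using norm_triangle_ineq2[of "f z" "cnj (f \<zeta>)"] by simp
      with elim(1) have "cmod (f z) / 2 \<le> cmod (f z - cnj (f \<zeta>))" by simp
      hence "(cmod (f z) / 2)\<^sup>2 \<le> (cmod (f z - cnj (f \<zeta>)))\<^sup>2" by (intro power_mono) auto
      hence "(cmod (f z) / 2)\<^sup>2 * (Im z * Im \<zeta>) \<le> (cmod (f z - cnj (f \<zeta>)))\<^sup>2 * (Im z * Im \<zeta>)"
        using z Im\<zeta> by (intro mult_right_mono) auto
      also have "\<dots> \<le> (cmod (z - cnj \<zeta>))\<^sup>2 * (Im (f z) * Im (f \<zeta>))" using pi elim(2) \<zeta> by (simp add: pick_ineq_def)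
      also have "\<dots> \<le> (cmod (z - cnj \<zeta>))\<^sup>2 * (cmod (f z) * Im (f \<zeta>))"
        using pi elim(2) \<zeta> abs_Im_le_cmod[of "f z"] by (intro mult_left_mono mult_right_mono) (auto simp: pick_ineq_def)
      finally have "cmod (f z) * (cmod (f z) * (Im z * Im \<zeta>)) \<le> cmod (f z) * (4 * (cmod (z - cnj \<zeta>))\<^sup>2 * Im (f \<zeta>))"
        by (simp add: power2_eq_square algebra_simps)
      moreover have "0 < cmod (f z)" using elim(1) by (smt (verit) norm_ge_zero)
      ultimately have "cmod (f z) * (Im z * Im \<zeta>) \<le> 4 * (cmod (z - cnj \<zeta>))\<^sup>2 * Im (f \<zeta>)" by simp
      thus ?case unfolding B_def using z Im\<zeta> by (simp add: pos_le_divide_eq)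
    qed
    have "(B \<longlongrightarrow> B z0) (at z0)" unfolding B_def using Im\<zeta> Imz0 by (auto intro!: tendsto_eq_intros)
    hence "eventually (\<lambda>z. B z < B z0 + 1) (at z0)" by (rule order_tendstoD) simp
    moreover have "eventually (\<lambda>z. \<bar>B z0\<bar> + 1 \<le> cmod (f z)) (at z0)"
      using inf[unfolded filterlim_at_infinity[OF order_refl], rule_format, of "\<bar>B z0\<bar> + 1"]
      by (simp add: add_nonneg_pos)
    ultimately have "eventually (\<lambda>_. False) (at z0)" using le
      by eventually_elim linarith
    thus False by simp
  qed
  hence "f analytic_on {z}" if "z \<in> upper_half_plane" for z
    using nicely_meromorphic_on_imp_analytic_at[OF nm that] that by blast
  thus ?thesis using analytic_on_analytic_at by blast
qed

lemma nevanlinna_0_domain: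
  "f \<in> nevanlinna 0 \<Longrightarrow> analyticity_domain f = upper_half_plane"
  using nevanlinna_0_analytic analytic_on_analytic_at unfolding analyticity_domain_def by blast

lemma nevanlinna_0_pick_ineq: "f \<in> nevanlinna 0 \<Longrightarrow> pick_ineq f upper_half_plane"
  using nevanlinna_0_pick_ineq_domain nevanlinna_0_domain by metis

text \<open>The maximum principle for Im f, read off from the Pick inequality: a zero of Im f
  annihilates its right-hand side.\<close>

lemma pick_ineq_real_value_imp_constant:
  assumes "pick_ineq f upper_half_plane" "\<zeta> \<in> upper_half_plane" "Im (f \<zeta>) = 0" "z \<in> upper_half_plane"
  shows "f z = f \<zeta>"
proof -
  have "(cmod (f z - cnj (f \<zeta>)))\<^sup>2 * (Im z * Im \<zeta>) \<le> (cmod (z - cnj \<zeta>))\<^sup>2 * (Im (f z) * Im (f \<zeta>))"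
    using assms unfolding pick_ineq_def by blast
  hence "(cmod (f z - cnj (f \<zeta>)))\<^sup>2 * (Im z * Im \<zeta>) \<le> 0" unfolding assms(3) by simp
  hence "f z = cnj (f \<zeta>)" using assms by (auto simp: mult_le_0_iff upper_half_plane_def)
  thus ?thesis using assms(3) by (simp add: complex_eq_iff)
qed

text \<open>Both sides are divided by |f z|^2 |f \<zeta>|^2. The map -1/f carries statements about
  the boundary value 0 over to the boundary value infinity.\<close>

lemma pick_ineq_neg_inverse:
  assumes f: "pick_ineq f upper_half_plane" and nz: "\<And>z. z \<in> upper_half_plane \<Longrightarrow> f z \<noteq> 0"
  shows "pick_ineq (\<lambda>z. - inverse (f z)) upper_half_plane"
  unfolding pick_ineq_def
proof (intro conjI ballI)
  have Im: "Im (- inverse (f z)) = Im (f z) / (cmod (f z))\<^sup>2" for z by (simp add: cmod_power2)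
  show "0 \<le> Im (- inverse (f z))" if "z \<in> upper_half_plane" for z
    unfolding Im using f that by (simp add: pick_ineq_def)
  fix z \<zeta> assume z: "z \<in> upper_half_plane" "\<zeta> \<in> upper_half_plane"
  have "- inverse (f z) - cnj (- inverse (f \<zeta>)) = (f z - cnj (f \<zeta>)) / (f z * cnj (f \<zeta>))"
    using nz[OF z(1)] nz[OF z(2)] by (simp add: field_simps)
  hence "(cmod (- inverse (f z) - cnj (- inverse (f \<zeta>))))\<^sup>2 = (cmod (f z - cnj (f \<zeta>)))\<^sup>2 / ((cmod (f z))\<^sup>2 * (cmod (f \<zeta>))\<^sup>2)"
    by (simp add: norm_divide norm_mult power_divide power_mult_distrib)
  moreover have "(cmod (f z - cnj (f \<zeta>)))\<^sup>2 * (Im z * Im \<zeta>) \<le> (cmod (z - cnj \<zeta>))\<^sup>2 * (Im (f z) * Im (f \<zeta>))"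
    using f z by (simp add: pick_ineq_def)
  hence "(cmod (f z - cnj (f \<zeta>)))\<^sup>2 * (Im z * Im \<zeta>) / ((cmod (f z))\<^sup>2 * (cmod (f \<zeta>))\<^sup>2)
      \<le> (cmod (z - cnj \<zeta>))\<^sup>2 * (Im (f z) * Im (f \<zeta>)) / ((cmod (f z))\<^sup>2 * (cmod (f \<zeta>))\<^sup>2)"
    by (intro divide_right_mono) auto
  ultimately show "(cmod (- inverse (f z) - cnj (- inverse (f \<zeta>))))\<^sup>2 * (Im z * Im \<zeta>)
      \<le> (cmod (z - cnj \<zeta>))\<^sup>2 * (Im (- inverse (f z)) * Im (- inverse (f \<zeta>)))"
    unfolding Im by simp
qed

(* A Julia-Caratheodory estimate: let the second point of the Pick inequality tend to x. *)
lemma pick_ineq_boundary_bound: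
  assumes f: "pick_ineq f upper_half_plane" and X: "\<And>n. X n \<in> upper_half_plane" "X \<longlonglongrightarrow> complex_of_real x"
    and lim: "(\<lambda>n. f (X n)) \<longlonglongrightarrow> \<eta>" "cnj \<eta> = \<eta>" and bound: "\<And>n. Im (f (X n)) \<le> B * Im (X n)"
    and \<zeta>: "\<zeta> \<in> upper_half_plane"
  shows "cmod (f \<zeta> - \<eta>) * Im \<zeta> \<le> B * (cmod (\<zeta> - of_real x))\<^sup>2"
proof -
  have Im\<zeta>: "0 < Im \<zeta>" and f\<zeta>: "0 \<le> Im (f \<zeta>)" using \<zeta> f by (auto simp: upper_half_plane_def pick_ineq_def)
  have "(cmod (f \<zeta> - cnj (f (X n))))\<^sup>2 * Im \<zeta> \<le> (cmod (\<zeta> - cnj (X n)))\<^sup>2 * (Im (f \<zeta>) * B)" for n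
  proof -
    have p: "0 < Im (X n)" using X(1)[of n] by (simp add: upper_half_plane_def)
    have "(cmod (f \<zeta> - cnj (f (X n))))\<^sup>2 * (Im \<zeta> * Im (X n)) \<le> (cmod (\<zeta> - cnj (X n)))\<^sup>2 * (Im (f \<zeta>) * Im (f (X n)))"
      using f \<zeta> X(1) by (simp add: pick_ineq_def)
    also have "\<dots> \<le> (cmod (\<zeta> - cnj (X n)))\<^sup>2 * (Im (f \<zeta>) * (B * Im (X n)))"
      using bound f\<zeta> by (intro mult_left_mono) auto
    finally have "((cmod (f \<zeta> - cnj (f (X n))))\<^sup>2 * Im \<zeta>) * Im (X n) \<le> ((cmod (\<zeta> - cnj (X n)))\<^sup>2 * (Im (f \<zeta>) * B)) * Im (X n)"
      by (simp add: mult_ac)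
    thus ?thesis using p by simp
  qed
  moreover have "(\<lambda>n. (cmod (f \<zeta> - cnj (f (X n))))\<^sup>2 * Im \<zeta>) \<longlonglongrightarrow> (cmod (f \<zeta> - cnj \<eta>))\<^sup>2 * Im \<zeta>"
    by (intro tendsto_intros lim)
  moreover have "(\<lambda>n. (cmod (\<zeta> - cnj (X n)))\<^sup>2 * (Im (f \<zeta>) * B)) \<longlonglongrightarrow> (cmod (\<zeta> - cnj (of_real x)))\<^sup>2 * (Im (f \<zeta>) * B)"
    by (intro tendsto_intros X)
  ultimately have "(cmod (f \<zeta> - \<eta>))\<^sup>2 * Im \<zeta> \<le> (cmod (\<zeta> - of_real x))\<^sup>2 * (Im (f \<zeta>) * B)"
    using lim(2) by (intro LIMSEQ_le[of _ _ "\<lambda>n. (cmod (\<zeta> - cnj (X n)))\<^sup>2 * (Im (f \<zeta>) * B)"]) auto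
  moreover have "B \<ge> 0"
  proof -
    have "0 \<le> B * Im (X 0)" using bound[of 0] f X(1)[of 0] by (auto simp: pick_ineq_def intro: order_trans)
    moreover have "0 < Im (X 0)" using X(1)[of 0] by (simp add: upper_half_plane_def)
    ultimately show ?thesis by (simp add: zero_le_mult_iff)
  qed
  \<comment> \<open>The limit \<eta> is real, so Im (f \<zeta>) on the right is at most |f \<zeta> -
    \<eta>|, and one factor of the square on the left cancels.\<close>
  moreover have "Im (f \<zeta>) \<le> cmod (f \<zeta> - \<eta>)"
  proof -
    have "Im \<eta> = 0" using lim(2) by (simp add: complex_eq_iff)
    thus ?thesis using abs_Im_le_cmod[of "f \<zeta> - \<eta>"] by simp
  qed
  hence "(cmod (\<zeta> - of_real x))\<^sup>2 * (Im (f \<zeta>) * B) \<le> (cmod (\<zeta> - of_real x))\<^sup>2 * (cmod (f \<zeta> - \<eta>) * B)"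
    using \<open>B \<ge> 0\<close> by (intro mult_left_mono mult_right_mono) auto
  ultimately have "cmod (f \<zeta> - \<eta>) * (cmod (f \<zeta> - \<eta>) * Im \<zeta>) \<le> cmod (f \<zeta> - \<eta>) * (B * (cmod (\<zeta> - of_real x))\<^sup>2)"
    by (simp add: power2_eq_square mult_ac)
  thus ?thesis using \<open>B \<ge> 0\<close> by (cases "f \<zeta> = \<eta>") auto
qed

section \<open>Boundary behaviour deduced from a single sequence\<close>

lemma stolz_sector_subset: "stolz_sector x M \<subseteq> upper_half_plane"
  by (auto simp: stolz_sector_def upper_half_plane_def)

text \<open>In a sector |z - x| is at most (1 + M) Im z, so closeness to the real number \<eta>
  gives Im f = O(Im z) along a sequence. The boundary estimate spreads this to the whole half plane,
  hence to every sector; the same bound keeps the diagonal kernel finite along the sequence.\<close>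

lemma nt_close_imp_boundary_value:
  assumes f: "pick_ineq f upper_half_plane" and \<eta>: "cnj \<eta> = \<eta>" and M: "M > 0" "B > 0"
    and freq: "\<exists>\<^sub>F z in at (complex_of_real x) within stolz_sector x M. cmod (f z - \<eta>) \<le> B * cmod (z - of_real x)"
  shows "nt_limit f x (Value \<eta>)" "\<not> nt_limit (\<lambda>z. pick_kernel f z z) x Infty"
proof -
  obtain X where X: "\<forall>n. X n \<in> stolz_sector x M - {of_real x} \<and> cmod (f (X n) - \<eta>) \<le> B * cmod (X n - of_real x)"
    "X \<longlonglongrightarrow> complex_of_real x"
    by (rule frequently_within_sequence[OF freq])
  have XH: "X n \<in> upper_half_plane" for n using X(1) stolz_sector_subset by blast
  have "(\<lambda>n. f (X n) - \<eta>) \<longlonglongrightarrow> 0"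
  proof (rule Lim_null_comparison)
    show "(\<lambda>n. B * cmod (X n - of_real x)) \<longlonglongrightarrow> 0" using X(2) by (auto intro!: tendsto_eq_intros)
  qed (use X in auto)
  hence lim: "(\<lambda>n. f (X n)) \<longlonglongrightarrow> \<eta>" by (rule LIM_zero_cancel)
  have Im\<eta>: "Im \<eta> = 0" using \<eta> by (simp add: complex_eq_iff)
  have bound: "Im (f (X n)) \<le> (B * (1 + M)) * Im (X n)" for n
  proof -
    have "Im (f (X n)) \<le> cmod (f (X n) - \<eta>)" using abs_Im_le_cmod[of "f (X n) - \<eta>"] Im\<eta> by simp
    also have "\<dots> \<le> B * cmod (X n - of_real x)" using X by blast
    also have "\<dots> \<le> B * ((1 + M) * Im (X n))" using X(1) M stolz_sectorD(3)[of "X n" x M] by (intro mult_left_mono) auto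
    finally show ?thesis by (simp add: mult_ac)
  qed
  note bd = pick_ineq_boundary_bound[OF f XH X(2) lim \<eta> bound]
  show "nt_limit f x (Value \<eta>)" unfolding nt_limit_Value
  proof safe
    fix M' :: real assume M': "M' > 0"
    have "cmod (f z - \<eta>) \<le> B * (1 + M) * (1 + M') * cmod (z - of_real x)" if z: "z \<in> stolz_sector x M'" for z
    proof -
      note s = stolz_sectorD[OF z]
      have "cmod (f z - \<eta>) * Im z \<le> B * (1 + M) * (cmod (z - of_real x))\<^sup>2"
        using z stolz_sector_subset by (intro bd) blast
      also have "\<dots> \<le> B * (1 + M) * (((1 + M') * Im z) * cmod (z - of_real x))"
        unfolding power2_eq_square using M s by (intro mult_left_mono mult_right_mono) auto
      also have "\<dots> = (B * (1 + M) * (1 + M') * cmod (z - of_real x)) * Im z" by (simp add: mult_ac)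
      finally show ?thesis using s(1) by simp
    qed
    hence "\<forall>\<^sub>F z in at (complex_of_real x) within stolz_sector x M'. norm (f z - \<eta>) \<le> B * (1 + M) * (1 + M') * cmod (z - of_real x)"
      by (auto simp: eventually_at_filter)
    hence "((\<lambda>z. f z - \<eta>) \<longlongrightarrow> 0) (at (complex_of_real x) within stolz_sector x M')"
      by (rule Lim_null_comparison) (auto intro!: tendsto_eq_intros)
    thus "(f \<longlongrightarrow> \<eta>) (at (complex_of_real x) within stolz_sector x M')" by (rule LIM_zero_cancel)
  qed
  show "\<not> nt_limit (\<lambda>z. pick_kernel f z z) x Infty"
  proof
    assume "nt_limit (\<lambda>z. pick_kernel f z z) x Infty"
    hence 1: "filterlim (\<lambda>z. pick_kernel f z z) at_infinity (at (complex_of_real x) within stolz_sector x M)"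
      using M by (simp add: nt_limit_Infty)
    have "filterlim (\<lambda>n. pick_kernel f (X n) (X n)) at_infinity sequentially"
      using X by (intro filterlim_compose[OF 1] filterlim_stolz_sequence) auto
    moreover have "0 < B * (1 + M) + 1" using M by (intro add_pos_pos mult_pos_pos) auto
    ultimately have "eventually (\<lambda>n. B * (1 + M) + 1 \<le> cmod (pick_kernel f (X n) (X n))) sequentially"
      unfolding filterlim_at_infinity[OF order_refl] by blast
    then obtain n where n: "B * (1 + M) + 1 \<le> cmod (pick_kernel f (X n) (X n))"
      using eventually_sequentially by auto
    have p: "0 < Im (X n)" "0 \<le> Im (f (X n))" using XH[of n] f by (auto simp: upper_half_plane_def pick_ineq_def)
    hence "cmod (pick_kernel f (X n) (X n)) = Im (f (X n)) / Im (X n)" by (simp add: pick_kernel_diagonal norm_divide)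
    also have "\<dots> \<le> B * (1 + M)" using bound[of n] p by (simp add: pos_divide_le_eq)
    finally show False using n by simp
  qed
qed

text \<open>A kernel that fails to tend to infinity stays below some r along a sequence in one
  sector. This is the bound on Im f which the boundary estimate requires, and the estimate is then
  applied at the points of that same sequence.\<close>

lemma kernel_not_infinite_imp_nt_close:
  assumes f: "pick_ineq f upper_half_plane" and \<eta>: "cnj \<eta> = \<eta>"
    and bv: "nt_limit f x (Value \<eta>)" and K: "\<not> nt_limit (\<lambda>z. pick_kernel f z z) x Infty"
  obtains M B X where "M > 0" "\<forall>n. X n \<in> stolz_sector x M" "X \<longlonglongrightarrow> complex_of_real x"
    "\<forall>n. cmod (f (X n) - \<eta>) \<le> B * cmod (X n - of_real x)"
proof -
  obtain M r where M: "M > 0" "0 < r" "\<not> (\<forall>\<^sub>F z in at (complex_of_real x) within stolz_sector x M. r \<le> cmod (pick_kernel f z z))"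
    using K unfolding nt_limit_Infty filterlim_at_infinity[OF order_refl] by blast
  hence "\<exists>\<^sub>F z in at (complex_of_real x) within stolz_sector x M. cmod (pick_kernel f z z) < r"
    by (simp add: frequently_def not_less)
  then obtain X where X: "\<forall>n. X n \<in> stolz_sector x M - {of_real x} \<and> cmod (pick_kernel f (X n) (X n)) < r"
    "X \<longlonglongrightarrow> complex_of_real x" by (rule frequently_within_sequence)
  have XH: "X n \<in> upper_half_plane" for n using X(1) stolz_sector_subset by blast
  have bound: "Im (f (X n)) \<le> r * Im (X n)" for n
  proof -
    have p: "0 < Im (X n)" "0 \<le> Im (f (X n))" using XH[of n] f by (auto simp: upper_half_plane_def pick_ineq_def)
    hence "Im (f (X n)) / Im (X n) < r" using X(1)[rule_format, of n] by (simp add: pick_kernel_diagonal norm_divide)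
    thus ?thesis using p by (simp add: pos_divide_less_eq)
  qed
  have 1: "(f \<longlongrightarrow> \<eta>) (at (complex_of_real x) within stolz_sector x M)" using bv M by (simp add: nt_limit_Value)
  have lim: "(\<lambda>n. f (X n)) \<longlonglongrightarrow> \<eta>"
    using X by (intro filterlim_compose[OF 1] filterlim_stolz_sequence) auto
  note bd = pick_ineq_boundary_bound[OF f XH X(2) lim \<eta> bound]
  have "cmod (f (X n) - \<eta>) \<le> r * (1 + M) * cmod (X n - of_real x)" for n
  proof -
    note s = stolz_sectorD[of "X n" x M]
    have Xn: "X n \<in> stolz_sector x M" using X by blast
    have "cmod (f (X n) - \<eta>) * Im (X n) \<le> r * (cmod (X n - of_real x))\<^sup>2" by (rule bd[OF XH])
    also have "\<dots> \<le> r * (((1 + M) * Im (X n)) * cmod (X n - of_real x))"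
      unfolding power2_eq_square using M s[OF Xn] by (intro mult_left_mono mult_right_mono) auto
    also have "\<dots> = (r * (1 + M) * cmod (X n - of_real x)) * Im (X n)" by (simp add: mult_ac)
    finally show ?thesis using s[OF Xn] by simp
  qed
  thus ?thesis using that[OF M(1), of X "r * (1 + M)"] X by blast
qed

section \<open>Boundary behaviour of the parameter\<close>

(* Homogeneous coordinates (hom_num, hom_den) of the parameter, to treat infinity uniformly. *)
definition hom_num :: "(complex \<Rightarrow> complex) with_infty \<Rightarrow> complex \<Rightarrow> complex" where
  "hom_num \<phi> z = (case \<phi> of Value f \<Rightarrow> f z | Infty \<Rightarrow> 1)"

definition hom_den :: "(complex \<Rightarrow> complex) with_infty \<Rightarrow> complex" where
  "hom_den \<phi> = (case \<phi> of Value f \<Rightarrow> 1 | Infty \<Rightarrow> 0)"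

lemma hom_simps [simp]:
  "hom_num (Value f) z = f z" "hom_num Infty z = 1" "hom_den (Value f) = 1" "hom_den Infty = 0"
  by (simp_all add: hom_num_def hom_den_def)

text \<open>The disjunction of the two conditions becomes an implication, because uniqueness of
  boundary values makes C_1 the negation of the first half of C_2. The pair (e, c) is kept instead
  of \<eta>, so that e = 0 fits in.\<close>

definition node_cond :: "complex \<Rightarrow> complex \<Rightarrow> (complex \<Rightarrow> complex) with_infty \<Rightarrow> real \<Rightarrow> bool" where
  "node_cond e c \<phi> x \<longleftrightarrow>
     (e \<noteq> 0 \<longrightarrow> boundary_value \<phi> x (Value (c / e)) \<longrightarrow> boundary_kernel \<phi> x Infty) \<and>
     (e = 0 \<longrightarrow> boundary_value \<phi> x Infty \<longrightarrow> boundary_residue \<phi> x (Value 0))"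

text \<open>As |e p - c q| = |z - x| |h_i|, this says (|p| + |q|) / |h_i| -> 0 in every sector. The
  strict inequality without division also yields that h_i does not vanish.\<close>

definition good_node :: "complex \<Rightarrow> complex \<Rightarrow> (complex \<Rightarrow> complex) with_infty \<Rightarrow> real \<Rightarrow> bool" where
  "good_node e c \<phi> x \<longleftrightarrow> (\<forall>M>0. \<forall>B>0. \<forall>\<^sub>F z in at (complex_of_real x) within stolz_sector x M.
     B * cmod (z - of_real x) * (cmod (hom_num \<phi> z) + cmod (hom_den \<phi>)) < cmod (e * hom_num \<phi> z - c * hom_den \<phi>))"

(* The scaling t is 1/phi where phi tends to infinity, and 1 otherwise. *)
definition bad_node :: "complex \<Rightarrow> complex \<Rightarrow> (complex \<Rightarrow> complex) with_infty \<Rightarrow> real \<Rightarrow> bool" where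
  "bad_node e c \<phi> x \<longleftrightarrow> (\<exists>M>0. \<exists>X t p q a. (\<forall>n. X n \<in> stolz_sector x M) \<and> X \<longlonglongrightarrow> complex_of_real x \<and>
     (\<lambda>n. t n * hom_num \<phi> (X n)) \<longlonglongrightarrow> p \<and> (\<lambda>n. t n * hom_den \<phi>) \<longlonglongrightarrow> q \<and> (p \<noteq> 0 \<or> q \<noteq> 0) \<and>
     (\<lambda>n. t n * (e * hom_num \<phi> (X n) - c * hom_den \<phi>) / (X n - of_real x)) \<longlonglongrightarrow> a)"

section \<open>From the conditions on the parameter to its growth at a node\<close>

lemma eventually_stolz_small:
  assumes "d > 0"
  shows "\<forall>\<^sub>F z in at (complex_of_real x) within stolz_sector x M. B * cmod (z - of_real x) < d"
proof -
  have "((\<lambda>z. B * cmod (z - of_real x)) \<longlongrightarrow> 0) (at (complex_of_real x) within stolz_sector x M)"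
    by (auto intro!: tendsto_eq_intros)
  from order_tendstoD(2)[OF this assms] show ?thesis .
qed

text \<open>If |f - \<eta>| were frequently O(|z - x|), then f would have the boundary value \<eta>
  while its kernel does not tend to infinity, against the condition.\<close>

lemma good_node_nonzero:
  assumes f: "pick_ineq f upper_half_plane" and e: "e \<noteq> 0" "cnj e = e" "cnj c = c" and nc: "node_cond e c (Value f) x"
  shows "good_node e c (Value f) x"
  unfolding good_node_def
proof safe
  fix M B :: real assume M: "M > 0" "B > 0"
  define \<eta> where "\<eta> = c / e"
  have \<eta>: "cnj \<eta> = \<eta>" using e by (simp add: \<eta>_def)
  \<comment> \<open>|f| + 1 is at most |f - \<eta>| + (|\<eta>| + 1), and each of these two summands
    has to be absorbed by half of |e| |f - \<eta>|; the second one requires the factor 2 (|\<eta>| +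
    1) / |e|.\<close>
  let ?B = "2 * B * (cmod \<eta> + 1) / cmod e"
  have B': "?B > 0" using M e by (intro divide_pos_pos mult_pos_pos add_nonneg_pos) auto
  have "\<not> (\<exists>\<^sub>F z in at (complex_of_real x) within stolz_sector x M. cmod (f z - \<eta>) \<le> ?B * cmod (z - of_real x))"
    using nt_close_imp_boundary_value[OF f \<eta> M(1) B'] nc e(1)
    by (auto simp: node_cond_def boundary_value_def boundary_kernel_def \<eta>_def)
  hence "\<forall>\<^sub>F z in at (complex_of_real x) within stolz_sector x M. ?B * cmod (z - of_real x) < cmod (f z - \<eta>)"
    by (simp add: frequently_def not_le)
  moreover have "\<forall>\<^sub>F z in at (complex_of_real x) within stolz_sector x M. B * cmod (z - of_real x) < cmod e / 2"
    using e by (intro eventually_stolz_small) auto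
  ultimately show "\<forall>\<^sub>F z in at (complex_of_real x) within stolz_sector x M. B * cmod (z - of_real x) *
      (cmod (hom_num (Value f) z) + cmod (hom_den (Value f))) < cmod (e * hom_num (Value f) z - c * hom_den (Value f))"
  proof eventually_elim
    case (elim z)
    have eq: "e * f z - c = e * (f z - \<eta>)" using e by (simp add: \<eta>_def algebra_simps)
    have "cmod (f z) \<le> cmod (f z - \<eta>) + cmod \<eta>" using norm_triangle_ineq[of "f z - \<eta>" \<eta>] by simp
    hence "B * cmod (z - of_real x) * (cmod (f z) + 1) \<le> B * cmod (z - of_real x) * (cmod (f z - \<eta>) + (cmod \<eta> + 1))"
      using M by (intro mult_left_mono) auto
    also have "\<dots> = B * cmod (z - of_real x) * cmod (f z - \<eta>) + B * cmod (z - of_real x) * (cmod \<eta> + 1)"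
      by (simp add: algebra_simps)
    also have "\<dots> < cmod e / 2 * cmod (f z - \<eta>) + cmod e / 2 * cmod (f z - \<eta>)"
    proof (rule add_le_less_mono)
      show "B * cmod (z - of_real x) * cmod (f z - \<eta>) \<le> cmod e / 2 * cmod (f z - \<eta>)"
        using elim(2) by (intro mult_right_mono) auto
      have "cmod e / 2 * (?B * cmod (z - of_real x)) < cmod e / 2 * cmod (f z - \<eta>)"
        using elim(1) e(1) by (intro mult_strict_left_mono) auto
      also have "cmod e / 2 * (?B * cmod (z - of_real x)) = B * cmod (z - of_real x) * (cmod \<eta> + 1)"
        using e(1) by (simp add: field_simps)
      finally show "B * cmod (z - of_real x) * (cmod \<eta> + 1) < cmod e / 2 * cmod (f z - \<eta>)" .
    qed
    also have "\<dots> = cmod (e * f z - c)" unfolding eq norm_mult by simp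
    finally show ?case by simp
  qed
qed

text \<open>If |z - x| |f| frequently stayed away from 0, then -1/f would frequently be O(|z - x|),
  hence have boundary value 0, and f would have boundary value infinity. The condition then demands
  (z - x) f -> 0, a contradiction.\<close>

lemma good_node_zero:
  assumes f: "pick_ineq f upper_half_plane" and c: "c \<noteq> 0" and nc: "node_cond 0 c (Value f) x"
  shows "good_node 0 c (Value f) x"
  unfolding good_node_def
proof safe
  fix M B :: real assume M: "M > 0" "B > 0"
  let ?F = "at (complex_of_real x) within stolz_sector x M"
  have "\<forall>\<^sub>F z in ?F. B * cmod (z - of_real x) * cmod (f z) < cmod c / 2"
  proof (rule ccontr)
    assume "\<not> ?thesis"
    hence freq: "\<exists>\<^sub>F z in ?F. cmod c / 2 \<le> B * cmod (z - of_real x) * cmod (f z)"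
      by (simp add: not_eventually not_less)
    then obtain X where X: "\<forall>n. X n \<in> stolz_sector x M - {of_real x} \<and> cmod c / 2 \<le> B * cmod (X n - of_real x) * cmod (f (X n))"
      "X \<longlonglongrightarrow> of_real x"
      by (rule frequently_within_sequence)
    have XH: "X 0 \<in> upper_half_plane" using X stolz_sector_subset by blast
    have "0 < cmod c / 2" using c by simp
    also have "\<dots> \<le> B * cmod (X 0 - of_real x) * cmod (f (X 0))" using X by blast
    finally have X0: "f (X 0) \<noteq> 0" by auto
    \<comment> \<open>A zero of f would make f constant, although f is nonzero at
      \<open>X 0\<close>; so -1/f is defined everywhere.\<close>
    have nz: "f z \<noteq> 0" if "z \<in> upper_half_plane" for z
      using pick_ineq_real_value_imp_constant[OF f that _ XH] X0 by auto
    define g where "g z = - inverse (f z)" for z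
    have g: "pick_ineq g upper_half_plane" unfolding g_def by (rule pick_ineq_neg_inverse[OF f nz])
    have B': "2 * B / cmod c > 0" using M c by simp
    have "\<exists>\<^sub>F z in ?F. cmod (g z - 0) \<le> (2 * B / cmod c) * cmod (z - of_real x)"
    proof -
      have "\<forall>\<^sub>F z in ?F. z \<in> stolz_sector x M" by (auto simp: eventually_at_filter)
      from frequently_eventually_frequently[OF freq this] show ?thesis
      proof (rule frequently_elim1)
        fix z assume z: "cmod c / 2 \<le> B * cmod (z - of_real x) * cmod (f z) \<and> z \<in> stolz_sector x M"
        hence "f z \<noteq> 0" using nz stolz_sector_subset by blast
        thus "cmod (g z - 0) \<le> (2 * B / cmod c) * cmod (z - of_real x)"
          using z c by (simp add: g_def norm_inverse norm_divide field_simps)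
      qed
    qed
    from nt_close_imp_boundary_value(1)[OF g _ M(1) B' this] have g0: "nt_limit g x (Value 0)" by simp
    have "nt_limit f x Infty"
      unfolding nt_limit_Infty
    proof safe
      fix M' :: real assume M': "M' > 0"
      let ?F' = "at (complex_of_real x) within stolz_sector x M'"
      have "(g \<longlongrightarrow> 0) ?F'" using g0 M' by (simp add: nt_limit_Value)
      hence "((\<lambda>z. - g z) \<longlongrightarrow> 0) ?F'" using tendsto_minus[of g 0] by simp
      moreover have "\<forall>\<^sub>F z in ?F'. - g z \<noteq> 0"
        unfolding eventually_at_filter g_def using nz stolz_sector_subset by (intro always_eventually) auto
      ultimately have "filterlim (\<lambda>z. - g z) (at 0) ?F'" by (simp add: filterlim_at)
      hence "filterlim (\<lambda>z. inverse (- g z)) at_infinity ?F'"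
        by (rule filterlim_compose[OF filterlim_inverse_at_infinity])
      thus "filterlim f at_infinity ?F'" by (simp add: g_def)
    qed
    hence "nt_limit (\<lambda>z. (z - of_real x) * f z) x (Value 0)"
      using nc by (simp add: node_cond_def boundary_value_def boundary_residue_def)
    hence "((\<lambda>z. (z - of_real x) * f z) \<longlongrightarrow> 0) ?F" using M by (simp add: nt_limit_Value)
    hence "\<forall>\<^sub>F z in ?F. cmod ((z - of_real x) * f z) < cmod c / (2 * B)"
      using M c by (auto simp: tendsto_iff dist_norm)
    hence "\<forall>\<^sub>F z in ?F. \<not> cmod c / 2 \<le> B * cmod (z - of_real x) * cmod (f z)"
      unfolding norm_mult by eventually_elim (use M in \<open>simp add: field_simps\<close>)
    with freq show False by (simp add: frequently_def)
  qed
  moreover have "\<forall>\<^sub>F z in ?F. B * cmod (z - of_real x) < cmod c / 2"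
    using c by (intro eventually_stolz_small) auto
  ultimately show "\<forall>\<^sub>F z in ?F. B * cmod (z - of_real x) *
      (cmod (hom_num (Value f) z) + cmod (hom_den (Value f))) < cmod (0 * hom_num (Value f) z - c * hom_den (Value f))"
    by eventually_elim (simp add: algebra_simps)
qed

lemma bounded_quotient_subsequence:
  fixes u :: "nat \<Rightarrow> complex"
  assumes "\<And>n. cmod (u n) \<le> B"
  obtains l r where "strict_mono (r :: nat \<Rightarrow> nat)" "(\<lambda>n. u (r n)) \<longlonglongrightarrow> l"
proof -
  have "bounded (range u)" using assms by (auto simp: bounded_iff)
  from bounded_imp_convergent_subsequence[OF this] that show ?thesis by (auto simp: o_def)
qed

text \<open>The scaling is t = 1 and the limits of p and q are \<eta> and 1. The difference
  quotients of f are bounded along the sequence obtained from the kernel, and compactness provides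
  the limit \<open>a\<close> on a subsequence.\<close>

lemma bad_node_nonzero:
  assumes f: "pick_ineq f upper_half_plane" and e: "e \<noteq> 0" "cnj e = e" "cnj c = c" and nc: "\<not> node_cond e c (Value f) x"
  shows "bad_node e c (Value f) x"
proof -
  define \<eta> where "\<eta> = c / e"
  have \<eta>: "cnj \<eta> = \<eta>" using e by (simp add: \<eta>_def)
  have lim: "nt_limit f x (Value \<eta>)" and K: "\<not> nt_limit (\<lambda>z. pick_kernel f z z) x Infty"
    using nc e by (auto simp: node_cond_def boundary_value_def boundary_kernel_def \<eta>_def)
  obtain M B X where X: "M > 0" "\<forall>n. X n \<in> stolz_sector x M" "X \<longlonglongrightarrow> complex_of_real x"
    "\<forall>n. cmod (f (X n) - \<eta>) \<le> B * cmod (X n - of_real x)"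
    by (rule kernel_not_infinite_imp_nt_close[OF f \<eta> lim K])
  have ne: "X n \<noteq> of_real x" for n using X(2) stolz_sectorD(2) by blast
  have "cmod ((f (X n) - \<eta>) / (X n - of_real x)) \<le> B" for n
    using X(4)[rule_format, of n] ne[of n] by (simp add: norm_divide divide_le_eq)
  then obtain l r where r: "strict_mono (r :: nat \<Rightarrow> nat)" "(\<lambda>n. (f (X (r n)) - \<eta>) / (X (r n) - of_real x)) \<longlonglongrightarrow> l"
    by (rule bounded_quotient_subsequence)
  have Xr: "(\<lambda>n. X (r n)) \<longlonglongrightarrow> of_real x" using LIMSEQ_subseq_LIMSEQ[OF X(3) r(1)] by (simp add: o_def)
  have "(f \<longlongrightarrow> \<eta>) (at (complex_of_real x) within stolz_sector x M)" using lim X(1) by (simp add: nt_limit_Value)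
  hence fX: "(\<lambda>n. f (X (r n))) \<longlonglongrightarrow> \<eta>"
    by (rule filterlim_compose) (use X Xr in \<open>auto intro!: filterlim_stolz_sequence\<close>)
  have eq: "e * f z - c = e * (f z - \<eta>)" for z using e by (simp add: \<eta>_def algebra_simps)
  have "(\<lambda>n. e * ((f (X (r n)) - \<eta>) / (X (r n) - of_real x))) \<longlonglongrightarrow> e * l" by (intro tendsto_intros r)
  hence "(\<lambda>n. (e * f (X (r n)) - c) / (X (r n) - of_real x)) \<longlonglongrightarrow> e * l" unfolding eq by simp
  thus ?thesis unfolding bad_node_def using X Xr fX
    by (intro exI[of _ M] conjI exI[of _ "\<lambda>n. X (r n)"] exI[of _ "\<lambda>_. 1"] exI[of _ \<eta>] exI[of _ 1] exI[of _ "e * l"]) auto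
qed

text \<open>With e = 0 and t = 1/f the scaled quotient is -c / ((z - x) f). It is bounded along a
  sequence on which (z - x) f stays away from 0, while t p = 1 and t q -> 0.\<close>

lemma bad_node_zero:
  assumes nc: "\<not> node_cond 0 c (Value f) x"
  shows "bad_node 0 c (Value f) x"
proof -
  have lim: "nt_limit f x Infty" and K: "\<not> nt_limit (\<lambda>z. (z - of_real x) * f z) x (Value 0)"
    using nc by (auto simp: node_cond_def boundary_value_def boundary_residue_def)
  obtain M r where M: "M > 0" "0 < r" "\<not> (\<forall>\<^sub>F z in at (complex_of_real x) within stolz_sector x M. cmod ((z - of_real x) * f z) < r)"
    using K unfolding nt_limit_Value tendsto_iff dist_norm by auto
  hence "\<exists>\<^sub>F z in at (complex_of_real x) within stolz_sector x M. r \<le> cmod ((z - of_real x) * f z)"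
    by (simp add: not_eventually not_less)
  then obtain X where X: "\<forall>n. X n \<in> stolz_sector x M - {of_real x} \<and> r \<le> cmod ((X n - of_real x) * f (X n))"
    "X \<longlonglongrightarrow> complex_of_real x" by (rule frequently_within_sequence)
  have nz: "f (X n) \<noteq> 0" for n using X(1)[rule_format, of n] M by auto
  have "cmod (1 / ((X n - of_real x) * f (X n))) \<le> 1 / r" for n
    using X(1)[rule_format, of n] M unfolding norm_divide norm_one
    by (intro divide_left_mono mult_pos_pos) auto
  then obtain l s where s: "strict_mono (s :: nat \<Rightarrow> nat)" "(\<lambda>n. 1 / ((X (s n) - of_real x) * f (X (s n)))) \<longlonglongrightarrow> l"
    by (rule bounded_quotient_subsequence)
  have Xr: "(\<lambda>n. X (s n)) \<longlonglongrightarrow> of_real x" using LIMSEQ_subseq_LIMSEQ[OF X(2) s(1)] by (simp add: o_def)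
  have "filterlim f at_infinity (at (complex_of_real x) within stolz_sector x M)" using lim M(1) by (simp add: nt_limit_Infty)
  hence "filterlim (\<lambda>n. f (X (s n))) at_infinity sequentially"
    by (rule filterlim_compose) (use X Xr in \<open>auto intro!: filterlim_stolz_sequence\<close>)
  hence i0: "(\<lambda>n. inverse (f (X (s n)))) \<longlonglongrightarrow> 0"
    by (rule filterlim_compose[OF tendsto_inverse_0])
  have "(\<lambda>n. - c * (1 / ((X (s n) - of_real x) * f (X (s n))))) \<longlonglongrightarrow> - c * l" by (intro tendsto_intros s)
  hence "(\<lambda>n. inverse (f (X (s n))) * (0 * f (X (s n)) - c) / (X (s n) - of_real x)) \<longlonglongrightarrow> - c * l"
    by (simp add: divide_inverse mult_ac)
  thus ?thesis unfolding bad_node_def using X Xr i0 M(1) nz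
    by (intro exI[of _ M] conjI exI[of _ "\<lambda>n. X (s n)"] exI[of _ "\<lambda>n. inverse (f (X (s n)))"] exI[of _ 1] exI[of _ 0] exI[of _ "- c * l"]) auto
qed

lemma good_node_Infty: "e \<noteq> 0 \<Longrightarrow> good_node e c Infty x"
  unfolding good_node_def using eventually_stolz_small[of "cmod e" _ x] by auto

lemma bad_node_Infty: "bad_node 0 c Infty x"
proof -
  have "(\<lambda>n. complex_of_real x + \<i> * of_real (inverse (real (Suc n)))) \<longlonglongrightarrow> of_real x + \<i> * of_real 0"
    by (intro tendsto_intros LIMSEQ_inverse_real_of_nat)
  thus ?thesis unfolding bad_node_def
    by (intro exI[of _ 1] conjI exI[of _ "\<lambda>n. complex_of_real x + \<i> * of_real (inverse (real (Suc n)))"] exI[of _ "\<lambda>n. 1"] exI[of _ 0])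
       (auto simp: stolz_sector_def)
qed

lemma node_dichotomy:
  assumes "\<phi> \<in> extended_nevanlinna" "cnj e = e" "cnj c = c" "e \<noteq> 0 \<or> c \<noteq> 0"
  shows "node_cond e c \<phi> x \<Longrightarrow> good_node e c \<phi> x" "\<not> node_cond e c \<phi> x \<Longrightarrow> bad_node e c \<phi> x"
proof -
  consider "\<phi> = Infty" | f where "\<phi> = Value f" "pick_ineq f upper_half_plane"
    using assms(1) nevanlinna_0_pick_ineq by (auto simp: extended_nevanlinna_def)
  note cases = this
  show "good_node e c \<phi> x" if "node_cond e c \<phi> x"
    using cases
  proof cases
    case 1
    thus ?thesis using that good_node_Infty by (cases "e = 0") (auto simp: node_cond_def boundary_value_def boundary_residue_def)
  next
    case (2 f)
    thus ?thesis using that good_node_nonzero[of f e c] good_node_zero[of f c] assms by (cases "e = 0") auto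
  qed
  show "bad_node e c \<phi> x" if "\<not> node_cond e c \<phi> x"
    using cases
  proof cases
    case 1
    thus ?thesis using that bad_node_Infty by (cases "e = 0") (auto simp: node_cond_def boundary_value_def)
  next
    case (2 f)
    thus ?thesis using that bad_node_nonzero[of f e c] bad_node_zero[of c f] assms by (cases "e = 0") auto
  qed
qed

section \<open>Boundary derivatives\<close>

text \<open>The remainder u = w - w0 - \<gamma> (z - x) is o(|z - x|) in every sector. Cauchy's
  estimate on a disc whose radius is comparable to |z - x| turns this into u' = o(1).\<close>

lemma nt_limit_deriv_if_quotient:
  assumes an: "\<And>M. M > 0 \<Longrightarrow> \<forall>\<^sub>F z in at (complex_of_real x) within stolz_sector x M. w analytic_on {z}"
    and quot: "nt_limit (\<lambda>z. (w z - w0) / (z - of_real x)) x (Value \<gamma>)"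
  shows "nt_limit (deriv w) x (Value \<gamma>)"
  unfolding nt_limit_Value
proof safe
  fix M :: real assume M: "M > 0"
  \<comment> \<open>On the disc of radius r = Im z / 2 about z the imaginary part is at least r, and
    the real part differs from x by at most M Im z + r = (2 M + 1) r; so the disc lies in the sector
    with aperture N.\<close>
  define N where "N = 2 * M + 1"
  have N: "N > 0" using M by (simp add: N_def)
  show "(deriv w \<longlongrightarrow> \<gamma>) (at (complex_of_real x) within stolz_sector x M)"
  proof (rule tendstoI)
    fix \<epsilon> :: real assume \<epsilon>: "\<epsilon> > 0"
    \<comment> \<open>Cauchy's estimate gives 2 \<epsilon>' |z - x| / r = 4 \<epsilon>' |z - x| / Im
      z, at most 4 \<epsilon>' (1 + M) = \<epsilon> / 2.\<close>
    define \<epsilon>' where "\<epsilon>' = \<epsilon> / (8 * (1 + M))"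
    have \<epsilon>': "\<epsilon>' > 0" using \<epsilon> M by (simp add: \<epsilon>'_def)
    have "\<forall>\<^sub>F z in at (complex_of_real x) within stolz_sector x N. w analytic_on {z} \<and> dist ((w z - w0) / (z - of_real x)) \<gamma> < \<epsilon>'"
      using an[OF N] quot N \<epsilon>' unfolding nt_limit_Value tendsto_iff by (intro eventually_conj) auto
    then obtain d where d: "d > 0" "\<And>z. z \<in> stolz_sector x N \<Longrightarrow> cmod (z - of_real x) < d \<Longrightarrow>
        w analytic_on {z} \<and> dist ((w z - w0) / (z - of_real x)) \<gamma> < \<epsilon>'"
      unfolding eventually_stolz_sector_eq by blast
    have "dist (deriv w z) \<gamma> < \<epsilon>" if z: "z \<in> stolz_sector x M" "cmod (z - of_real x) < d / 2" for z
    proof -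
      note s = stolz_sectorD[OF z(1)]
      define r where "r = Im z / 2"
      have r: "r > 0" using s by (simp add: r_def)
      have Imle: "Im z \<le> cmod (z - of_real x)" using abs_Im_le_cmod[of "z - of_real x"] by simp
      have in_sec: "\<xi> \<in> stolz_sector x N \<and> cmod (\<xi> - of_real x) \<le> 2 * cmod (z - of_real x)" if \<xi>: "cmod (z - \<xi>) \<le> r" for \<xi>
      proof -
        have 1: "\<bar>Re z - Re \<xi>\<bar> \<le> r" "\<bar>Im z - Im \<xi>\<bar> \<le> r"
          using \<xi> abs_Re_le_cmod[of "z - \<xi>"] abs_Im_le_cmod[of "z - \<xi>"] by auto
        have 2: "\<bar>Re z - x\<bar> \<le> M * Im z" using z(1) by (simp add: stolz_sector_def)
        have 3: "r \<le> Im \<xi>" using 1 by (simp add: r_def abs_if split: if_splits)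
        have "\<bar>Re \<xi> - x\<bar> \<le> M * Im z + r" using 1(1) 2 by linarith
        also have "\<dots> = N * r" by (simp add: r_def N_def algebra_simps)
        also have "\<dots> \<le> N * Im \<xi>" using 3 N by (intro mult_left_mono) auto
        finally have "\<xi> \<in> stolz_sector x N" using 3 r by (simp add: stolz_sector_def)
        moreover have "cmod (\<xi> - of_real x) \<le> cmod (z - of_real x) + r"
          using \<xi> norm_triangle_ineq4[of "z - of_real x" "z - \<xi>"] by simp
        ultimately show ?thesis using Imle s(1) by (simp add: r_def)
      qed
      define u where "u \<xi> = w \<xi> - w0 - \<gamma> * (\<xi> - of_real x)" for \<xi>
      have w_an: "w analytic_on {\<xi>}" if "cmod (z - \<xi>) \<le> r" for \<xi>
        using d(2) in_sec[OF that] z(2) by force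
      have w_an': "w analytic_on cball z r"
        using w_an by (subst analytic_on_analytic_at) (auto simp: dist_norm)
      hence hol: "w holomorphic_on cball z r" by (rule analytic_imp_holomorphic)
      have u_hol: "u holomorphic_on cball z r" unfolding u_def by (intro holomorphic_intros hol)
      have "cmod ((deriv ^^ 1) u z) \<le> fact 1 * (\<epsilon>' * (2 * cmod (z - of_real x))) / r ^ 1"
      proof (rule Cauchy_inequality)
        show "u holomorphic_on ball z r" using u_hol by (rule holomorphic_on_subset) auto
        show "continuous_on (cball z r) u" using u_hol by (rule holomorphic_on_imp_continuous_on)
        fix \<xi> assume \<xi>: "cmod (z - \<xi>) = r"
        note i = in_sec[of \<xi>]
        have xne: "\<xi> \<noteq> of_real x" using i \<xi> stolz_sectorD(2) by auto
        have "dist ((w \<xi> - w0) / (\<xi> - of_real x)) \<gamma> < \<epsilon>'" using d(2) i \<xi> z(2) by force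
        moreover have "u \<xi> = ((w \<xi> - w0) / (\<xi> - of_real x) - \<gamma>) * (\<xi> - of_real x)"
          using xne by (simp add: u_def field_simps)
        ultimately have "cmod (u \<xi>) \<le> \<epsilon>' * cmod (\<xi> - of_real x)"
          unfolding dist_norm by (simp add: norm_mult mult_right_mono)
        also have "\<dots> \<le> \<epsilon>' * (2 * cmod (z - of_real x))" using i \<xi> \<epsilon>' by (intro mult_left_mono) auto
        finally show "cmod (u \<xi>) \<le> \<epsilon>' * (2 * cmod (z - of_real x))" .
      qed (use r in auto)
      moreover have "deriv u z = deriv w z - \<gamma>"
      proof (rule DERIV_imp_deriv)
        have "(w has_field_derivative deriv w z) (at z)"
          using w_an[of z] r analytic_at_imp_isCont by (intro analytic_derivI) auto
        thus "(u has_field_derivative deriv w z - \<gamma>) (at z)" unfolding u_def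
          by (auto intro!: derivative_eq_intros)
      qed
      ultimately have "cmod (deriv w z - \<gamma>) \<le> 4 * \<epsilon>' * (cmod (z - of_real x) / Im z)" by (simp add: r_def)
      also have "\<dots> \<le> 4 * \<epsilon>' * (1 + M)" using s \<epsilon>' by (intro mult_left_mono) (auto simp: pos_divide_le_eq)
      also have "\<dots> = \<epsilon> / 2"
      proof -
        have "4 * (\<epsilon> / (8 * K)) * K = \<epsilon> / 2" if "K \<noteq> 0" for K using that by simp
        from this[of "1 + M"] show ?thesis using M by (simp only: \<epsilon>'_def)
      qed
      also have "\<dots> < \<epsilon>" using \<epsilon> by simp
      finally show ?thesis by (simp add: dist_norm)
    qed
    thus "\<forall>\<^sub>F z in at (complex_of_real x) within stolz_sector x M. dist (deriv w z) \<gamma> < \<epsilon>"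
      unfolding eventually_stolz_sector_eq using d(1) by (intro exI[of _ "d / 2"]) auto
  qed
qed

text \<open>The value at a pole is the dummy 0, so boundedness must be contradicted at points around
  the pole. They need not lie in the given sector; the limit is therefore used in the sector with
  aperture M + 1, whose interior contains the given one.\<close>

lemma nt_limit_imp_eventually_analytic:
  assumes w: "w nicely_meromorphic_on upper_half_plane" and lim: "nt_limit w x (Value w0)" and M: "M > 0"
  shows "\<forall>\<^sub>F z in at (complex_of_real x) within stolz_sector x M. w analytic_on {z}"
proof -
  have "((\<lambda>z. w z) \<longlongrightarrow> w0) (at (complex_of_real x) within stolz_sector x (M + 1))" using lim M by (simp add: nt_limit_Value)
  hence "\<forall>\<^sub>F z in at (complex_of_real x) within stolz_sector x (M + 1). dist (w z) w0 < 1" by (rule tendstoD) simp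
  then obtain d where d: "d > 0" "\<And>z. z \<in> stolz_sector x (M + 1) \<Longrightarrow> cmod (z - of_real x) < d \<Longrightarrow> dist (w z) w0 < 1"
    unfolding eventually_stolz_sector_eq by blast
  have "w analytic_on {z0}" if z0: "z0 \<in> stolz_sector x M" "cmod (z0 - of_real x) < d" for z0
  proof (rule nicely_meromorphic_on_imp_analytic_at[OF w])
    show "z0 \<in> upper_half_plane" using z0 stolz_sector_subset by blast
    show "\<not> is_pole w z0"
    proof
      assume "is_pole w z0"
      hence inf: "filterlim w at_infinity (at z0)" by (simp add: is_pole_def)
      have Im0: "Im z0 > 0" "\<bar>Re z0 - x\<bar> \<le> M * Im z0" using z0 by (auto simp: stolz_sector_def)
      have "M * Im z0 < (M + 1) * Im z0" using Im0 by (simp add: algebra_simps)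
      hence lt: "\<bar>Re z0 - x\<bar> < (M + 1) * Im z0" using Im0 by linarith
      have "\<forall>\<^sub>F z in at z0. 0 < Im z"
        by (rule order_tendstoD(1)[OF _ Im0(1)]) (auto intro!: tendsto_eq_intros)
      moreover have "((\<lambda>z. (M + 1) * Im z - \<bar>Re z - x\<bar>) \<longlongrightarrow> (M + 1) * Im z0 - \<bar>Re z0 - x\<bar>) (at z0)"
        by (auto intro!: tendsto_eq_intros)
      hence "\<forall>\<^sub>F z in at z0. 0 < (M + 1) * Im z - \<bar>Re z - x\<bar>"
        by (rule order_tendstoD(1)) (use lt in simp)
      moreover have "((\<lambda>z. cmod (z - of_real x)) \<longlongrightarrow> cmod (z0 - of_real x)) (at z0)"
        by (auto intro!: tendsto_eq_intros)
      hence "\<forall>\<^sub>F z in at z0. cmod (z - of_real x) < d"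
        by (rule order_tendstoD(2)) (use z0 in simp)
      ultimately have "\<forall>\<^sub>F z in at z0. cmod (w z) < cmod w0 + 1"
      proof eventually_elim
        case (elim z)
        have "dist (w z) w0 < 1" using elim by (intro d) (auto simp: stolz_sector_def)
        thus ?case using norm_triangle_sub[of "w z" w0] by (simp add: dist_norm)
      qed
      moreover have "\<forall>\<^sub>F z in at z0. cmod w0 + 1 \<le> cmod (w z)"
        using inf[unfolded filterlim_at_infinity[OF order_refl], rule_format, of "cmod w0 + 1"] by (simp add: add_nonneg_pos)
      ultimately have "\<forall>\<^sub>F z in at z0. False" by eventually_elim simp
      thus False by simp
    qed
  qed
  thus ?thesis unfolding eventually_stolz_sector_eq using d(1) by blast
qed

text \<open>The mean value inequality for w - \<gamma> z on the truncated sector, which is convex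
  and on which the derivative of this function is at most \<epsilon> / 2; then the second point
  moves to the vertex, where w tends to w0.\<close>

lemma quotient_limit_if_nt_limit_deriv:
  assumes w: "w nicely_meromorphic_on upper_half_plane" and lim: "nt_limit w x (Value w0)"
    and der: "nt_limit (deriv w) x (Value \<gamma>)"
  shows "nt_limit (\<lambda>z. (w z - w0) / (z - of_real x)) x (Value \<gamma>)"
  unfolding nt_limit_Value
proof safe
  fix M :: real assume M: "M > 0"
  show "((\<lambda>z. (w z - w0) / (z - of_real x)) \<longlongrightarrow> \<gamma>) (at (complex_of_real x) within stolz_sector x M)"
  proof (rule tendstoI)
    fix \<epsilon> :: real assume \<epsilon>: "\<epsilon> > 0"
    have "\<forall>\<^sub>F z in at (complex_of_real x) within stolz_sector x M. w analytic_on {z} \<and> dist (deriv w z) \<gamma> < \<epsilon> / 2"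
      using nt_limit_imp_eventually_analytic[OF w lim M]
        der[unfolded nt_limit_Value tendsto_iff, rule_format, OF M, of "\<epsilon> / 2"] \<epsilon>
      by (intro eventually_conj) auto
    then obtain d where d: "d > 0" "\<And>z. z \<in> stolz_sector x M \<Longrightarrow> cmod (z - of_real x) < d \<Longrightarrow>
        w analytic_on {z} \<and> dist (deriv w z) \<gamma> < \<epsilon> / 2"
      unfolding eventually_stolz_sector_eq by blast
    define S where "S = stolz_sector x M \<inter> ball (complex_of_real x) d"
    have conv: "convex S" unfolding S_def by (intro convex_Int convex_stolz_sector convex_ball)
    define g where "g z = w z - \<gamma> * z" for z
    have gS: "cmod (g z - g z') \<le> \<epsilon> / 2 * cmod (z - z')" if "z \<in> S" "z' \<in> S" for z z'
    proof (rule field_differentiable_bound[OF conv _ _ that])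
      fix \<xi> assume "\<xi> \<in> S"
      hence *: "w analytic_on {\<xi>}" "dist (deriv w \<xi>) \<gamma> < \<epsilon> / 2" using d(2)[of \<xi>] by (auto simp: S_def dist_norm norm_minus_commute)
      have "(w has_field_derivative deriv w \<xi>) (at \<xi>)" using *(1) by (rule analytic_derivI)
      hence "(g has_field_derivative deriv w \<xi> - \<gamma>) (at \<xi>)" unfolding g_def by (auto intro!: derivative_eq_intros)
      thus "(g has_field_derivative deriv w \<xi> - \<gamma>) (at \<xi> within S)" by (rule has_field_derivative_at_within)
      show "cmod (deriv w \<xi> - \<gamma>) \<le> \<epsilon> / 2" using * by (simp add: dist_norm)
    qed
    have "dist ((w z - w0) / (z - of_real x)) \<gamma> < \<epsilon>" if z: "z \<in> stolz_sector x M" "cmod (z - of_real x) < d" for z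
    proof -
      have zS: "z \<in> S" using z by (simp add: S_def dist_norm norm_minus_commute)
      let ?F = "at (complex_of_real x) within stolz_sector x M"
      have ev: "\<forall>\<^sub>F z' in ?F. cmod (g z - g z') \<le> \<epsilon> / 2 * cmod (z - z')"
        unfolding eventually_stolz_sector_eq using d(1) gS[OF zS]
        by (intro exI[of _ d]) (auto simp: S_def dist_norm norm_minus_commute)
      have wl: "(w \<longlongrightarrow> w0) ?F" using lim M by (simp add: nt_limit_Value)
      have l1: "((\<lambda>z'. cmod (g z - g z')) \<longlongrightarrow> cmod (g z - (w0 - \<gamma> * of_real x))) ?F"
        unfolding g_def by (intro tendsto_intros wl)
      have l2: "((\<lambda>z'. \<epsilon> / 2 * cmod (z - z')) \<longlongrightarrow> \<epsilon> / 2 * cmod (z - of_real x)) ?F" by (intro tendsto_intros)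
      have "cmod (g z - (w0 - \<gamma> * of_real x)) \<le> \<epsilon> / 2 * cmod (z - of_real x)"
        by (rule tendsto_le[OF stolz_sector_filter_nontrivial[OF M] l2 l1 ev])
      moreover have ne: "z \<noteq> of_real x" using stolz_sectorD(2)[OF z(1)] .
      moreover have "g z - (w0 - \<gamma> * of_real x) = ((w z - w0) / (z - of_real x) - \<gamma>) * (z - of_real x)"
        using ne by (simp add: g_def field_simps)
      ultimately have "cmod ((w z - w0) / (z - of_real x) - \<gamma>) \<le> \<epsilon> / 2" by (simp add: norm_mult)
      thus ?thesis using \<epsilon> by (simp add: dist_norm)
    qed
    thus "\<forall>\<^sub>F z in at (complex_of_real x) within stolz_sector x M. dist ((w z - w0) / (z - of_real x)) \<gamma> < \<epsilon>"
      unfolding eventually_stolz_sector_eq using d(1) by blast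
  qed
qed

section \<open>The kernel identity\<close>

text \<open>\<open>Q\<close> is the inverse of \<open>P\<close>, and \<open>P_c\<close>,
  \<open>P_e\<close> express c = C P^{-1} and e = E P^{-1} through the symmetry of P. The Lyapunov
  identity says nothing about the diagonal of P, which is why \<open>node_type\<close> records the
  diagonal entry at a singular node.\<close>

locale pick_data =
  fixes n :: nat and x :: "nat \<Rightarrow> real" and P Q :: "nat \<Rightarrow> nat \<Rightarrow> complex" and C E c e :: "nat \<Rightarrow> complex"
  assumes nodes: "inj_on x {..<n}"
    and P_real: "\<And>i j. cnj (P i j) = P i j" and P_sym: "\<And>i j. P i j = P j i"
    and C_real: "\<And>i. cnj (C i) = C i" and E_real: "\<And>i. cnj (E i) = E i"
    and c_real: "\<And>i. i < n \<Longrightarrow> cnj (c i) = c i" and e_real: "\<And>i. i < n \<Longrightarrow> cnj (e i) = e i"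
    and lyapunov: "\<And>i j. i < n \<Longrightarrow> j < n \<Longrightarrow> P i j * (x j - x i) = E i * C j - C i * E j"
    and P_c: "\<And>i. i < n \<Longrightarrow> (\<Sum>j<n. P i j * c j) = C i"
    and P_e: "\<And>i. i < n \<Longrightarrow> (\<Sum>j<n. P i j * e j) = E i"
    and P_inverse: "\<And>i k. i < n \<Longrightarrow> k < n \<Longrightarrow> (\<Sum>j<n. P i j * Q j k) = (if i = k then 1 else 0)"
    and node_type: "\<And>i. i < n \<Longrightarrow> E i = 1 \<or> E i = 0 \<and> C i \<noteq> 0 \<and> P i i = - C i"
begin

definition H :: "complex \<Rightarrow> complex \<Rightarrow> complex \<Rightarrow> nat \<Rightarrow> complex" where
  "H p q z j = (e j * p - c j * q) / (z - x j)"

definition N :: "complex \<Rightarrow> complex \<Rightarrow> complex \<Rightarrow> complex" where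
  "N p q z = p + (\<Sum>j<n. C j * H p q z j)"

definition D :: "complex \<Rightarrow> complex \<Rightarrow> complex \<Rightarrow> complex" where
  "D p q z = q + (\<Sum>j<n. E j * H p q z j)"

lemma H_mult: "z \<noteq> of_real (x j) \<Longrightarrow> (z - of_real (x j)) * H p q z j = e j * p - c j * q"
  by (simp add: H_def)

text \<open>\<open>Q\<close> is given as a right inverse; by symmetry of P its transpose is a left
  inverse.\<close>

lemma P_injective:
  assumes "\<And>i. i < n \<Longrightarrow> (\<Sum>j<n. P i j * v j) = 0" "k < n"
  shows "v k = 0"
proof -
  have "v k = (\<Sum>i<n. (if i = k then 1 else 0) * v i)"
    using assms(2) by (simp add: if_distrib[of "\<lambda>t. t * _"] cong: if_cong)
  also have "\<dots> = (\<Sum>i<n. \<Sum>j<n. P i j * Q j k * v i)"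
    using P_inverse assms(2) by (intro sum.cong refl) (simp add: sum_distrib_right[symmetric])
  also have "\<dots> = (\<Sum>j<n. Q j k * (\<Sum>i<n. P j i * v i))"
    by (subst sum.swap) (simp add: sum_distrib_left P_sym mult_ac)
  finally show ?thesis using assms(1) by simp
qed

text \<open>If e_i = c_i = 0, the i-th column u of P^{-1} is annihilated by C and E, and the
  Lyapunov identity yields P (X - x_i) u = 0. Hence u is supported at i, and C u = E u = 0 gives C_i
  = E_i = 0, which is impossible for a node of either type.\<close>

lemma node_coefficients_nonzero:
  assumes i: "i < n"
  shows "e i \<noteq> 0 \<or> c i \<noteq> 0"
proof (rule ccontr)
  assume 0: "\<not> ?thesis"
  define u where "u j = Q j i" for j
  have Pu: "(\<Sum>j<n. P k j * u j) = (if k = i then 1 else 0)" if "k < n" for k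
    using P_inverse[OF that i] by (simp add: u_def)
  have dual: "(\<Sum>j<n. R j * u j) = r i"
    if R: "\<And>j. j < n \<Longrightarrow> (\<Sum>k<n. P j k * r k) = R j" for R r
  proof -
    have "(\<Sum>j<n. R j * u j) = (\<Sum>j<n. \<Sum>k<n. P j k * r k * u j)"
      by (intro sum.cong refl) (simp add: R[symmetric] sum_distrib_right)
    also have "\<dots> = (\<Sum>k<n. r k * (\<Sum>j<n. P k j * u j))"
      by (subst sum.swap) (simp add: sum_distrib_left P_sym mult_ac)
    also have "\<dots> = (\<Sum>k<n. if k = i then r k else 0)" by (intro sum.cong refl) (simp add: Pu)
    finally show ?thesis using i by simp
  qed
  have Cu: "(\<Sum>j<n. C j * u j) = 0" using dual[of c C, OF P_c] 0 by simp
  have Eu: "(\<Sum>j<n. E j * u j) = 0" using dual[of e E, OF P_e] 0 by simp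
  have "(\<Sum>j<n. P k j * ((x j - x i) * u j)) = 0" if k: "k < n" for k
  proof -
    have "(\<Sum>j<n. P k j * ((x j - x i) * u j)) = (\<Sum>j<n. P k j * (x j - x k) * u j + (x k - x i) * (P k j * u j))"
      by (intro sum.cong refl) (simp add: algebra_simps)
    also have "\<dots> = (\<Sum>j<n. (E k * C j - C k * E j) * u j) + (x k - x i) * (\<Sum>j<n. P k j * u j)"
      using lyapunov[OF k] by (simp add: sum.distrib sum_distrib_left)
    also have "(\<Sum>j<n. (E k * C j - C k * E j) * u j) = E k * (\<Sum>j<n. C j * u j) - C k * (\<Sum>j<n. E j * u j)"
      by (simp add: sum_distrib_left sum_subtractf algebra_simps)
    finally show ?thesis using Pu[OF k] Cu Eu by auto
  qed
  from P_injective[OF this] have "(x k - x i) * u k = 0" if "k < n" for k using that by simp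
  hence u0: "u k = 0" if "k < n" "k \<noteq> i" for k
    using that i nodes by (force simp: inj_on_def)
  have sum_u: "(\<Sum>j<n. R j * u j) = R i * u i" for R
  proof -
    have "(\<Sum>j<n. R j * u j) = (\<Sum>j<n. if j = i then R i * u i else 0)" by (intro sum.cong refl) (use u0 in auto)
    thus ?thesis using i by simp
  qed
  have "u i \<noteq> 0" using Pu[OF i] unfolding sum_u by auto
  with Cu Eu have "C i = 0" "E i = 0" unfolding sum_u by auto
  with node_type[OF i] show False by auto
qed

text \<open>The Lyapunov identity moves the factor across P: z - x_i becomes z - x_j, which cancels
  the denominator of \<open>H\<close>, at the cost of a rank two term that reassembles into
  \<open>N\<close> and \<open>D\<close>.\<close>

lemma P_H:
  fixes z :: complex
  assumes z: "\<And>j. j < n \<Longrightarrow> z \<noteq> of_real (x j)" and i: "i < n"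
  shows "(z - x i) * (\<Sum>j<n. P i j * H p q z j) = E i * N p q z - C i * D p q z"
proof -
  have "(z - x i) * (\<Sum>j<n. P i j * H p q z j) =
        (\<Sum>j<n. P i j * ((z - x j) * H p q z j) + P i j * (x j - x i) * H p q z j)"
    unfolding sum_distrib_left by (intro sum.cong refl) (simp add: algebra_simps)
  also have "\<dots> = (\<Sum>j<n. P i j * (e j * p - c j * q) + (E i * C j - C i * E j) * H p q z j)"
    using z lyapunov[OF i] by (intro sum.cong refl) (simp add: H_def)
  also have "\<dots> = p * (\<Sum>j<n. P i j * e j) - q * (\<Sum>j<n. P i j * c j)
      + (E i * (\<Sum>j<n. C j * H p q z j) - C i * (\<Sum>j<n. E j * H p q z j))"
    by (simp add: sum.distrib sum_subtractf sum_distrib_left algebra_simps)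
  finally show ?thesis using P_c[OF i] P_e[OF i] by (simp add: N_def D_def algebra_simps)
qed

text \<open>In the i-th summand z - cnj z' is split as (z - x_i) - (cnj z' - x_i). The first part is
  row i of \<open>P_H\<close>; the second cancels the denominator of the conjugated
  \<open>H\<close>, and P e = E, P c = C evaluate what remains.\<close>

lemma kernel_identity:
  fixes z z' :: complex
  assumes z: "\<And>j. j < n \<Longrightarrow> z \<noteq> of_real (x j)" and z': "\<And>j. j < n \<Longrightarrow> z' \<noteq> of_real (x j)"
  shows "(z - cnj z') * (\<Sum>i<n. \<Sum>j<n. cnj (H p' q' z' i) * P i j * H p q z j) =
    N p q z * cnj (D p' q' z') - cnj (N p' q' z') * D p q z - (p * cnj q' - cnj p' * q)"
proof -
  let ?S = "\<lambda>i. \<Sum>j<n. P i j * H p q z j"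
  have "(z - cnj z') * (\<Sum>i<n. \<Sum>j<n. cnj (H p' q' z' i) * P i j * H p q z j)
     = (\<Sum>i<n. cnj (H p' q' z' i) * ((z - x i) * ?S i) - cnj ((z' - x i) * H p' q' z' i) * ?S i)"
    unfolding sum_distrib_left by (intro sum.cong refl) (simp add: sum_distrib_left sum_subtractf[symmetric] algebra_simps)
  also have "\<dots> = (\<Sum>i<n. cnj (H p' q' z' i) * (E i * N p q z - C i * D p q z) - (e i * cnj p' - c i * cnj q') * ?S i)"
  proof (intro sum.cong refl)
    fix i assume i: "i \<in> {..<n}"
    have "(z' - x i) * H p' q' z' i = e i * p' - c i * q'" using z' i by (intro H_mult) simp
    hence "cnj ((z' - x i) * H p' q' z' i) = cnj (e i * p' - c i * q')" by (rule arg_cong)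
    also have "\<dots> = e i * cnj p' - c i * cnj q'" using i by (simp add: e_real c_real)
    finally have "cnj ((z' - x i) * H p' q' z' i) = e i * cnj p' - c i * cnj q'" .
    with i show "cnj (H p' q' z' i) * ((z - x i) * ?S i) - cnj ((z' - x i) * H p' q' z' i) * ?S i =
        cnj (H p' q' z' i) * (E i * N p q z - C i * D p q z) - (e i * cnj p' - c i * cnj q') * ?S i"
      using P_H[OF z] by simp
  qed
  also have "\<dots> = N p q z * cnj (\<Sum>i<n. E i * H p' q' z' i) - D p q z * cnj (\<Sum>i<n. C i * H p' q' z' i)
      - (cnj p' * (\<Sum>i<n. e i * ?S i) - cnj q' * (\<Sum>i<n. c i * ?S i))"
    by (simp add: sum_subtractf sum_distrib_left E_real C_real algebra_simps)
  also have "(\<Sum>i<n. e i * ?S i) = (\<Sum>j<n. E j * H p q z j)"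
  proof -
    have "(\<Sum>i<n. e i * ?S i) = (\<Sum>j<n. (\<Sum>i<n. P j i * e i) * H p q z j)"
      unfolding sum_distrib_left sum_distrib_right by (subst sum.swap) (simp add: P_sym mult_ac)
    thus ?thesis using P_e by simp
  qed
  also have "(\<Sum>i<n. c i * ?S i) = (\<Sum>j<n. C j * H p q z j)"
  proof -
    have "(\<Sum>i<n. c i * ?S i) = (\<Sum>j<n. (\<Sum>i<n. P j i * c i) * H p q z j)"
      unfolding sum_distrib_left sum_distrib_right by (subst sum.swap) (simp add: P_sym mult_ac)
    thus ?thesis using P_c by simp
  qed
  finally show ?thesis by (simp add: N_def D_def algebra_simps)
qed

text \<open>Invertibility of Theta(z) in disguise: if N = D = 0, then P h = 0, so h = 0, and N and D
  reduce to p and q.\<close>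

lemma N_D_not_both_zero:
  fixes z :: complex
  assumes z: "\<And>j. j < n \<Longrightarrow> z \<noteq> of_real (x j)" and pq: "p \<noteq> 0 \<or> q \<noteq> 0"
  shows "N p q z \<noteq> 0 \<or> D p q z \<noteq> 0"
proof (rule ccontr)
  assume 0: "\<not> ?thesis"
  have "(\<Sum>j<n. P i j * H p q z j) = 0" if "i < n" for i
    using P_H[OF z that, of p q] 0 z[OF that] by simp
  hence "H p q z k = 0" if "k < n" for k using that by (rule P_injective)
  hence "N p q z = p" "D p q z = q" by (simp_all add: N_def D_def)
  with 0 pq show False by simp
qed

end

locale pick_lft = pick_data +
  fixes \<phi> :: "(complex \<Rightarrow> complex) with_infty" and w :: "complex \<Rightarrow> complex"
  assumes param: "\<phi> \<in> extended_nevanlinna"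
    and mero: "w nicely_meromorphic_on upper_half_plane"
    and lft: "\<forall>\<^sub>\<approx>z\<in>upper_half_plane. D (hom_num \<phi> z) (hom_den \<phi>) z \<noteq> 0 \<and>
                 w z = N (hom_num \<phi> z) (hom_den \<phi>) z / D (hom_num \<phi> z) (hom_den \<phi>) z"
begin

abbreviation p :: "complex \<Rightarrow> complex" where "p \<equiv> hom_num \<phi>"
abbreviation q :: complex where "q \<equiv> hom_den \<phi>"
abbreviation h :: "nat \<Rightarrow> complex \<Rightarrow> complex" where "h j z \<equiv> H (p z) q z j"
abbreviation numer :: "complex \<Rightarrow> complex" where "numer z \<equiv> N (p z) q z"
abbreviation den :: "complex \<Rightarrow> complex" where "den z \<equiv> D (p z) q z"

section \<open>Poles and values of the transform\<close>

lemma off_nodes: "z \<in> upper_half_plane \<Longrightarrow> z \<noteq> of_real (x j)"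
  by (auto simp: upper_half_plane_def)

lemma hom_nonzero: "p z \<noteq> 0 \<or> q \<noteq> 0"
  by (cases \<phi>) auto

lemma p_analytic: "p analytic_on upper_half_plane"
proof (cases \<phi>)
  case (Value f)
  hence "f \<in> nevanlinna 0" using param by (auto simp: extended_nevanlinna_def)
  thus ?thesis using nevanlinna_0_analytic Value by (simp add: hom_num_def[abs_def])
qed (simp add: hom_num_def[abs_def])

lemma num_den_analytic:
  assumes "z \<in> upper_half_plane"
  shows "numer analytic_on {z}" "den analytic_on {z}"
proof -
  have "p analytic_on {z}" using p_analytic assms analytic_on_analytic_at by blast
  thus "numer analytic_on {z}" "den analytic_on {z}"
    unfolding N_def D_def H_def using off_nodes[OF assms] by (auto intro!: analytic_intros)
qed

lemma num_den_not_both_zero: "z \<in> upper_half_plane \<Longrightarrow> numer z \<noteq> 0 \<or> den z \<noteq> 0"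
  using N_D_not_both_zero off_nodes hom_nonzero by blast

lemma tendsto_analytic_at: "f analytic_on {z} \<Longrightarrow> (f \<longlongrightarrow> f z) (at z)"
  using analytic_at_imp_isCont isContD by blast

text \<open>The quotient is known to equal w only off a sparse set, which may contain z. Its limit
  at z shows that w has no pole there, and a nicely meromorphic function without a pole takes its
  limit as value.\<close>

lemma w_eq:
  assumes z: "z \<in> upper_half_plane" and den: "den z \<noteq> 0"
  shows "w analytic_on {z}" "w z = numer z / den z"
proof -
  have "((\<lambda>z. numer z / den z) \<longlongrightarrow> numer z / den z) (at z)"
    using tendsto_analytic_at[OF num_den_analytic(1)[OF z]] tendsto_analytic_at[OF num_den_analytic(2)[OF z]] den
    by (intro tendsto_divide)
  moreover have "\<forall>\<^sub>F z in at z. numer z / den z = w z"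
    using eventually_cosparse_imp_eventually_at[OF lft z, of UNIV] by (auto elim!: eventually_mono)
  ultimately have lim: "(w \<longlongrightarrow> numer z / den z) (at z)" by (rule Lim_transform_eventually)
  have np: "\<not> is_pole w z"
    using not_tendsto_and_filterlim_at_infinity[OF _ lim] by (auto simp: is_pole_def)
  thus "w analytic_on {z}" using nicely_meromorphic_on_imp_analytic_at[OF mero z] by blast
  hence "(w \<longlongrightarrow> w z) (at z)" by (rule tendsto_analytic_at)
  from tendsto_unique[OF _ this lim] show "w z = numer z / den z" by simp
qed

lemma den_nonzero_if_analytic:
  assumes z: "z \<in> upper_half_plane" and an: "w analytic_on {z}"
  shows "den z \<noteq> 0"
proof
  assume den: "den z = 0"
  have "((\<lambda>z. w z * den z) \<longlongrightarrow> w z * den z) (at z)"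
    using tendsto_analytic_at[OF an] tendsto_analytic_at[OF num_den_analytic(2)[OF z]] by (rule tendsto_mult)
  moreover have "\<forall>\<^sub>F z in at z. w z * den z = numer z"
    using eventually_cosparse_imp_eventually_at[OF lft z, of UNIV] by (auto elim!: eventually_mono)
  ultimately have "(numer \<longlongrightarrow> w z * den z) (at z)" by (rule Lim_transform_eventually)
  from tendsto_unique[OF _ this tendsto_analytic_at[OF num_den_analytic(1)[OF z]]] den
  have "numer z = 0" by simp
  with num_den_not_both_zero[OF z] den show False by simp
qed

text \<open>A zero of \<open>den\<close> is a pole of w, where the representation prescribes the
  dummy value 0. Conversely a nonzero value of w certifies that \<open>den\<close> does not vanish,
  which is how this is used at singular nodes.\<close>

lemma w_zero_if_den_zero:
  assumes z: "z \<in> upper_half_plane" and "den z = 0"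
  shows "w z = 0"
proof -
  have "is_pole w z" using nicely_meromorphic_on_imp_analytic_at[OF mero z] den_nonzero_if_analytic[OF z] assms(2) by blast
  hence "\<not> (w \<longlongrightarrow> w z) (at z)"
    using not_tendsto_and_filterlim_at_infinity[of "at z" w "w z"] by (auto simp: is_pole_def)
  thus ?thesis using mero z by (auto simp: nicely_meromorphic_on_def)
qed

lemma w_domain: "analyticity_domain w = {z \<in> upper_half_plane. den z \<noteq> 0}"
  using w_eq(1) den_nonzero_if_analytic by (auto simp: analyticity_domain_def)

text \<open>The Pick kernel of the parameter in homogeneous coordinates; it vanishes for the
  infinite parameter.\<close>

definition param_kernel :: "complex \<Rightarrow> complex \<Rightarrow> complex" where
  "param_kernel z z' = (p z * cnj q - cnj (p z') * q) / (z - cnj z')"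

lemma param_kernel_Value: "\<phi> = Value f \<Longrightarrow> param_kernel = pick_kernel f"
  unfolding param_kernel_def pick_kernel_def fun_eq_iff by simp

lemma param_kernel_Infty: "\<phi> = Infty \<Longrightarrow> param_kernel z z' = 0"
  unfolding param_kernel_def by simp

lemma param_kernel_nonneg:
  assumes "set zs \<subseteq> upper_half_plane"
  shows "0 \<le> Re (qform (length zs) (\<lambda>i j. param_kernel (zs ! j) (zs ! i)) d)"
proof (cases \<phi>)
  case (Value f)
  hence "f \<in> nevanlinna 0" using param by (auto simp: extended_nevanlinna_def)
  thus ?thesis using nevanlinna_0_qform_nonneg[of f zs d] nevanlinna_0_domain assms param_kernel_Value[OF Value] by simp
next
  case Infty
  show ?thesis unfolding qform_def by (simp only: param_kernel_Infty[OF Infty]) simp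
qed

lemma w_kernel:
  assumes z: "z \<in> analyticity_domain w" and z': "z' \<in> analyticity_domain w"
  shows "pick_kernel w z z' * den z * cnj (den z') =
    (\<Sum>i<n. \<Sum>j<n. cnj (h i z') * P i j * h j z) + param_kernel z z'"
proof -
  have H: "z \<in> upper_half_plane" "z' \<in> upper_half_plane" and d: "den z \<noteq> 0" "den z' \<noteq> 0"
    using z z' unfolding w_domain by auto
  have ne: "z - cnj z' \<noteq> 0" using H by (auto simp: upper_half_plane_def complex_eq_iff)
  have "(z - cnj z') * (pick_kernel w z z' * den z * cnj (den z')) = numer z * cnj (den z') - cnj (numer z') * den z"
    unfolding pick_kernel_def w_eq(2)[OF H(1) d(1)] w_eq(2)[OF H(2) d(2)] using ne d by (simp add: field_simps)
  also have "\<dots> = (z - cnj z') * ((\<Sum>i<n. \<Sum>j<n. cnj (h i z') * P i j * h j z) + param_kernel z z')"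
    using kernel_identity[of z z' "p z'" q "p z" q] off_nodes H ne
    by (simp add: distrib_left param_kernel_def)
  finally show ?thesis using ne by simp
qed

text \<open>With d = a / den, the form at \<open>a\<close> is the form of P at v = sum_b d_b h(z_b)
  plus the nonnegative form of the parameter kernel at d. The linear conditions that make P
  nonnegative at v pull back to equally many conditions on \<open>a\<close>.\<close>

lemma sq_neg_kernel_le:
  assumes zs: "set zs \<subseteq> analyticity_domain w"
  shows "sq_neg (kernel_matrix w zs) \<le> sq_neg (Matrix.mat n n (\<lambda>(i, j). P i j))"
proof -
  let ?P = "Matrix.mat n n (\<lambda>(i, j). P i j)"
  have P: "?P \<in> carrier_mat n n" by simp
  have herm: "hermitian ?P" by (rule hermitianI[OF P]) (simp add: P_real P_sym)
  have qP: "qform n (\<lambda>i j. ?P $$ (i, j)) v = qform n P v" for v by (simp add: qform_def)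
  obtain K :: "nat set" and B where K: "finite K" "card K = sq_neg ?P"
    "\<forall>v. (\<forall>k\<in>K. (\<Sum>i<n. B k i * v i) = 0) \<longrightarrow> 0 \<le> Re (qform n (\<lambda>i j. ?P $$ (i, j)) v)"
    by (rule sq_neg_nonneg_subspace[OF P herm])
  let ?m = "length zs"
  have dom: "zs ! b \<in> analyticity_domain w" if "b < ?m" for b using zs that by (auto simp: subset_iff)
  have den: "den (zs ! b) \<noteq> 0" if "b < ?m" for b using dom[OF that] by (simp add: w_domain)
  have "sq_neg (kernel_matrix w zs) \<le> card K"
  proof (rule sq_neg_le[OF kernel_matrix_carrier hermitian_kernel_matrix K(1), of "\<lambda>k b. \<Sum>j<n. B k j * (h j (zs ! b) / den (zs ! b))"])
    fix a :: "nat \<Rightarrow> complex"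
    assume a: "\<forall>k\<in>K. (\<Sum>b<?m. (\<Sum>j<n. B k j * (h j (zs ! b) / den (zs ! b))) * a b) = 0"
    define d where "d b = a b / den (zs ! b)" for b
    define v where "v j = (\<Sum>b<?m. h j (zs ! b) * d b)" for j
    have "(\<Sum>j<n. B k j * v j) = (\<Sum>b<?m. (\<Sum>j<n. B k j * (h j (zs ! b) / den (zs ! b))) * a b)" for k
      unfolding v_def sum_distrib_left sum_distrib_right by (subst sum.swap) (simp add: d_def mult_ac)
    hence pos: "0 \<le> Re (qform n P v)" using a K(3)[rule_format, of v] by (simp add: qP)
    have "qform ?m (\<lambda>i j. kernel_matrix w zs $$ (i, j)) a
      = (\<Sum>b<?m. \<Sum>b'<?m. cnj (d b) * ((\<Sum>i<n. \<Sum>j<n. cnj (h i (zs ! b)) * P i j * h j (zs ! b')) + param_kernel (zs ! b') (zs ! b)) * d b')"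
      unfolding qform_kernel_matrix unfolding qform_def
      by (intro sum.cong refl) (simp add: w_kernel[symmetric] dom den d_def)
    also have "\<dots> = (\<Sum>b<?m. \<Sum>b'<?m. cnj (d b) * (\<Sum>i<n. \<Sum>j<n. cnj (h i (zs ! b)) * P i j * h j (zs ! b')) * d b')
        + qform ?m (\<lambda>i j. param_kernel (zs ! j) (zs ! i)) d"
      unfolding qform_def by (simp add: sum.distrib distrib_left distrib_right)
    also have "(\<Sum>b<?m. \<Sum>b'<?m. cnj (d b) * (\<Sum>i<n. \<Sum>j<n. cnj (h i (zs ! b)) * P i j * h j (zs ! b')) * d b') = qform n P v"
    proof -
      have "(\<Sum>b<?m. \<Sum>b'<?m. cnj (d b) * (\<Sum>i<n. \<Sum>j<n. cnj (h i (zs ! b)) * P i j * h j (zs ! b')) * d b')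
        = (\<Sum>b<?m. \<Sum>b'<?m. \<Sum>i<n. \<Sum>j<n. cnj (h i (zs ! b) * d b) * P i j * (h j (zs ! b') * d b'))"
        by (intro sum.cong refl) (simp add: sum_distrib_left sum_distrib_right mult_ac)
      also have "\<dots> = (\<Sum>b<?m. \<Sum>i<n. \<Sum>b'<?m. \<Sum>j<n. cnj (h i (zs ! b) * d b) * P i j * (h j (zs ! b') * d b'))"
        by (intro sum.cong refl sum.swap)
      also have "\<dots> = (\<Sum>i<n. \<Sum>b<?m. \<Sum>b'<?m. \<Sum>j<n. cnj (h i (zs ! b) * d b) * P i j * (h j (zs ! b') * d b'))"
        by (rule sum.swap)
      also have "\<dots> = (\<Sum>i<n. \<Sum>b<?m. \<Sum>j<n. \<Sum>b'<?m. cnj (h i (zs ! b) * d b) * P i j * (h j (zs ! b') * d b'))"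
        by (intro sum.cong refl sum.swap)
      also have "\<dots> = (\<Sum>i<n. \<Sum>j<n. \<Sum>b<?m. \<Sum>b'<?m. cnj (h i (zs ! b) * d b) * P i j * (h j (zs ! b') * d b'))"
        by (intro sum.cong refl sum.swap)
      also have "\<dots> = qform n P v"
        unfolding qform_def v_def cnj_sum sum_distrib_left sum_distrib_right
        by (rule sum.cong[OF refl], rule sum.cong[OF refl], rule sum.swap)
      finally show ?thesis .
    qed
    moreover have "0 \<le> Re (qform ?m (\<lambda>i j. param_kernel (zs ! j) (zs ! i)) d)"
      using zs by (intro param_kernel_nonneg) (auto simp: analyticity_domain_def)
    ultimately show "0 \<le> Re (qform ?m (\<lambda>i j. kernel_matrix w zs $$ (i, j)) a)" using pos by simp
  qed
  thus ?thesis using K(2) by simp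
qed

end

section \<open>Boundary values at the nodes\<close>

context pick_lft
begin

text \<open>The derivative condition is put as a difference quotient, since that is the expression
  which row i of \<open>P_H\<close> controls.\<close>

definition node_solved :: "nat \<Rightarrow> bool" where
  "node_solved i \<longleftrightarrow>
     (E i = 1 \<longrightarrow> nt_limit w (x i) (Value (C i)) \<and>
        nt_limit (\<lambda>z. (w z - C i) / (z - of_real (x i))) (x i) (Value (P i i))) \<and>
     (E i = 0 \<longrightarrow> nt_limit (\<lambda>z. (z - of_real (x i)) * w z) (x i) (Value (C i)))"

abbreviation at_node :: "real \<Rightarrow> nat \<Rightarrow> complex filter" where
  "at_node M i \<equiv> at (complex_of_real (x i)) within stolz_sector (x i) M"

abbreviation good :: "nat \<Rightarrow> bool" where
  "good i \<equiv> good_node (e i) (c i) \<phi> (x i)"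

lemma node_neq: "i < n \<Longrightarrow> j < n \<Longrightarrow> i \<noteq> j \<Longrightarrow> of_real (x i) - of_real (x j) \<noteq> (0 :: complex)"
  using nodes by (auto simp: inj_on_def)

lemma eventually_at_node_sector: "\<forall>\<^sub>F z in at_node M i. z \<in> stolz_sector (x i) M"
  by (auto simp: eventually_at_filter)

section \<open>Limits at a good node\<close>

lemma good_h_nonzero:
  assumes "good i" "M > 0"
  shows "\<forall>\<^sub>F z in at_node M i. h i z \<noteq> 0"
proof -
  have "\<forall>\<^sub>F z in at_node M i. 1 * cmod (z - of_real (x i)) * (cmod (p z) + cmod q) < cmod (e i * p z - c i * q)"
  proof -
    have "0 < (1 :: real)" by simp
    from assms(1)[unfolded good_node_def, rule_format, OF assms(2) this] show ?thesis .
  qed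
  thus ?thesis using eventually_at_node_sector
  proof eventually_elim
    case (elim z)
    have "0 \<le> 1 * cmod (z - of_real (x i)) * (cmod (p z) + cmod q)" by simp
    with elim(1) have "0 < cmod (e i * p z - c i * q)" by linarith
    thus ?case using stolz_sectorD(2)[OF elim(2)] by (simp add: H_def)
  qed
qed

lemma good_quotient_null:
  assumes i: "good i" "M > 0" and u: "\<And>z. cmod (u z) \<le> cmod (p z) + cmod q"
  shows "((\<lambda>z. u z / h i z) \<longlongrightarrow> 0) (at_node M i)"
proof (rule tendstoI)
  fix \<epsilon> :: real assume \<epsilon>: "\<epsilon> > 0"
  hence pos: "0 < 1 / \<epsilon>" by simp
  have "\<forall>\<^sub>F z in at_node M i. (1 / \<epsilon>) * cmod (z - of_real (x i)) * (cmod (p z) + cmod q) < cmod (e i * p z - c i * q)"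
    by (rule i(1)[unfolded good_node_def, rule_format, OF i(2) pos])
  thus "\<forall>\<^sub>F z in at_node M i. dist (u z / h i z) 0 < \<epsilon>"
    using eventually_at_node_sector good_h_nonzero[OF i]
  proof eventually_elim
    case (elim z)
    have L: "0 < cmod (e i * p z - c i * q)" using elim(3) by (auto simp: H_def)
    have "cmod (z - of_real (x i)) * cmod (u z) \<le> cmod (z - of_real (x i)) * (cmod (p z) + cmod q)"
      by (intro mult_left_mono u) auto
    also have "\<dots> < \<epsilon> * cmod (e i * p z - c i * q)" using elim(1) \<epsilon> by (simp add: field_simps)
    finally have "cmod (z - of_real (x i)) * cmod (u z) / cmod (e i * p z - c i * q) < \<epsilon>"
      using L by (simp add: pos_divide_less_eq)
    thus ?case by (simp add: H_def norm_divide norm_mult mult_ac)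
  qed
qed

lemma good_p_null: "good i \<Longrightarrow> M > 0 \<Longrightarrow> ((\<lambda>z. p z / h i z) \<longlongrightarrow> 0) (at_node M i)"
  and good_q_null: "good i \<Longrightarrow> M > 0 \<Longrightarrow> ((\<lambda>z. q / h i z) \<longlongrightarrow> 0) (at_node M i)"
  by (rule good_quotient_null; simp)+

text \<open>Near x_i the denominator z - x_j of another h_j stays away from 0, so h_j is O(|p| +
  |q|) and thus negligible against h_i.\<close>

lemma good_h_ratio:
  assumes i: "good i" "M > 0" and ij: "i < n" "j < n"
  shows "((\<lambda>z. h j z / h i z) \<longlongrightarrow> (if j = i then 1 else 0)) (at_node M i)"
proof (cases "j = i")
  case True
  have "\<forall>\<^sub>F z in at_node M i. 1 = h j z / h i z"
    using good_h_nonzero[OF i] True by (auto elim!: eventually_mono)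
  from Lim_transform_eventually[OF tendsto_const this] show ?thesis using True by simp
next
  case False
  have ne: "complex_of_real (x i) - of_real (x j) \<noteq> 0" using node_neq ij False by blast
  have "((\<lambda>z. (e j * (p z / h i z) - c j * (q / h i z)) / (z - of_real (x j))) \<longlongrightarrow> (e j * 0 - c j * 0) / (of_real (x i) - of_real (x j))) (at_node M i)"
    using ne by (intro tendsto_intros good_p_null good_q_null i) auto
  moreover have "(e j * (p z / h i z) - c j * (q / h i z)) / (z - of_real (x j)) = h j z / h i z" for z
    by (simp add: H_def[of _ _ _ j] diff_divide_distrib mult.commute)
  ultimately show ?thesis using False by simp
qed

lemma good_sum_ratio:
  assumes i: "good i" "M > 0" "i < n"
  shows "((\<lambda>z. \<Sum>j<n. R j * (h j z / h i z)) \<longlongrightarrow> R i) (at_node M i)"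
proof -
  have "((\<lambda>z. \<Sum>j<n. R j * (h j z / h i z)) \<longlongrightarrow> (\<Sum>j<n. R j * (if j = i then 1 else 0))) (at_node M i)"
    using good_h_ratio[OF i(1,2,3)] by (intro tendsto_sum tendsto_mult tendsto_const) auto
  moreover have "(\<Sum>j<n. R j * (if j = i then 1 else 0)) = R i"
    using i(3) by (simp add: if_distrib[of "\<lambda>t. _ * t"] cong: if_cong)
  ultimately show ?thesis by simp
qed

lemma good_num_ratio:
  assumes i: "good i" "M > 0" "i < n"
  shows "((\<lambda>z. numer z / h i z) \<longlongrightarrow> C i) (at_node M i)"
proof -
  have "numer z / h i z = p z / h i z + (\<Sum>j<n. C j * (h j z / h i z))" for z
    by (simp add: N_def add_divide_distrib sum_divide_distrib)
  moreover have "((\<lambda>z. p z / h i z + (\<Sum>j<n. C j * (h j z / h i z))) \<longlongrightarrow> 0 + C i) (at_node M i)"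
    by (intro tendsto_add good_p_null good_sum_ratio i)
  ultimately show ?thesis by simp
qed

lemma good_den_ratio:
  assumes i: "good i" "M > 0" "i < n"
  shows "((\<lambda>z. den z / h i z) \<longlongrightarrow> E i) (at_node M i)"
proof -
  have "den z / h i z = q / h i z + (\<Sum>j<n. E j * (h j z / h i z))" for z
    by (simp add: D_def add_divide_distrib sum_divide_distrib)
  moreover have "((\<lambda>z. q / h i z + (\<Sum>j<n. E j * (h j z / h i z))) \<longlongrightarrow> 0 + E i) (at_node M i)"
    by (intro tendsto_add good_q_null good_sum_ratio i)
  ultimately show ?thesis by simp
qed

text \<open>Row i of \<open>P_H\<close> divided by h_i. As num / h_i and den / h_i tend to C_i and
  E_i, this combination cancels to leading order, and P_ii appears as the next term.\<close>

lemma good_row_ratio: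
  assumes i: "good i" "M > 0" "i < n"
  shows "((\<lambda>z. (E i * numer z - C i * den z) / ((z - of_real (x i)) * h i z)) \<longlongrightarrow> P i i) (at_node M i)"
proof -
  have "\<forall>\<^sub>F z in at_node M i. (\<Sum>j<n. P i j * (h j z / h i z)) = (E i * numer z - C i * den z) / ((z - of_real (x i)) * h i z)"
    using eventually_at_node_sector
  proof eventually_elim
    case (elim z)
    have "z \<in> upper_half_plane" using elim stolz_sector_subset by blast
    hence "(z - of_real (x i)) * (\<Sum>j<n. P i j * h j z) = E i * numer z - C i * den z"
      by (intro P_H off_nodes i)
    moreover have "z - of_real (x i) \<noteq> 0" using stolz_sectorD(2)[OF elim] by simp
    ultimately show ?case by (simp add: sum_divide_distrib[symmetric] flip: \<open>_ = E i * numer z - C i * den z\<close>)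
  qed
  with good_sum_ratio[OF i, of "\<lambda>j. P i j"] show ?thesis by (rule Lim_transform_eventually)
qed

text \<open>At a singular node den / h_i tends to 0, so the limit of (z - x_i) w depends on the
  rate. With E_i = 0 the row identity is -C_i den = (z - x_i) (P h)_i, and P_ii = -C_i normalizes
  the limit to 1.\<close>

lemma good_singular_den_ratio:
  assumes i: "good i" "M > 0" "i < n" and E: "E i = 0"
  shows "((\<lambda>z. den z / ((z - of_real (x i)) * h i z)) \<longlongrightarrow> 1) (at_node M i)"
proof -
  have nz: "C i \<noteq> 0" "P i i = - C i" using node_type[OF i(3)] E by auto
  have "((\<lambda>z. (- 1 / C i) * ((E i * numer z - C i * den z) / ((z - of_real (x i)) * h i z))) \<longlongrightarrow> (- 1 / C i) * P i i) (at_node M i)"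
    by (intro tendsto_intros good_row_ratio i)
  thus ?thesis using nz E by simp
qed

lemma good_den_nonzero:
  assumes i: "good i" "M > 0" "i < n"
  shows "\<forall>\<^sub>F z in at_node M i. den z \<noteq> 0"
proof (cases "E i = 0")
  case True
  from tendsto_imp_eventually_ne[OF good_singular_den_ratio[OF i True], of 0] show ?thesis
    by (auto elim!: eventually_mono)
next
  case False
  hence "E i \<noteq> 0" by simp
  from tendsto_imp_eventually_ne[OF good_den_ratio[OF i] this] show ?thesis
    by (auto elim!: eventually_mono)
qed

lemma good_imp_eventually_analytic:
  assumes i: "good i" "M > 0" "i < n"
  shows "\<forall>\<^sub>F z in at_node M i. w analytic_on {z}"
  using good_den_nonzero[OF i] eventually_at_node_sector
  by eventually_elim (use w_eq(1) stolz_sector_subset in blast)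

lemma good_imp_solved:
  assumes i: "i < n" and g: "good i"
  shows "node_solved i"
  unfolding node_solved_def nt_limit_Value
proof (intro conjI impI allI)
  fix M :: real assume M: "M > 0" and E: "E i = 1"
  have ev: "\<forall>\<^sub>F z in at_node M i. w z = numer z / den z \<and> den z \<noteq> 0 \<and> h i z \<noteq> 0"
    using good_den_nonzero[OF g M i] good_h_nonzero[OF g M] eventually_at_node_sector
    by eventually_elim (use w_eq(2) stolz_sector_subset in blast)
  have "((\<lambda>z. (numer z / h i z) / (den z / h i z)) \<longlongrightarrow> C i / E i) (at_node M i)"
    using E by (intro tendsto_divide good_num_ratio good_den_ratio g M i) auto
  moreover have "\<forall>\<^sub>F z in at_node M i. (numer z / h i z) / (den z / h i z) = w z"
    using ev by eventually_elim simp
  ultimately show "(w \<longlongrightarrow> C i) (at_node M i)" using E by (auto dest: Lim_transform_eventually)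
  have "((\<lambda>z. ((E i * numer z - C i * den z) / ((z - of_real (x i)) * h i z)) / (den z / h i z)) \<longlongrightarrow> P i i / E i) (at_node M i)"
    using E by (intro tendsto_divide good_row_ratio good_den_ratio g M i) auto
  moreover have "\<forall>\<^sub>F z in at_node M i. ((E i * numer z - C i * den z) / ((z - of_real (x i)) * h i z)) / (den z / h i z)
      = (w z - C i) / (z - of_real (x i))"
  proof -
    have alg: "((a - k * d) / (r * b)) / (d / b) = (a / d - k) / r" if "d \<noteq> 0" "b \<noteq> 0" for a b d k r :: complex
      using that by (cases "r = 0") (simp_all add: field_simps)
    show ?thesis using ev by eventually_elim (elim conjE, simp only: E mult_1 alg not_False_eq_True)
  qed
  ultimately show "((\<lambda>z. (w z - C i) / (z - of_real (x i))) \<longlongrightarrow> P i i) (at_node M i)"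
    using E by (auto dest: Lim_transform_eventually)
next
  fix M :: real assume M: "M > 0" and E: "E i = 0"
  have ev: "\<forall>\<^sub>F z in at_node M i. w z = numer z / den z \<and> den z \<noteq> 0 \<and> h i z \<noteq> 0"
    using good_den_nonzero[OF g M i] good_h_nonzero[OF g M] eventually_at_node_sector
    by eventually_elim (use w_eq(2) stolz_sector_subset in blast)
  have "((\<lambda>z. (numer z / h i z) / (den z / ((z - of_real (x i)) * h i z))) \<longlongrightarrow> C i / 1) (at_node M i)"
    by (intro tendsto_divide good_num_ratio good_singular_den_ratio g M i E) auto
  moreover have "\<forall>\<^sub>F z in at_node M i. (numer z / h i z) / (den z / ((z - of_real (x i)) * h i z)) = (z - of_real (x i)) * w z"
    using ev by eventually_elim simp
  ultimately show "((\<lambda>z. (z - of_real (x i)) * w z) \<longlongrightarrow> C i) (at_node M i)"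
    by (auto dest: Lim_transform_eventually)
qed

text \<open>All rows of \<open>P_H\<close> pass to the limit along the sequence, but row i then only
  reads E_i N0 = C_i D0, because its factor z - x_i vanishes. The value of (P \<alpha>)_i must be
  obtained by dividing by z - x_i beforehand, and this is where the prescribed derivative or residue
  enters.\<close>

lemma bad_imp_not_solved:
  assumes i: "i < n" and bad: "bad_node (e i) (c i) \<phi> (x i)"
  shows "\<not> node_solved i"
proof
  assume sol: "node_solved i"
  obtain M X t p0 q0 a where M: "M > 0" and X: "\<And>m. X m \<in> stolz_sector (x i) M" "X \<longlonglongrightarrow> of_real (x i)"
    and p0: "(\<lambda>m. t m * p (X m)) \<longlonglongrightarrow> p0" and q0: "(\<lambda>m. t m * q) \<longlonglongrightarrow> q0" and pq0: "p0 \<noteq> 0 \<or> q0 \<noteq> 0"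
    and a: "(\<lambda>m. t m * (e i * p (X m) - c i * q) / (X m - of_real (x i))) \<longlonglongrightarrow> a"
    using bad unfolding bad_node_def by blast
  have XH: "X m \<in> upper_half_plane" for m using X(1) stolz_sector_subset by blast
  have Xne: "X m - of_real (x i) \<noteq> 0" for m using stolz_sectorD(2)[OF X(1)[of m]] by simp
  have flt: "filterlim X (at_node M i) sequentially" by (rule filterlim_stolz_sequence[OF X])
  define \<alpha> where "\<alpha> j = (if j = i then a else (e j * p0 - c j * q0) / (of_real (x i) - of_real (x j)))" for j
  have th: "(\<lambda>m. t m * h j (X m)) \<longlonglongrightarrow> \<alpha> j" if j: "j < n" for j
  proof (cases "j = i")
    case True
    thus ?thesis using a by (simp add: \<alpha>_def H_def)
  next
    case False
    have "(\<lambda>m. (e j * (t m * p (X m)) - c j * (t m * q)) / (X m - of_real (x j))) \<longlonglongrightarrow> \<alpha> j"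
      using False node_neq[OF i j] unfolding \<alpha>_def by (auto intro!: tendsto_intros p0 q0 X(2))
    thus ?thesis by (simp add: H_def algebra_simps)
  qed
  define N0 where "N0 = p0 + (\<Sum>j<n. C j * \<alpha> j)"
  define D0 where "D0 = q0 + (\<Sum>j<n. E j * \<alpha> j)"
  have tN: "(\<lambda>m. t m * numer (X m)) \<longlonglongrightarrow> N0"
  proof -
    have "(\<lambda>m. t m * p (X m) + (\<Sum>j<n. C j * (t m * h j (X m)))) \<longlonglongrightarrow> N0"
      unfolding N0_def by (intro tendsto_intros p0 th) auto
    thus ?thesis by (simp add: N_def distrib_left sum_distrib_left mult_ac)
  qed
  have tD: "(\<lambda>m. t m * den (X m)) \<longlonglongrightarrow> D0"
  proof -
    have "(\<lambda>m. t m * q + (\<Sum>j<n. E j * (t m * h j (X m)))) \<longlonglongrightarrow> D0"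
      unfolding D0_def by (intro tendsto_intros q0 th) auto
    thus ?thesis by (simp add: D_def distrib_left sum_distrib_left mult_ac)
  qed
  have tP: "(\<lambda>m. \<Sum>j<n. P k j * (t m * h j (X m))) \<longlonglongrightarrow> (\<Sum>j<n. P k j * \<alpha> j)" for k
    by (intro tendsto_intros th) auto
  have row: "(X m - of_real (x k)) * (\<Sum>j<n. P k j * (t m * h j (X m))) = E k * (t m * numer (X m)) - C k * (t m * den (X m))"
    if k: "k < n" for k m
  proof -
    have "(\<Sum>j<n. P k j * (t m * h j (X m))) = t m * (\<Sum>j<n. P k j * h j (X m))"
      by (simp add: sum_distrib_left mult_ac)
    hence "(X m - of_real (x k)) * (\<Sum>j<n. P k j * (t m * h j (X m))) = t m * ((X m - of_real (x k)) * (\<Sum>j<n. P k j * h j (X m)))"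
      by simp
    also have "\<dots> = t m * (E k * numer (X m) - C k * den (X m))"
      by (subst P_H) (use off_nodes[OF XH] k in auto)
    finally show ?thesis by (simp add: algebra_simps)
  qed
  have row_lim: "(of_real (x i) - of_real (x k)) * (\<Sum>j<n. P k j * \<alpha> j) = E k * N0 - C k * D0" if k: "k < n" for k
  proof (rule LIMSEQ_unique)
    show "(\<lambda>m. (X m - of_real (x k)) * (\<Sum>j<n. P k j * (t m * h j (X m)))) \<longlonglongrightarrow> (of_real (x i) - of_real (x k)) * (\<Sum>j<n. P k j * \<alpha> j)"
      by (intro tendsto_mult tendsto_diff tP X tendsto_const)
    show "(\<lambda>m. (X m - of_real (x k)) * (\<Sum>j<n. P k j * (t m * h j (X m)))) \<longlonglongrightarrow> E k * N0 - C k * D0"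
      unfolding row[OF k] by (intro tendsto_intros tN tD)
  qed
  \<comment> \<open>These relations hold for s times the i-th unit vector in place of \<alpha> if p
    and q contribute nothing; the aim is to show that \<alpha> is this vector.\<close>
  obtain s where s: "N0 = C i * s" "D0 = E i * s" "(\<Sum>j<n. P i j * \<alpha> j) = s * P i i"
  proof (cases "E i = 0")
    case True
    hence Ci: "C i \<noteq> 0" "P i i = - C i" using node_type[OF i] by auto
    have "((\<lambda>z. (z - of_real (x i)) * w z) \<longlongrightarrow> C i) (at_node M i)"
      using sol True M by (auto simp: node_solved_def nt_limit_Value)
    from filterlim_compose[OF this flt] have wl: "(\<lambda>m. (X m - of_real (x i)) * w (X m)) \<longlonglongrightarrow> C i" .
    have "\<forall>\<^sub>F m in sequentially. (X m - of_real (x i)) * w (X m) \<noteq> 0"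
      by (rule tendsto_imp_eventually_ne[OF wl Ci(1)])
    hence ev: "\<forall>\<^sub>F m in sequentially. w (X m) * den (X m) = numer (X m)"
    proof eventually_elim
      case (elim m)
      hence "den (X m) \<noteq> 0" using w_zero_if_den_zero[OF XH] by auto
      thus ?case using w_eq(2)[OF XH] by simp
    qed
    \<comment> \<open>Since (z - x_i) w -> C_i is nonzero, den is smaller than numer by one
      order.\<close>
    have "D0 * C i = 0 * N0"
    proof (rule LIMSEQ_unique)
      show "(\<lambda>m. (t m * den (X m)) * ((X m - of_real (x i)) * w (X m))) \<longlonglongrightarrow> D0 * C i"
        by (intro tendsto_mult tD wl)
      have "(\<lambda>m. (X m - of_real (x i)) * (t m * numer (X m))) \<longlonglongrightarrow> (of_real (x i) - of_real (x i)) * N0"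
        by (intro tendsto_intros tN X)
      moreover have "\<forall>\<^sub>F m in sequentially. (X m - of_real (x i)) * (t m * numer (X m)) = (t m * den (X m)) * ((X m - of_real (x i)) * w (X m))"
        using ev
      proof eventually_elim
        case (elim m)
        show ?case unfolding elim[symmetric] by (simp only: mult_ac)
      qed
      ultimately have "(\<lambda>m. (t m * den (X m)) * ((X m - of_real (x i)) * w (X m))) \<longlonglongrightarrow> (of_real (x i) - of_real (x i)) * N0"
        by (rule Lim_transform_eventually)
      thus "(\<lambda>m. (t m * den (X m)) * ((X m - of_real (x i)) * w (X m))) \<longlonglongrightarrow> 0 * N0" by simp
    qed
    hence D0: "D0 = 0" using Ci by simp
    \<comment> \<open>Multiplying row i, (z - x_i) (P h)_i = -C_i den, by w turns den into numer and
      lets (z - x_i) w tend to C_i.\<close>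
    have "C i * (\<Sum>j<n. P i j * \<alpha> j) = - C i * N0"
    proof (rule LIMSEQ_unique)
      show "(\<lambda>m. ((X m - of_real (x i)) * w (X m)) * (\<Sum>j<n. P i j * (t m * h j (X m)))) \<longlonglongrightarrow> C i * (\<Sum>j<n. P i j * \<alpha> j)"
        by (intro tendsto_mult tP wl)
      have "(\<lambda>m. - C i * (t m * numer (X m))) \<longlonglongrightarrow> - C i * N0" by (intro tendsto_intros tN)
      moreover have "\<forall>\<^sub>F m in sequentially. - C i * (t m * numer (X m)) = ((X m - of_real (x i)) * w (X m)) * (\<Sum>j<n. P i j * (t m * h j (X m)))"
        using ev
      proof eventually_elim
        case (elim m)
        have "((X m - of_real (x i)) * w (X m)) * (\<Sum>j<n. P i j * (t m * h j (X m)))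
          = w (X m) * ((X m - of_real (x i)) * (\<Sum>j<n. P i j * (t m * h j (X m))))" by (simp only: mult_ac)
        also have "\<dots> = w (X m) * (- C i * (t m * den (X m)))" unfolding row[OF i] using True by simp
        also have "\<dots> = - C i * (t m * (w (X m) * den (X m)))" by (simp add: mult_ac)
        finally show ?case unfolding elim by simp
      qed
      ultimately show "(\<lambda>m. ((X m - of_real (x i)) * w (X m)) * (\<Sum>j<n. P i j * (t m * h j (X m)))) \<longlonglongrightarrow> - C i * N0"
        by (rule Lim_transform_eventually)
    qed
    hence "C i * (\<Sum>j<n. P i j * \<alpha> j) = C i * (- N0)" by simp
    hence "(\<Sum>j<n. P i j * \<alpha> j) = - N0" using Ci(1) by (simp only: mult_cancel_left) simp
    thus ?thesis using that[of "N0 / C i"] Ci D0 True by simp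
  next
    case False
    hence E: "E i = 1" using node_type[OF i] by auto
    have lim: "nt_limit w (x i) (Value (C i))" using sol E by (simp add: node_solved_def)
    have l1: "(w \<longlongrightarrow> C i) (at_node M i)" and l2: "((\<lambda>z. (w z - C i) / (z - of_real (x i))) \<longlongrightarrow> P i i) (at_node M i)"
      using sol E M by (auto simp: node_solved_def nt_limit_Value)
    note wl = filterlim_compose[OF l1 flt] and ql = filterlim_compose[OF l2 flt]
    have "\<forall>\<^sub>F m in sequentially. w analytic_on {X m}"
      by (rule eventually_compose_filterlim[OF nt_limit_imp_eventually_analytic[OF mero lim M] flt])
    hence ev: "\<forall>\<^sub>F m in sequentially. numer (X m) = w (X m) * den (X m)"
      by eventually_elim (use den_nonzero_if_analytic[OF XH] w_eq(2)[OF XH] in force)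
    have "N0 = C i * D0"
    proof (rule LIMSEQ_unique[OF tN])
      have "(\<lambda>m. w (X m) * (t m * den (X m))) \<longlonglongrightarrow> C i * D0" by (intro tendsto_mult wl tD)
      moreover have "\<forall>\<^sub>F m in sequentially. w (X m) * (t m * den (X m)) = t m * numer (X m)"
        using ev by eventually_elim simp
      ultimately show "(\<lambda>m. t m * numer (X m)) \<longlonglongrightarrow> C i * D0" by (rule Lim_transform_eventually)
    qed
    moreover have "(\<Sum>j<n. P i j * \<alpha> j) = D0 * P i i"
    proof (rule LIMSEQ_unique[OF tP])
      have "(\<lambda>m. (t m * den (X m)) * ((w (X m) - C i) / (X m - of_real (x i)))) \<longlonglongrightarrow> D0 * P i i"
        by (intro tendsto_mult ql tD)
      moreover have "\<forall>\<^sub>F m in sequentially. (t m * den (X m)) * ((w (X m) - C i) / (X m - of_real (x i))) = (\<Sum>j<n. P i j * (t m * h j (X m)))"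
        using ev
      proof eventually_elim
        case (elim m)
        have "(X m - of_real (x i)) * (\<Sum>j<n. P i j * (t m * h j (X m))) = (t m * den (X m)) * (w (X m) - C i)"
          unfolding row[OF i] elim E by (simp add: algebra_simps)
        thus ?case using Xne[of m] by (simp add: nonzero_eq_divide_eq mult_ac flip: times_divide_eq_right) (simp add: field_simps)
      qed
      ultimately show "(\<lambda>m. \<Sum>j<n. P i j * (t m * h j (X m))) \<longlonglongrightarrow> D0 * P i i" by (rule Lim_transform_eventually)
    qed
    ultimately show ?thesis using that[of D0] E by simp
  qed
  have sum_delta: "(\<Sum>j<n. R j * (if j = i then s else 0)) = R i * s" for R
    using i by (simp add: if_distrib[of "\<lambda>t. _ * t"] cong: if_cong)
  \<comment> \<open>Row i vanishes by the choice of s. In row k the limit identity leaves s (E_k C_i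
    - C_k E_i), which the Lyapunov identity rewrites as (x_i - x_k) P_ki s.\<close>
  have "(\<Sum>j<n. P k j * (\<alpha> j - (if j = i then s else 0))) = 0" if k: "k < n" for k
  proof -
    have eq: "(\<Sum>j<n. P k j * (\<alpha> j - (if j = i then s else 0))) = (\<Sum>j<n. P k j * \<alpha> j) - P k i * s"
      unfolding right_diff_distrib sum_subtractf sum_delta ..
    show ?thesis
    proof (cases "k = i")
      case True
      thus ?thesis unfolding eq using s(3) by (simp add: mult.commute)
    next
      case False
      have "(of_real (x i) - of_real (x k)) * (\<Sum>j<n. P k j * \<alpha> j) = s * (E k * C i - C k * E i)"
        unfolding row_lim[OF k] s(1,2) by (simp add: algebra_simps)
      also have "\<dots> = (of_real (x i) - of_real (x k)) * (P k i * s)"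
        unfolding lyapunov[OF k i, symmetric] by (simp add: algebra_simps)
      finally show ?thesis unfolding eq using node_neq[OF i k] False by simp
    qed
  qed
  from P_injective[OF this] have "\<alpha> j = (if j = i then s else 0)" if "j < n" for j using that by force
  hence "(\<Sum>j<n. R j * \<alpha> j) = R i * s" for R
    by (subst sum_delta[symmetric]) (intro sum.cong refl, simp)
  \<comment> \<open>Compared with N0 = C_i s and D0 = E_i s, this leaves p0 = q0 = 0.\<close>
  hence "N0 = p0 + C i * s" "D0 = q0 + E i * s" by (simp_all add: N0_def D0_def)
  with s(1,2) pq0 show False by simp
qed

section \<open>Decay of the parameter kernel at a good node\<close>

lemma param_kernel_cauchy_schwarz:
  assumes z: "z \<in> upper_half_plane" "z' \<in> upper_half_plane"
  shows "(cmod (param_kernel z z'))\<^sup>2 \<le> cmod (param_kernel z z) * cmod (param_kernel z' z')"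
proof (cases \<phi>)
  case (Value f)
  hence f: "pick_ineq f upper_half_plane" using param nevanlinna_0_pick_ineq by (auto simp: extended_nevanlinna_def)
  have Im: "0 < Im z" "0 < Im z'" using z by (auto simp: upper_half_plane_def)
  have Imf: "0 \<le> Im (f z)" "0 \<le> Im (f z')" using f z by (auto simp: pick_ineq_def)
  have ne: "cmod (z - cnj z') > 0" using Im by (auto simp: complex_eq_iff)
  have "(cmod (f z - cnj (f z')))\<^sup>2 * (Im z * Im z') \<le> (cmod (z - cnj z'))\<^sup>2 * (Im (f z) * Im (f z'))"
    using f z unfolding pick_ineq_def by blast
  hence "(cmod (f z - cnj (f z')))\<^sup>2 / (cmod (z - cnj z'))\<^sup>2 \<le> (Im (f z) / Im z) * (Im (f z') / Im z')"
    using ne Im by (simp add: field_simps)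
  thus ?thesis unfolding param_kernel_Value[OF Value] pick_kernel_diagonal
    using Im Imf by (simp add: pick_kernel_def norm_divide power_divide)
next
  case Infty
  show ?thesis unfolding param_kernel_Infty[OF Infty] by simp
qed

lemma cmod_param_kernel_diagonal:
  assumes "z \<in> upper_half_plane"
  shows "cmod (param_kernel z z) = \<bar>Im (p z * cnj q)\<bar> / Im z"
proof -
  have Im: "0 < Im z" using assms by (simp add: upper_half_plane_def)
  define a where "a = Im (p z * cnj q)"
  have "p z * cnj q - cnj (p z) * q = 2 * \<i> * of_real a" by (simp add: complex_eq_iff a_def)
  moreover have "z - cnj z = 2 * \<i> * of_real (Im z)" by (simp add: complex_eq_iff)
  ultimately show ?thesis unfolding param_kernel_def a_def[symmetric] using Im by (simp add: norm_divide norm_mult)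
qed

text \<open>For real e_i and c_i and L = e_i p - c_i q, e_i Im (p cnj q) = Im (L cnj q) and c_i Im
  (p cnj q) = Im (L cnj p). So the kernel is O(|L| |u| / Im z) with u = q or u = p. Here |L| = |z -
  x_i| |h_i|, the sector bounds |z - x_i| / Im z, and u / h_i -> 0.\<close>

lemma good_param_kernel_null:
  assumes i: "i < n" "good i" and M: "M > 0"
  shows "((\<lambda>z. cmod (param_kernel z z) / (cmod (h i z))\<^sup>2) \<longlongrightarrow> 0) (at_node M i)"
proof -
  define L where "L z = e i * p z - c i * q" for z
  have r: "Im (e i) = 0" "Im (c i) = 0" using e_real[OF i(1)] c_real[OF i(1)] by (auto simp: complex_eq_iff)
  obtain u \<beta> where u: "\<And>z. cmod (u z) \<le> cmod (p z) + cmod q" and \<beta>: "\<beta> > (0::real)"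
    and bound: "\<And>z. \<bar>Im (p z * cnj q)\<bar> \<le> \<beta> * (cmod (L z) * cmod (u z))"
  proof (cases "e i = 0")
    case False
    have *: "\<bar>Im (p z * cnj q)\<bar> \<le> (1 / cmod (e i)) * (cmod (L z) * cmod q)" for z
    proof -
      have "Im (L z * cnj q) = Re (e i) * Im (p z * cnj q)" using r by (simp add: L_def algebra_simps)
      moreover have "cmod (e i) = \<bar>Re (e i)\<bar>" using r by (simp add: cmod_def)
      ultimately have "cmod (e i) * \<bar>Im (p z * cnj q)\<bar> \<le> cmod (L z) * cmod q"
        using abs_Im_le_cmod[of "L z * cnj q"] by (simp add: abs_mult norm_mult)
      thus ?thesis using False by (simp add: field_simps)
    qed
    show ?thesis by (rule that[OF _ _ *]) (use False in auto)
  next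
    case True
    hence c: "c i \<noteq> 0" using node_coefficients_nonzero[OF i(1)] by simp
    have *: "\<bar>Im (p z * cnj q)\<bar> \<le> (1 / cmod (c i)) * (cmod (L z) * cmod (p z))" for z
    proof -
      have "Im (L z * cnj (p z)) = Re (c i) * Im (p z * cnj q)" using r by (simp add: L_def algebra_simps)
      moreover have "cmod (c i) = \<bar>Re (c i)\<bar>" using r by (simp add: cmod_def)
      ultimately have "cmod (c i) * \<bar>Im (p z * cnj q)\<bar> \<le> cmod (L z) * cmod (p z)"
        using abs_Im_le_cmod[of "L z * cnj (p z)"] by (simp add: abs_mult norm_mult)
      thus ?thesis using c by (simp add: field_simps)
    qed
    show ?thesis by (rule that[OF _ _ *]) (use c in auto)
  qed
  have "((\<lambda>z. \<beta> * (1 + M) * cmod (u z / h i z)) \<longlongrightarrow> \<beta> * (1 + M) * cmod 0) (at_node M i)"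
    by (intro tendsto_intros good_quotient_null[OF i(2) M u])
  hence lim: "((\<lambda>z. \<beta> * (1 + M) * cmod (u z / h i z)) \<longlongrightarrow> 0) (at_node M i)" by simp
  have "\<forall>\<^sub>F z in at_node M i. norm (cmod (param_kernel z z) / (cmod (h i z))\<^sup>2) \<le> \<beta> * (1 + M) * cmod (u z / h i z)"
    using eventually_at_node_sector good_h_nonzero[OF i(2) M]
  proof eventually_elim
    case (elim z)
    note s = stolz_sectorD[OF elim(1)]
    have zH: "z \<in> upper_half_plane" using elim(1) stolz_sector_subset by blast
    have hn: "cmod (h i z) > 0" using elim(2) by simp
    have L: "cmod (L z) = cmod (h i z) * cmod (z - of_real (x i))" using s(2) by (simp add: H_def L_def norm_divide)
    have "cmod (param_kernel z z) \<le> \<beta> * (cmod (L z) * cmod (u z)) / Im z"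
      unfolding cmod_param_kernel_diagonal[OF zH] using bound s by (intro divide_right_mono) auto
    also have "\<dots> = \<beta> * (cmod (h i z) * cmod (u z)) * (cmod (z - of_real (x i)) / Im z)" unfolding L by simp
    also have "\<dots> \<le> \<beta> * (cmod (h i z) * cmod (u z)) * (1 + M)"
      using \<beta> s by (intro mult_left_mono) (auto simp: pos_divide_le_eq)
    finally have "cmod (param_kernel z z) / (cmod (h i z))\<^sup>2 \<le> \<beta> * (cmod (h i z) * cmod (u z)) * (1 + M) / (cmod (h i z))\<^sup>2"
      by (intro divide_right_mono) auto
    also have "\<dots> = \<beta> * (1 + M) * cmod (u z / h i z)" using hn by (simp add: norm_divide power2_eq_square)
    finally show ?case by simp
  qed
  with lim show ?thesis by (rule Lim_null_comparison[rotated])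
qed

end

section \<open>The number of negative squares\<close>

lemma qform_perturbation:
  assumes "\<And>a b. a < n \<Longrightarrow> b < n \<Longrightarrow> cmod (A a b - B a b) \<le> \<epsilon>"
  shows "Re (qform n A v) \<le> Re (qform n B v) + \<epsilon> * n * (\<Sum>a<n. (cmod (v a))\<^sup>2)"
proof -
  have t: "Re (cnj (v a) * A a b * v b) \<le> Re (cnj (v a) * B a b * v b) + \<epsilon> * (((cmod (v a))\<^sup>2 + (cmod (v b))\<^sup>2) / 2)"
    if ab: "a < n" "b < n" for a b
  proof -
    have "Re (cnj (v a) * A a b * v b) - Re (cnj (v a) * B a b * v b) = Re (cnj (v a) * (A a b - B a b) * v b)"
      by (simp add: algebra_simps)
    also have "\<dots> \<le> cmod (A a b - B a b) * (cmod (v a) * cmod (v b))"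
      using complex_Re_le_cmod[of "cnj (v a) * (A a b - B a b) * v b"] by (simp add: norm_mult mult_ac)
    also have "\<dots> \<le> \<epsilon> * (cmod (v a) * cmod (v b))" using assms[OF ab] by (intro mult_right_mono) auto
    also have "\<dots> \<le> \<epsilon> * (((cmod (v a))\<^sup>2 + (cmod (v b))\<^sup>2) / 2)"
    proof (rule mult_left_mono)
      show "cmod (v a) * cmod (v b) \<le> ((cmod (v a))\<^sup>2 + (cmod (v b))\<^sup>2) / 2"
        using sum_squares_bound[of "cmod (v a)" "cmod (v b)"] by simp
      show "0 \<le> \<epsilon>" using assms[OF ab] norm_ge_zero order_trans by blast
    qed
    finally show ?thesis by simp
  qed
  have "Re (qform n A v) \<le> (\<Sum>a<n. \<Sum>b<n. Re (cnj (v a) * B a b * v b) + \<epsilon> * (((cmod (v a))\<^sup>2 + (cmod (v b))\<^sup>2) / 2))"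
    unfolding qform_def Re_sum by (intro sum_mono t) auto
  also have "\<dots> = Re (qform n B v) + \<epsilon> * ((\<Sum>a<n. \<Sum>b<n. (cmod (v a))\<^sup>2) / 2 + (\<Sum>a<n. \<Sum>b<n. (cmod (v b))\<^sup>2) / 2)"
    unfolding qform_def Re_sum
    by (simp add: sum.distrib sum_distrib_left sum_divide_distrib add_divide_distrib distrib_left mult_ac)
  also have "(\<Sum>a<n. \<Sum>b<n. (cmod (v a))\<^sup>2) = n * (\<Sum>a<n. (cmod (v a))\<^sup>2)" by (simp add: sum_distrib_left)
  also have "(\<Sum>a<n. \<Sum>b<n. (cmod (v b))\<^sup>2) = n * (\<Sum>a<n. (cmod (v a))\<^sup>2)" by simp
  finally have "Re (qform n A v) \<le> Re (qform n B v) +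
      \<epsilon> * (n * (\<Sum>a<n. (cmod (v a))\<^sup>2) / 2 + n * (\<Sum>a<n. (cmod (v a))\<^sup>2) / 2)" .
  moreover have "\<epsilon> * (n * S / 2 + n * S / 2) = \<epsilon> * n * S" for S :: real by simp
  ultimately show ?thesis by (simp only:)
qed

context pick_lft
begin

text \<open>One point is taken near each node, and \<open>A m\<close> is the kernel matrix rescaled
  by the factors den / h_a. Its parameter part decays on the diagonal, and Cauchy-Schwarz extends
  the decay to pairs of different nodes.\<close>

lemma sq_neg_kernel_ge:
  assumes good: "\<And>i. i < n \<Longrightarrow> good i" and n: "n > 0"
  obtains zs where "zs \<noteq> []" "set zs \<subseteq> analyticity_domain w"
    "sq_neg (Matrix.mat n n (\<lambda>(i, j). P i j)) \<le> sq_neg (kernel_matrix w zs)"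
proof -
  let ?P = "Matrix.mat n n (\<lambda>(i, j). P i j)"
  have P: "?P \<in> carrier_mat n n" by simp
  have herm: "hermitian ?P" by (rule hermitianI[OF P]) (simp add: P_real P_sym)
  have qP: "qform n (\<lambda>i j. ?P $$ (i, j)) v = qform n P v" for v by (simp add: qform_def)
  obtain K :: "nat set" and V \<delta> where K: "finite K" "card K = sq_neg ?P" "\<delta> > 0"
    "\<forall>b. (\<Sum>i<n. (cmod (\<Sum>k\<in>K. V k i * b k))\<^sup>2) = (\<Sum>k\<in>K. (cmod (b k))\<^sup>2)"
    "\<forall>b. Re (qform n (\<lambda>i j. ?P $$ (i, j)) (\<lambda>i. \<Sum>k\<in>K. V k i * b k)) \<le> - \<delta> * (\<Sum>k\<in>K. (cmod (b k))\<^sup>2)"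
    by (rule sq_neg_negative_subspace[OF P herm])
  define Z where "Z a m = complex_of_real (x a) + \<i> * of_real (inverse (real (Suc m)))" for a m
  have Z: "Z a m \<in> stolz_sector (x a) 1" for a m by (simp add: Z_def stolz_sector_def)
  have ZH: "Z a m \<in> upper_half_plane" for a m using Z stolz_sector_subset by blast
  have "Z a \<longlonglongrightarrow> of_real (x a) + \<i> * of_real 0" for a
    unfolding Z_def by (intro tendsto_intros LIMSEQ_inverse_real_of_nat)
  hence "Z a \<longlonglongrightarrow> of_real (x a)" for a by simp
  hence flt: "filterlim (Z a) (at_node 1 a) sequentially" for a
    using Z by (intro filterlim_stolz_sequence) auto
  define A where "A m a b = (\<Sum>i<n. \<Sum>j<n. cnj (h i (Z a m) / h a (Z a m)) * P i j * (h j (Z b m) / h b (Z b m)))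
      + param_kernel (Z b m) (Z a m) / (cnj (h a (Z a m)) * h b (Z b m))" for m a b
  have A_lim: "(\<lambda>m. A m a b) \<longlonglongrightarrow> P a b" if ab: "a < n" "b < n" for a b
  proof -
    have one: "0 < (1 :: real)" by simp
    have r: "(\<lambda>m. h j (Z a m) / h a (Z a m)) \<longlonglongrightarrow> (if j = a then 1 else 0)" if "a < n" "j < n" for a j
      using filterlim_compose[OF good_h_ratio[OF good[OF that(1)] one that] flt] .
    have k: "(\<lambda>m. cmod (param_kernel (Z a m) (Z a m)) / (cmod (h a (Z a m)))\<^sup>2) \<longlonglongrightarrow> 0" if "a < n" for a
      using filterlim_compose[OF good_param_kernel_null[OF that good[OF that] one] flt] .
    have "(\<lambda>m. sqrt ((cmod (param_kernel (Z b m) (Z b m)) / (cmod (h b (Z b m)))\<^sup>2) * (cmod (param_kernel (Z a m) (Z a m)) / (cmod (h a (Z a m)))\<^sup>2)))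
        \<longlonglongrightarrow> sqrt (0 * 0)"
      by (intro tendsto_intros k ab)
    hence lim0: "(\<lambda>m. sqrt ((cmod (param_kernel (Z b m) (Z b m)) / (cmod (h b (Z b m)))\<^sup>2) * (cmod (param_kernel (Z a m) (Z a m)) / (cmod (h a (Z a m)))\<^sup>2)))
        \<longlonglongrightarrow> 0" by simp
    have "(\<lambda>m. param_kernel (Z b m) (Z a m) / (cnj (h a (Z a m)) * h b (Z b m))) \<longlonglongrightarrow> 0"
    proof (rule Lim_null_comparison[OF _ lim0], rule always_eventually, rule allI, rule real_le_rsqrt)
      fix m
      have "(cmod (param_kernel (Z b m) (Z a m)))\<^sup>2 \<le> cmod (param_kernel (Z b m) (Z b m)) * cmod (param_kernel (Z a m) (Z a m))"
        by (rule param_kernel_cauchy_schwarz[OF ZH ZH])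
      hence "(cmod (param_kernel (Z b m) (Z a m)))\<^sup>2 / ((cmod (h a (Z a m)))\<^sup>2 * (cmod (h b (Z b m)))\<^sup>2)
        \<le> cmod (param_kernel (Z b m) (Z b m)) * cmod (param_kernel (Z a m) (Z a m)) / ((cmod (h a (Z a m)))\<^sup>2 * (cmod (h b (Z b m)))\<^sup>2)"
        by (intro divide_right_mono) auto
      thus "(norm (param_kernel (Z b m) (Z a m) / (cnj (h a (Z a m)) * h b (Z b m))))\<^sup>2
        \<le> cmod (param_kernel (Z b m) (Z b m)) / (cmod (h b (Z b m)))\<^sup>2 * (cmod (param_kernel (Z a m) (Z a m)) / (cmod (h a (Z a m)))\<^sup>2)"
        by (simp add: norm_divide norm_mult power_divide power_mult_distrib mult_ac)
    qed
    moreover have "(\<lambda>m. \<Sum>i<n. \<Sum>j<n. cnj (h i (Z a m) / h a (Z a m)) * P i j * (h j (Z b m) / h b (Z b m)))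
        \<longlonglongrightarrow> (\<Sum>i<n. \<Sum>j<n. cnj (if i = a then 1 else 0) * P i j * (if j = b then 1 else 0))"
      by (intro tendsto_sum tendsto_mult tendsto_cnj tendsto_const r ab) auto
    moreover have "(\<Sum>i<n. \<Sum>j<n. cnj (if i = a then 1 else 0) * P i j * (if j = b then 1 else 0)) = P a b"
    proof -
      have "(\<Sum>i<n. \<Sum>j<n. cnj (if i = a then 1 else 0) * P i j * (if j = b then 1 else 0)) = (\<Sum>i<n. \<Sum>j<n. if j = b then (if i = a then P i j else 0) else 0)"
        by (intro sum.cong refl) auto
      also have "\<dots> = P a b" using ab by simp
      finally show ?thesis .
    qed
    ultimately have "(\<lambda>m. A m a b) \<longlonglongrightarrow> P a b + 0" unfolding A_def by (intro tendsto_add) auto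
    thus ?thesis by simp
  qed
  \<comment> \<open>An entrywise error \<epsilon> changes the form by at most \<epsilon> n |v|^2 =
    (\<delta> / 2) |v|^2, half of the negative gap of P.\<close>
  define \<epsilon> where "\<epsilon> = \<delta> / (2 * n)"
  have \<epsilon>: "\<epsilon> > 0" using K(3) n by (simp add: \<epsilon>_def)
  have "\<forall>\<^sub>F m in sequentially. \<forall>a\<in>{..<n}. den (Z a m) \<noteq> 0 \<and> h a (Z a m) \<noteq> 0 \<and> (\<forall>b\<in>{..<n}. cmod (A m a b - P a b) < \<epsilon>)"
  proof (intro eventually_ball_finite finite_lessThan ballI eventually_conj)
    fix a assume a: "a \<in> {..<n}"
    show "\<forall>\<^sub>F m in sequentially. den (Z a m) \<noteq> 0"
      by (rule eventually_compose_filterlim[OF good_den_nonzero flt]) (use good a in auto)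
    show "\<forall>\<^sub>F m in sequentially. h a (Z a m) \<noteq> 0"
      by (rule eventually_compose_filterlim[OF good_h_nonzero flt]) (use good a in auto)
    fix b assume b: "b \<in> {..<n}"
    show "\<forall>\<^sub>F m in sequentially. cmod (A m a b - P a b) < \<epsilon>"
      using tendstoD[OF A_lim[of a b] \<epsilon>] a b by (simp add: dist_norm)
  qed
  then obtain m where m: "\<And>a. a < n \<Longrightarrow> den (Z a m) \<noteq> 0" "\<And>a. a < n \<Longrightarrow> h a (Z a m) \<noteq> 0"
    "\<And>a b. a < n \<Longrightarrow> b < n \<Longrightarrow> cmod (A m a b - P a b) < \<epsilon>"
    unfolding eventually_sequentially by (metis lessThan_iff order_refl)
  define zs where "zs = map (\<lambda>a. Z a m) [0..<n]"
  have zs: "zs ! a = Z a m" if "a < n" for a using that by (auto simp: zs_def)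
  have len: "length zs = n" by (simp add: zs_def)
  have dom: "Z a m \<in> analyticity_domain w" if "a < n" for a using m(1)[OF that] ZH by (simp add: w_domain)
  have "card K \<le> sq_neg (kernel_matrix w zs)"
  \<comment> \<open>Scaling the negative directions of P by den / h_a undoes the congruence, so the
    form of the kernel matrix at these vectors is the form of \<open>A m\<close> at
    \<open>v\<close>.\<close>
  proof (rule sq_neg_ge[OF kernel_matrix_carrier hermitian_kernel_matrix K(1), where V = "\<lambda>k a. den (Z a m) / h a (Z a m) * V k a"])
    fix b :: "nat \<Rightarrow> complex"
    assume b: "\<exists>j\<in>K. b j \<noteq> 0"
    define v where "v a = (\<Sum>k\<in>K. V k a * b k)" for a
    have pos: "(\<Sum>k\<in>K. (cmod (b k))\<^sup>2) > 0" using b K(1) by (auto intro: sum_pos2)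
    have ca: "(\<Sum>k\<in>K. den (Z a m) / h a (Z a m) * V k a * b k) = den (Z a m) / h a (Z a m) * v a" for a
      unfolding v_def sum_distrib_left by (intro sum.cong refl) (simp add: mult_ac)
    have "qform (length zs) (\<lambda>i j. kernel_matrix w zs $$ (i, j)) (\<lambda>a. \<Sum>k\<in>K. den (Z a m) / h a (Z a m) * V k a * b k)
      = qform n (A m) v"
      unfolding qform_kernel_matrix unfolding ca len unfolding qform_def
    proof (intro sum.cong refl)
      fix a a' assume "a \<in> {..<n}" "a' \<in> {..<n}"
      hence a: "a < n" "a' < n" by auto
      have "A m a a' = ((\<Sum>i<n. \<Sum>j<n. cnj (h i (Z a m)) * P i j * h j (Z a' m)) + param_kernel (Z a' m) (Z a m)) / (cnj (h a (Z a m)) * h a' (Z a' m))"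
        by (simp add: A_def add_divide_distrib sum_divide_distrib mult_ac)
      also have "\<dots> = pick_kernel w (Z a' m) (Z a m) * den (Z a' m) * cnj (den (Z a m)) / (cnj (h a (Z a m)) * h a' (Z a' m))"
        by (simp only: w_kernel[OF dom[OF a(2)] dom[OF a(1)]])
      finally show "cnj (den (Z a m) / h a (Z a m) * v a) * pick_kernel w (zs ! a') (zs ! a) * (den (Z a' m) / h a' (Z a' m) * v a')
          = cnj (v a) * A m a a' * v a'"
        by (simp add: zs a mult_ac)
    qed
    also have "Re \<dots> \<le> Re (qform n P v) + \<epsilon> * n * (\<Sum>a<n. (cmod (v a))\<^sup>2)"
      using m(3) by (intro qform_perturbation) (auto intro: less_imp_le)
    also have "\<dots> \<le> - \<delta> * (\<Sum>k\<in>K. (cmod (b k))\<^sup>2) + \<delta> / 2 * (\<Sum>k\<in>K. (cmod (b k))\<^sup>2)"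
    proof (rule add_mono)
      show "Re (qform n P v) \<le> - \<delta> * (\<Sum>k\<in>K. (cmod (b k))\<^sup>2)"
        using K(5)[rule_format, of b] unfolding qP v_def[symmetric] .
      have "\<epsilon> * n = \<delta> / 2" using n by (simp add: \<epsilon>_def)
      moreover have "(\<Sum>a<n. (cmod (v a))\<^sup>2) = (\<Sum>k\<in>K. (cmod (b k))\<^sup>2)"
        using K(4)[rule_format, of b] unfolding v_def[symmetric] .
      ultimately show "\<epsilon> * n * (\<Sum>a<n. (cmod (v a))\<^sup>2) \<le> \<delta> / 2 * (\<Sum>k\<in>K. (cmod (b k))\<^sup>2)"
        by (simp only: order_refl)
    qed
    also have "\<dots> = - (\<delta> / 2) * (\<Sum>k\<in>K. (cmod (b k))\<^sup>2)" by (simp add: algebra_simps)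
    also have "\<dots> < 0" using pos K(3) by (simp add: mult_less_0_iff)
    finally show "Re (qform (length zs) (\<lambda>i j. kernel_matrix w zs $$ (i, j))
        (\<lambda>a. \<Sum>k\<in>K. den (Z a m) / h a (Z a m) * V k a * b k)) < 0" .
  qed
  moreover have "zs \<noteq> []" using n len by auto
  moreover have "set zs \<subseteq> analyticity_domain w" using dom by (auto simp: zs_def)
  ultimately show ?thesis using that K(2) by simp
qed

lemma good_imp_nevanlinna:
  assumes "\<And>i. i < n \<Longrightarrow> good i" "n > 0"
  shows "w \<in> nevanlinna (sq_neg (Matrix.mat n n (\<lambda>(i, j). P i j)))"
proof -
  obtain zs where zs: "zs \<noteq> []" "set zs \<subseteq> analyticity_domain w"
    "sq_neg (Matrix.mat n n (\<lambda>(i, j). P i j)) \<le> sq_neg (kernel_matrix w zs)"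
    by (rule sq_neg_kernel_ge[OF assms])
  with sq_neg_kernel_le mero show ?thesis unfolding nevanlinna_def by (auto intro!: exI[of _ zs] antisym)
qed

lemma node_solved_iff: "i < n \<Longrightarrow> node_solved i \<longleftrightarrow> node_cond (e i) (c i) \<phi> (x i)"
  using node_dichotomy[OF param e_real c_real node_coefficients_nonzero] good_imp_solved bad_imp_not_solved by metis

end

section \<open>The interpolation problem\<close>

lemma boundary_value_unique: "boundary_value \<phi> x L \<Longrightarrow> boundary_value \<phi> x L' \<Longrightarrow> L = L'"
  using nt_limit_unique by (auto simp: boundary_value_def split: with_infty.splits)

lemma conditions_iff_node_cond:
  "(e_tilde \<Omega> i \<noteq> 0 \<longrightarrow> cond_C1 \<Omega> \<phi> i \<or> cond_C2 \<Omega> \<phi> i) \<and>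
   (e_tilde \<Omega> i = 0 \<longrightarrow> cond_C1_tilde \<Omega> \<phi> i \<or> cond_C2_tilde \<Omega> \<phi> i) \<longleftrightarrow>
   node_cond (e_tilde \<Omega> i) (c_tilde \<Omega> i) \<phi> (node \<Omega> i)"
proof -
  have "cond_C1 \<Omega> \<phi> i \<longleftrightarrow> \<not> boundary_value \<phi> (node \<Omega> i) (Value (eta \<Omega> i))"
    unfolding cond_C1_def using boundary_value_unique by blast
  thus ?thesis unfolding node_cond_def cond_C2_def cond_C1_tilde_def cond_C2_tilde_def eta_def by blast
qed

section \<open>The given data and Theta in coordinates\<close>

lemma inv_mat:
  assumes A: "A \<in> carrier_mat n n" and inv: "invertible_mat A"
  shows "inv_mat A \<in> carrier_mat n n" "A * inv_mat A = 1\<^sub>m n" "inv_mat A * A = 1\<^sub>m n"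
proof -
  obtain B where B: "inverts_mat A B" "inverts_mat B A" using inv by (auto simp: invertible_mat_def)
  have AB: "A * B = 1\<^sub>m n" using B(1) A by (simp add: inverts_mat_def)
  have BA: "B * A = 1\<^sub>m (dim_row B)" using B(2) by (simp add: inverts_mat_def)
  have "dim_col B = n" using arg_cong[OF AB, of dim_col] by simp
  moreover have "dim_row B = n" using arg_cong[OF BA, of dim_col] A by simp
  ultimately have Bc: "B \<in> carrier_mat n n" by auto
  have "A \<in> Units (ring_mat TYPE(complex) n ())"
    unfolding Units_def ring_mat_def using A Bc AB BA by auto
  with mat_inverse(1)[OF A, of "()"] obtain B' where "mat_inverse A = Some B'" by (cases "mat_inverse A") auto
  with mat_inverse(2)[OF A this] show "inv_mat A \<in> carrier_mat n n" "A * inv_mat A = 1\<^sub>m n" "inv_mat A * A = 1\<^sub>m n"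
    by (auto simp: inv_mat_def)
qed

lemma inv_mat_diag:
  assumes nz: "\<And>i. i < n \<Longrightarrow> d i \<noteq> (0 :: complex)"
  shows "inv_mat (mat_diag n d) = mat_diag n (\<lambda>i. inverse (d i))"
proof -
  have c: "mat_diag n d \<in> carrier_mat n n" "mat_diag n (\<lambda>i. inverse (d i)) \<in> carrier_mat n n" by auto
  have 1: "mat_diag n d * mat_diag n (\<lambda>i. inverse (d i)) = 1\<^sub>m n" "mat_diag n (\<lambda>i. inverse (d i)) * mat_diag n d = 1\<^sub>m n"
    unfolding mat_diag_diag using nz by (auto simp: mat_diag_def intro!: eq_matI)
  have "invertible_mat (mat_diag n d)"
    unfolding invertible_mat_def inverts_mat_def
    using 1 carrier_matD[OF c(1)] carrier_matD[OF c(2)] by (auto intro!: exI[of _ "mat_diag n (\<lambda>i. inverse (d i))"])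
  note inv = inv_mat[OF c(1) this]
  have "inv_mat (mat_diag n d) = inv_mat (mat_diag n d) * (mat_diag n d * mat_diag n (\<lambda>i. inverse (d i)))"
    unfolding 1 using inv(1) by simp
  also have "\<dots> = (inv_mat (mat_diag n d) * mat_diag n d) * mat_diag n (\<lambda>i. inverse (d i))"
    by (rule assoc_mult_mat[OF inv(1) c, symmetric])
  finally show ?thesis unfolding inv using c by simp
qed

definition C_entry :: "interp_data \<Rightarrow> nat \<Rightarrow> complex" where
  "C_entry \<Omega> j = complex_of_real (if j < ell \<Omega> then val \<Omega> j else res \<Omega> j)"

definition E_entry :: "interp_data \<Rightarrow> nat \<Rightarrow> complex" where
  "E_entry \<Omega> j = (if j < ell \<Omega> then 1 else 0)"

abbreviation P_entry :: "interp_data \<Rightarrow> nat \<Rightarrow> nat \<Rightarrow> complex" where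
  "P_entry \<Omega> i j \<equiv> complex_of_real (pick_entry \<Omega> i j)"

lemma pick_entry_sym: "pick_entry \<Omega> i j = pick_entry \<Omega> j i"
proof -
  have "(a - b) / (c - d) = (b - a) / (d - c)" for a b c d :: real
    by (metis minus_diff_eq minus_divide_divide)
  thus ?thesis by (auto simp: pick_entry_def)
qed

lemma pick_matrix_carrier: "pick_matrix \<Omega> \<in> carrier_mat (num \<Omega>) (num \<Omega>)"
  by (simp add: pick_matrix_def)

lemma mat_mult_entry:
  assumes "A \<in> carrier_mat n m" "B \<in> carrier_mat m l" "i < n" "j < l"
  shows "(A * B) $$ (i, j) = (\<Sum>k<m. A $$ (i, k) * B $$ (k, j))"
  using assms by (auto simp: scalar_prod_def atLeast0LessThan)

text \<open>This is (R P^{-1}) P = R, written as a linear system for the row by means of the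
  symmetry of P.\<close>

lemma row_times_inv_mat:
  assumes inv: "invertible_mat (pick_matrix \<Omega>)" and R: "R \<in> carrier_mat 1 (num \<Omega>)" and i: "i < num \<Omega>"
  shows "(\<Sum>j<num \<Omega>. P_entry \<Omega> i j * (R * inv_mat (pick_matrix \<Omega>)) $$ (0, j)) = R $$ (0, i)"
proof -
  note I = inv_mat[OF pick_matrix_carrier inv]
  let ?T = "R * inv_mat (pick_matrix \<Omega>)"
  have T: "?T \<in> carrier_mat 1 (num \<Omega>)" using R I(1) by simp
  have "?T * pick_matrix \<Omega> = R * (inv_mat (pick_matrix \<Omega>) * pick_matrix \<Omega>)"
    by (rule assoc_mult_mat[OF R I(1) pick_matrix_carrier])
  hence "?T * pick_matrix \<Omega> = R" using I(3) R by simp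
  from arg_cong[OF this, of "\<lambda>A. A $$ (0, i)"]
  have "R $$ (0, i) = (\<Sum>j<num \<Omega>. ?T $$ (0, j) * pick_matrix \<Omega> $$ (j, i))"
    using mat_mult_entry[OF T pick_matrix_carrier _ i, of 0] by simp
  also have "\<dots> = (\<Sum>j<num \<Omega>. P_entry \<Omega> i j * ?T $$ (0, j))"
    using i by (intro sum.cong refl) (simp add: pick_matrix_def pick_entry_sym[of \<Omega> i])
  finally show ?thesis by simp
qed

lemma P_entry_times_c_tilde:
  assumes "invertible_mat (pick_matrix \<Omega>)" "i < num \<Omega>"
  shows "(\<Sum>j<num \<Omega>. P_entry \<Omega> i j * c_tilde \<Omega> j) = C_entry \<Omega> i"
    "(\<Sum>j<num \<Omega>. P_entry \<Omega> i j * e_tilde \<Omega> j) = E_entry \<Omega> i"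
  using row_times_inv_mat[OF assms(1) _ assms(2), of "C_row \<Omega>"] row_times_inv_mat[OF assms(1) _ assms(2), of "E_row \<Omega>"] assms(2)
  unfolding c_tilde_def e_tilde_def by (auto simp: C_row_def E_row_def C_entry_def E_entry_def)

lemma P_entry_injective:
  assumes inv: "invertible_mat (pick_matrix \<Omega>)"
    and v: "\<And>i. i < num \<Omega> \<Longrightarrow> (\<Sum>j<num \<Omega>. P_entry \<Omega> i j * u j) = (\<Sum>j<num \<Omega>. P_entry \<Omega> i j * v j)" and k: "k < num \<Omega>"
  shows "u k = v k"
proof -
  note I = inv_mat[OF pick_matrix_carrier inv]
  let ?n = "num \<Omega>"
  have eq: "pick_matrix \<Omega> *\<^sub>v Matrix.vec ?n u = pick_matrix \<Omega> *\<^sub>v Matrix.vec ?n v"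
    using v by (intro eq_vecI) (auto simp: pick_matrix_def scalar_prod_def atLeast0LessThan)
  have inj: "inv_mat (pick_matrix \<Omega>) *\<^sub>v (pick_matrix \<Omega> *\<^sub>v Matrix.vec ?n r) = Matrix.vec ?n r" for r
    using assoc_mult_mat_vec[OF I(1) pick_matrix_carrier, of "Matrix.vec ?n r"] I(3) by simp
  have "Matrix.vec ?n u = Matrix.vec ?n v" using inj[of u] inj[of v] unfolding eq by simp
  thus ?thesis using k by (metis index_vec)
qed

text \<open>P, C and E are real, so the conjugate solves the same linear system, whose solution is
  unique.\<close>

lemma tilde_real:
  assumes inv: "invertible_mat (pick_matrix \<Omega>)" and k: "k < num \<Omega>"
  shows "cnj (c_tilde \<Omega> k) = c_tilde \<Omega> k" "cnj (e_tilde \<Omega> k) = e_tilde \<Omega> k"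
proof -
  have *: "(\<Sum>j<num \<Omega>. P_entry \<Omega> i j * cnj (v j)) = cnj (\<Sum>j<num \<Omega>. P_entry \<Omega> i j * v j)" for i v by simp
  show "cnj (c_tilde \<Omega> k) = c_tilde \<Omega> k"
    by (rule P_entry_injective[OF inv _ k, where u = "\<lambda>k. cnj (c_tilde \<Omega> k)"])
       (simp only: * P_entry_times_c_tilde[OF inv], simp add: C_entry_def)
  show "cnj (e_tilde \<Omega> k) = e_tilde \<Omega> k"
    by (rule P_entry_injective[OF inv _ k, where u = "\<lambda>k. cnj (e_tilde \<Omega> k)"])
       (simp only: * P_entry_times_c_tilde[OF inv], simp add: E_entry_def)
qed

lemma pick_data_interp:
  assumes \<Omega>: "interpolation_data \<Omega>" and inv: "invertible_mat (pick_matrix \<Omega>)"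
  shows "pick_data (num \<Omega>) (node \<Omega>) (P_entry \<Omega>) (\<lambda>j k. inv_mat (pick_matrix \<Omega>) $$ (j, k))
           (C_entry \<Omega>) (E_entry \<Omega>) (c_tilde \<Omega>) (e_tilde \<Omega>)"
proof
  show "inj_on (node \<Omega>) {..<num \<Omega>}" using \<Omega> by (simp add: interpolation_data_def)
  show "P_entry \<Omega> i j = P_entry \<Omega> j i" for i j by (simp add: pick_entry_sym[of \<Omega> i j])
  fix i j assume ij: "i < num \<Omega>" "j < num \<Omega>"
  have ne: "node \<Omega> j \<noteq> node \<Omega> i" if "i \<noteq> j"
    using \<Omega> ij that by (auto simp: interpolation_data_def inj_on_def)
  have "pick_entry \<Omega> i j * (node \<Omega> j - node \<Omega> i) =
      (if i < ell \<Omega> then 1 else 0) * (if j < ell \<Omega> then val \<Omega> j else res \<Omega> j)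
      - (if i < ell \<Omega> then val \<Omega> i else res \<Omega> i) * (if j < ell \<Omega> then 1 else 0)"
  proof (cases "i = j")
    case False
    from ne[OF this] show ?thesis using False by (auto simp: pick_entry_def field_simps)
  qed auto
  from arg_cong[OF this, of complex_of_real]
  show "P_entry \<Omega> i j * of_real (node \<Omega> j - node \<Omega> i) = E_entry \<Omega> i * C_entry \<Omega> j - C_entry \<Omega> i * E_entry \<Omega> j"
    by (simp add: E_entry_def C_entry_def)
  have "(pick_matrix \<Omega> * inv_mat (pick_matrix \<Omega>)) $$ (i, j) = (\<Sum>k<num \<Omega>. P_entry \<Omega> i k * inv_mat (pick_matrix \<Omega>) $$ (k, j))"
    using inv_mat(1)[OF pick_matrix_carrier inv] ij
    by (auto simp: pick_matrix_def scalar_prod_def atLeast0LessThan)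
  thus "(\<Sum>k<num \<Omega>. P_entry \<Omega> i k * inv_mat (pick_matrix \<Omega>) $$ (k, j)) = (if i = j then 1 else 0)"
    unfolding inv_mat(2)[OF pick_matrix_carrier inv] using ij by simp
next
  fix i assume i: "i < num \<Omega>"
  show "E_entry \<Omega> i = 1 \<or> E_entry \<Omega> i = 0 \<and> C_entry \<Omega> i \<noteq> 0 \<and> P_entry \<Omega> i i = - C_entry \<Omega> i"
    using \<Omega> i by (auto simp: E_entry_def C_entry_def pick_entry_def interpolation_data_def)
qed (simp_all add: tilde_real[OF inv] P_entry_times_c_tilde[OF inv] C_entry_def E_entry_def)

text \<open>J interchanges the two columns with factors i and -i. Combined with the outer -i they
  become +1 in the first column, which receives \<open>e_tilde\<close>, and -1 in the second, which
  receives \<open>c_tilde\<close>.\<close>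

lemma Theta_entries:
  assumes inv: "invertible_mat (pick_matrix \<Omega>)" and z: "z \<in> upper_half_plane"
  defines "s \<equiv> \<lambda>a b. \<Sum>j<num \<Omega>. a j * b j / (z - of_real (node \<Omega> j))"
  shows "Theta \<Omega> z $$ (0, 0) = 1 + s (C_entry \<Omega>) (e_tilde \<Omega>)"
    "Theta \<Omega> z $$ (0, 1) = - s (C_entry \<Omega>) (c_tilde \<Omega>)"
    "Theta \<Omega> z $$ (1, 0) = s (E_entry \<Omega>) (e_tilde \<Omega>)"
    "Theta \<Omega> z $$ (1, 1) = 1 - s (E_entry \<Omega>) (c_tilde \<Omega>)"
proof -
  let ?n = "num \<Omega>"
  define M where "M = C_row \<Omega> @\<^sub>r E_row \<Omega>"
  have M: "M \<in> carrier_mat 2 ?n"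
    using carrier_append_rows[of "C_row \<Omega>" 1 ?n "E_row \<Omega>" 1] by (simp add: M_def C_row_def E_row_def numeral_2_eq_2)
  have CE: "C_row \<Omega> \<in> carrier_mat 1 ?n" "E_row \<Omega> \<in> carrier_mat 1 ?n" by (auto simp: C_row_def E_row_def)
  have M_idx: "M $$ (0, j) = C_entry \<Omega> j" "M $$ (1, j) = E_entry \<Omega> j" if "j < ?n" for j
    using that CE unfolding M_def append_rows_def
    by (auto simp: C_row_def E_row_def C_entry_def E_entry_def)
  have M_cnj: "cnj (M $$ (r, j)) = M $$ (r, j)" if "r < 2" "j < ?n" for r j
    using that M_idx[OF that(2)] by (auto simp: less_2_cases_iff C_entry_def E_entry_def)
  note I = inv_mat[OF pick_matrix_carrier inv]
  note aM = mat_adjoint_carrier[OF M]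
  \<comment> \<open>As C and E are real, the columns of \<open>T\<close> solve the systems that
    characterize \<open>c_tilde\<close> and \<open>e_tilde\<close>.\<close>
  define T where "T = inv_mat (pick_matrix \<Omega>) * mat_adjoint M"
  have T: "T \<in> carrier_mat ?n 2" using I(1) aM by (simp add: T_def)
  have "pick_matrix \<Omega> * T = (pick_matrix \<Omega> * inv_mat (pick_matrix \<Omega>)) * mat_adjoint M"
    unfolding T_def by (rule assoc_mult_mat[OF pick_matrix_carrier I(1) aM, symmetric])
  hence PT: "pick_matrix \<Omega> * T = mat_adjoint M" using I(2) aM by simp
  have T_row: "(\<Sum>j<?n. P_entry \<Omega> i j * T $$ (j, r)) = M $$ (r, i)" if "i < ?n" "r < 2" for i r
  proof -
    have "(pick_matrix \<Omega> * T) $$ (i, r) = (\<Sum>j<?n. P_entry \<Omega> i j * T $$ (j, r))"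
      using that T by (auto simp: pick_matrix_def scalar_prod_def atLeast0LessThan)
    thus ?thesis unfolding PT using mat_adjoint_index[OF M that] M_cnj[OF that(2,1)] by simp
  qed
  have T_idx: "T $$ (j, 0) = c_tilde \<Omega> j" "T $$ (j, 1) = e_tilde \<Omega> j" if j: "j < ?n" for j
    by (rule P_entry_injective[OF inv _ j], simp add: T_row P_entry_times_c_tilde[OF inv] M_idx M_idx[simplified])+
  have "z \<cdot>\<^sub>m 1\<^sub>m ?n - node_matrix \<Omega> = mat_diag ?n (\<lambda>i. z - of_real (node \<Omega> i))"
    by (rule eq_matI) (auto simp: node_matrix_def mat_diag_def)
  moreover have "z - of_real (node \<Omega> i) \<noteq> 0" for i using z by (auto simp: upper_half_plane_def)
  ultimately have R: "inv_mat (z \<cdot>\<^sub>m 1\<^sub>m ?n - node_matrix \<Omega>) = mat_diag ?n (\<lambda>i. inverse (z - of_real (node \<Omega> i)))" (is "_ = ?R")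
    using inv_mat_diag[of ?n "\<lambda>i. z - of_real (node \<Omega> i)"] by simp
  have Rc: "?R \<in> carrier_mat ?n ?n" by simp
  have MR: "M * ?R = Matrix.mat 2 ?n (\<lambda>(r, j). M $$ (r, j) * inverse (z - of_real (node \<Omega> j)))"
    using M by (simp add: mat_diag_mult_right)
  define G where "G = M * ?R * T"
  have G: "G \<in> carrier_mat 2 2" using mult_carrier_mat[OF mult_carrier_mat[OF M Rc] T] by (simp add: G_def)
  have G_idx: "G $$ (r, t) = (\<Sum>j<?n. M $$ (r, j) * T $$ (j, t) / (z - of_real (node \<Omega> j)))" if "r < 2" "t < 2" for r t
    using that T unfolding G_def MR by (auto simp: scalar_prod_def atLeast0LessThan divide_inverse mult_ac intro!: sum.cong)
  have Jc: "J_matrix \<in> carrier_mat 2 2" by (auto simp: J_matrix_def mat_of_rows_list_def)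
  have J: "J_matrix $$ (0, 0) = 0" "J_matrix $$ (0, 1) = - \<i>" "J_matrix $$ (1, 0) = \<i>" "J_matrix $$ (1, 1) = 0"
    by (simp_all add: J_matrix_def mat_of_rows_list_def)
  have "M * ?R * inv_mat (pick_matrix \<Omega>) * mat_adjoint M = G"
    unfolding G_def T_def using M Rc I(1) aM by (intro assoc_mult_mat[of _ 2 ?n _ ?n _ 2]) auto
  hence Theta: "Theta \<Omega> z = 1\<^sub>m 2 - \<i> \<cdot>\<^sub>m (G * J_matrix)"
    unfolding Theta_def M_def[symmetric] R by simp
  have GJ: "(G * J_matrix) $$ (r, t) = G $$ (r, 0) * J_matrix $$ (0, t) + G $$ (r, 1) * J_matrix $$ (1, t)" if "r < 2" "t < 2" for r t
    using that G Jc by (auto simp: scalar_prod_def numeral_2_eq_2)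
  have Th: "Theta \<Omega> z $$ (r, t) = (if r = t then 1 else 0) - \<i> * (G $$ (r, 0) * J_matrix $$ (0, t) + G $$ (r, 1) * J_matrix $$ (1, t))"
    if "r < 2" "t < 2" for r t
    unfolding Theta using that G Jc GJ[OF that] by simp
  have g: "G $$ (0, 0) = s (C_entry \<Omega>) (c_tilde \<Omega>)" "G $$ (0, 1) = s (C_entry \<Omega>) (e_tilde \<Omega>)"
    "G $$ (1, 0) = s (E_entry \<Omega>) (c_tilde \<Omega>)" "G $$ (1, 1) = s (E_entry \<Omega>) (e_tilde \<Omega>)"
    unfolding s_def
    by (simp_all add: G_idx M_idx T_idx M_idx[simplified] T_idx[simplified] cong: sum.cong_simp)
  have ii: "\<i> * (a * \<i>) = - a" "\<i> * (\<i> * a) = - a" for a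
    by (simp_all add: complex_eq_iff)
  show "Theta \<Omega> z $$ (0, 0) = 1 + s (C_entry \<Omega>) (e_tilde \<Omega>)"
    "Theta \<Omega> z $$ (0, 1) = - s (C_entry \<Omega>) (c_tilde \<Omega>)"
    "Theta \<Omega> z $$ (1, 0) = s (E_entry \<Omega>) (e_tilde \<Omega>)"
    "Theta \<Omega> z $$ (1, 1) = 1 - s (E_entry \<Omega>) (c_tilde \<Omega>)"
    using Th[of 0 0] Th[of 0 1] Th[of 1 0] Th[of 1 1] unfolding g J
    by (simp_all add: ii)
qed

lemma pick_lft_interp:
  assumes \<Omega>: "interpolation_data \<Omega>" and inv: "invertible_mat (pick_matrix \<Omega>)"
    and w: "w nicely_meromorphic_on upper_half_plane" and \<phi>: "\<phi> \<in> extended_nevanlinna"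
    and lft: "is_lft (Theta \<Omega>) \<phi> w"
  shows "pick_lft (num \<Omega>) (node \<Omega>) (P_entry \<Omega>) (\<lambda>j k. inv_mat (pick_matrix \<Omega>) $$ (j, k))
           (C_entry \<Omega>) (E_entry \<Omega>) (c_tilde \<Omega>) (e_tilde \<Omega>) \<phi> w"
proof -
  interpret pick_data "num \<Omega>" "node \<Omega>" "P_entry \<Omega>" "\<lambda>j k. inv_mat (pick_matrix \<Omega>) $$ (j, k)"
    "C_entry \<Omega>" "E_entry \<Omega>" "c_tilde \<Omega>" "e_tilde \<Omega>"
    by (rule pick_data_interp[OF \<Omega> inv])
  have lin: "(\<Sum>j<num \<Omega>. R j * ((e_tilde \<Omega> j * p - c_tilde \<Omega> j * q) / (z - of_real (node \<Omega> j)))) =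
      (\<Sum>j<num \<Omega>. R j * e_tilde \<Omega> j / (z - of_real (node \<Omega> j))) * p
      - (\<Sum>j<num \<Omega>. R j * c_tilde \<Omega> j / (z - of_real (node \<Omega> j))) * q" for R p q z
    unfolding sum_distrib_right sum_subtractf[symmetric]
    by (intro sum.cong refl) (simp add: diff_divide_distrib right_diff_distrib mult.assoc)
  have num: "lft_num (Theta \<Omega>) \<phi> z = N (hom_num \<phi> z) (hom_den \<phi>) z"
    and den: "lft_den (Theta \<Omega>) \<phi> z = D (hom_num \<phi> z) (hom_den \<phi>) z" if z: "z \<in> upper_half_plane" for z
    unfolding lft_num_def lft_den_def Theta_entries[OF inv z] N_def D_def H_def lin
    by (cases \<phi>; simp add: distrib_right)+
  have op: "open upper_half_plane" unfolding upper_half_plane_def by (rule open_halfspace_Im_gt)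
  \<comment> \<open>The entries of Theta are computed on the half plane only, so membership is added
    to the cosparse filter before rewriting.\<close>
  have "\<forall>\<^sub>\<approx>z\<in>upper_half_plane. z \<in> upper_half_plane" by (rule eventually_in_cosparse[OF order_refl op])
  with lft[unfolded is_lft_def]
  have "\<forall>\<^sub>\<approx>z\<in>upper_half_plane. D (hom_num \<phi> z) (hom_den \<phi>) z \<noteq> 0 \<and>
      w z = N (hom_num \<phi> z) (hom_den \<phi>) z / D (hom_num \<phi> z) (hom_den \<phi>) z"
    by eventually_elim (simp add: num den)
  thus ?thesis using \<phi> w by unfold_locales
qed

theorem theorem2p10:
  fixes \<Omega> :: interp_data
    and \<phi> :: "(complex \<Rightarrow> complex) with_infty"
    and w :: "complex \<Rightarrow> complex"
  assumes "interpolation_data \<Omega>"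
    and "invertible_mat (pick_matrix \<Omega>)"
    and "w nicely_meromorphic_on upper_half_plane"
    and "\<phi> \<in> extended_nevanlinna"
    and "is_lft (Theta \<Omega>) \<phi> w"
  shows "solves_BIP \<Omega> w \<longleftrightarrow>
    (\<forall>i<num \<Omega>.
       (e_tilde \<Omega> i \<noteq> 0 \<longrightarrow> cond_C1 \<Omega> \<phi> i \<or> cond_C2 \<Omega> \<phi> i) \<and>
       (e_tilde \<Omega> i = 0 \<longrightarrow> cond_C1_tilde \<Omega> \<phi> i \<or> cond_C2_tilde \<Omega> \<phi> i))"
proof -
  interpret pick_lft "num \<Omega>" "node \<Omega>" "P_entry \<Omega>" "\<lambda>j k. inv_mat (pick_matrix \<Omega>) $$ (j, k)"
    "C_entry \<Omega>" "E_entry \<Omega>" "c_tilde \<Omega>" "e_tilde \<Omega>" \<phi> w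
    by (rule pick_lft_interp[OF assms])
  have ell: "ell \<Omega> \<le> num \<Omega>" and num: "num \<Omega> > 0" using assms(1) by (auto simp: interpolation_data_def)
  have reg: "E_entry \<Omega> i = 1" "C_entry \<Omega> i = of_real (val \<Omega> i)" "P_entry \<Omega> i i = of_real (dval \<Omega> i)"
    if "i < ell \<Omega>" for i using that by (auto simp: E_entry_def C_entry_def pick_entry_def)
  have sing: "E_entry \<Omega> i = 0" "C_entry \<Omega> i = of_real (res \<Omega> i)"
    if "ell \<Omega> \<le> i" for i using that by (auto simp: E_entry_def C_entry_def)
  have "solves_BIP \<Omega> w \<longleftrightarrow> (\<forall>i<num \<Omega>. node_cond (e_tilde \<Omega> i) (c_tilde \<Omega> i) \<phi> (node \<Omega> i))"
  proof
    assume sol: "solves_BIP \<Omega> w"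
    show "\<forall>i<num \<Omega>. node_cond (e_tilde \<Omega> i) (c_tilde \<Omega> i) \<phi> (node \<Omega> i)"
    proof (intro allI impI)
      fix i assume i: "i < num \<Omega>"
      have "node_solved i"
      proof (cases "i < ell \<Omega>")
        case True
        hence "nt_limit w (node \<Omega> i) (Value (of_real (val \<Omega> i)))" "nt_limit (deriv w) (node \<Omega> i) (Value (of_real (dval \<Omega> i)))"
          using sol by (auto simp: solves_BIP_def)
        \<comment> \<open>The prescribed limit of w' is exchanged for the limit of the difference
          quotient, the form that \<open>node_solved\<close> requires.\<close>
        with quotient_limit_if_nt_limit_deriv[OF mero this] show ?thesis
          unfolding node_solved_def reg[OF True] by simp
      next
        case False
        hence "nt_limit (\<lambda>z. (z - of_real (node \<Omega> i)) * w z) (node \<Omega> i) (Value (of_real (res \<Omega> i)))"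
          using sol i by (auto simp: solves_BIP_def)
        thus ?thesis using False sing[of i] unfolding node_solved_def by simp
      qed
      thus "node_cond (e_tilde \<Omega> i) (c_tilde \<Omega> i) \<phi> (node \<Omega> i)" using node_solved_iff[OF i] by simp
    qed
  next
    assume cond: "\<forall>i<num \<Omega>. node_cond (e_tilde \<Omega> i) (c_tilde \<Omega> i) \<phi> (node \<Omega> i)"
    have good: "good i" if "i < num \<Omega>" for i
      using node_dichotomy(1)[OF param e_real[OF that] c_real[OF that] node_coefficients_nonzero[OF that]] cond that by blast
    have solved: "node_solved i" if "i < num \<Omega>" for i using good_imp_solved[OF that good[OF that]] .
    show "solves_BIP \<Omega> w" unfolding solves_BIP_def
    proof (intro conjI allI impI)
      show "w \<in> nevanlinna (sq_neg (pick_matrix \<Omega>))"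
        using good_imp_nevanlinna[OF good num] by (simp add: pick_matrix_def)
    next
      fix i assume i: "i < ell \<Omega>"
      hence i': "i < num \<Omega>" using ell by simp
      have s: "nt_limit w (node \<Omega> i) (Value (of_real (val \<Omega> i)))"
        "nt_limit (\<lambda>z. (w z - of_real (val \<Omega> i)) / (z - of_real (node \<Omega> i))) (node \<Omega> i) (Value (of_real (dval \<Omega> i)))"
        using solved[OF i'] unfolding node_solved_def reg[OF i] by simp_all
      show "nt_limit w (node \<Omega> i) (Value (of_real (val \<Omega> i)))" by (rule s)
      show "nt_limit (deriv w) (node \<Omega> i) (Value (of_real (dval \<Omega> i)))"
        by (rule nt_limit_deriv_if_quotient[OF good_imp_eventually_analytic[OF good[OF i'] _ i'] s(2)])
    next
      fix j assume j: "ell \<Omega> \<le> j \<and> j < num \<Omega>"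
      show "nt_limit (\<lambda>z. (z - of_real (node \<Omega> j)) * w z) (node \<Omega> j) (Value (of_real (res \<Omega> j)))"
        using solved[of j] j sing[of j] unfolding node_solved_def by simp
    qed
  qed
  thus ?thesis unfolding conditions_iff_node_cond .
qed

end
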